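(* Let $\tau>0$ and let the step-sizes be $\gamma_n=\gamma/n$ for some $\gamma>0$. For each agent $k=1,\dots,K$, starting from $\mathbf{Y}_k(1)=0$ and $\mathbf{X}_k(1)=\exp(\mathbf{Y}_k(1))/\operatorname{tr}[\exp(\mathbf{Y}_k(1))]$, consider the asynchronous recursion $$\mathbf{Y}_k(n+1)=\mathbf{Y}_k(n)-\gamma_{n_k}\,\mathbf{1}(k\in\mathcal{K}_n)\big(\hat{\mathbf{V}}_k(n)+\tau\mathbf{Y}_k(n)\big),\qquad \mathbf{X}_k(n+1)=\frac{\exp(\mathbf{Y}_k(n+1))}{\operatorname{tr}[\exp(\mathbf{Y}_k(n+1))]},$$ where $\mathcal{K}_n\subseteq\{1,\dots,K\}$ is the set of agents updating at the $n$-th overall update epoch and $n_k=\sum_{j=1}^n\mathbf{1}(k\in\mathcal{K}_j)$ is the number of updates performed by agent $k$ up to epoch $n$. Assume that: (i) the delay processes $d_k(n)$ are bounded almost surely; (ii) the set-valued process $\mathcal{K}_n$ is a homogeneous recurrent Markov chain, i.e. all agents update at a strictly positive rate; (iii) the imperfect gradient estimates $\hat{\mathbf{V}}_k(n)$ are uniformly bounded random Hermitian matrices satisfying $$\mathbb{E}[\hat{\mathbf{V}}_k(n)\mid\mathcal{F}_n]=\mathbf{V}_k\big(\mathbf{X}_1(n-d_1(n)),\dots,\mathbf{X}_K(n-d_K(n))\big).$$ Then, almost surely, the iterates $(\mathbf{X}_1(n),\dots,\mathbf{X}_K(n))$ converge to the unique minimizer of $$F_\tau(\mathbf{X}_1,\dots,\mathbf{X}_K)=F(\mathbf{X}_1,\dots,\mathbf{X}_K)+\tau\sum_{k=1}^K\operatorname{tr}[\mathbf{X}_k\log\mathbf{X}_k]$$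 over $\mathcal{X}=\prod_{k=1}^K\mathcal{X}_k$. In particular, the iterates converge within $\varepsilon(\tau)$ of a solution of the distributed stochastic problem: minimize $\mathbb{E}[f(\mathbf{X}_1,\dots,\mathbf{X}_K;\omega)]$ subject to $\mathbf{X}_k\in\mathcal{X}_k$, $k=1,\dots,K$; and the approximation error $\varepsilon(\tau)$ vanishes as $\tau\to0^+$.
   Context: $\mathcal{X}_k=\{\mathbf{X}_k\in\mathbb{C}^{M_k\times M_k}:\mathbf{X}_k\succeq0,\ \operatorname{tr}(\mathbf{X}_k)=1\}$ is the feasible region of agent $k$. $\omega$ is a random variable with values in a probability space $\Omega$; $f:\prod_k\mathcal{X}_k\times\Omega\to\mathbb{R}$ is smooth and is convex in $\mathbf{X}=(\mathbf{X}_1,\dots,\mathbf{X}_K)$ for all $\omega\in\Omega$; $F(\mathbf{X})=\mathbb{E}[f(\mathbf{X};\omega)]$ is assumed finite and smooth (it is convex). $\mathbf{V}_k(\mathbf{X})=\nabla_{\mathbf{X}_k}F(\mathbf{X})$ is the individual (Hermitian) gradient matrix of agent $k$. $d_k(n)$ is the number of periods that have elapsed at period $n$ since the last update of agent $k$. $\mathcal{F}_n$ is the filtration induced by the history of the process $\mathbf{X}(n)=(\mathbf{X}_1(n),\dots,\mathbf{X}_K(n))$. By convention $0\log0=0$.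
   Formalization: In (iii), F_n is taken as the history of the iterates together with the update sets K_1,…,K_n; with the history of X(n) alone the claim fails, since estimates may be biased on the epochs at which agent k actually updates. *)

theory Defs
  imports "HOL-Probability.Probability"
begin

text \<open>
  Agents are the elements of a finite type \<open>'k\<close>. Since the size \<open>M\<^sub>k\<close> may differ from agent to
  agent, all matrices live in one type \<open>complex^'n^'n\<close>, and agent \<open>k\<close> owns a nonempty set
  \<open>I k\<close> of indices with \<open>M\<^sub>k = card (I k)\<close>: a matrix of agent \<open>k\<close> is one that vanishes
  outside \<open>I k \<times> I k\<close>. These matrices form an algebra isomorphic to the \<open>M\<^sub>k \<times> M\<^sub>k\<close>
  matrices, whose unit is \<open>corner_one (I k)\<close>, not \<open>mat 1\<close>. Every family of sizes
  \<open>M\<^sub>k \<ge> 1\<close> arises in this way.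
\<close>

type_synonym ('n, 'k) profile = "complex^'n^'n^'k"

definition corner :: "'n set \<Rightarrow> (complex^'n^'n) set" where
  "corner S = {A. \<forall>i j. i \<notin> S \<or> j \<notin> S \<longrightarrow> A $ i $ j = 0}"

definition corner_one :: "'n set \<Rightarrow> complex^'n^'n" where
  "corner_one S = (\<chi> i j. if i = j \<and> i \<in> S then 1 else 0)"

definition ctranspose :: "complex^'n^'n \<Rightarrow> complex^'n^'n" where
  "ctranspose A = (\<chi> i j. cnj (A $ j $ i))"

definition hermitian :: "complex^'n^'n \<Rightarrow> bool" where
  "hermitian A \<longleftrightarrow> ctranspose A = A"

definition psd :: "complex^'n^'n \<Rightarrow> bool" where
  "psd A \<longleftrightarrow> hermitian A \<and>
     (\<forall>v. 0 \<le> Re (\<Sum>i\<in>UNIV. \<Sum>j\<in>UNIV. cnj (v $ i) * A $ i $ j * v $ j))"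

definition spectraplex :: "'n set \<Rightarrow> (complex^'n^'n) set" where
  "spectraplex S = {A \<in> corner S. psd A \<and> trace A = 1}"

definition feasible :: "('k::finite \<Rightarrow> 'n::finite set) \<Rightarrow> ('n, 'k) profile set" where
  "feasible I = {X. \<forall>k. X $ k \<in> spectraplex (I k)}"


subsection \<open>Matrix exponential and logarithm\<close>

primrec corner_power :: "'n set \<Rightarrow> complex^'n^'n \<Rightarrow> nat \<Rightarrow> complex^'n^'n" where
  "corner_power S A 0 = corner_one S"
| "corner_power S A (Suc m) = A ** corner_power S A m"

definition corner_exp :: "'n set \<Rightarrow> complex^'n^'n \<Rightarrow> complex^'n^'n" where
  "corner_exp S A = (\<Sum>m. corner_power S A m /\<^sub>R fact m)"

definition gibbs :: "'n set \<Rightarrow> complex^'n^'n \<Rightarrow> complex^'n^'n" where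
  "gibbs S A = (\<chi> i j. corner_exp S A $ i $ j / trace (corner_exp S A))"

definition unitary :: "complex^'n^'n \<Rightarrow> bool" where
  "unitary U \<longleftrightarrow> U ** ctranspose U = mat 1"

definition diag_mat :: "('n \<Rightarrow> real) \<Rightarrow> complex^'n^'n" where
  "diag_mat d = (\<chi> i j. if i = j then complex_of_real (d i) else 0)"

text \<open>
  Functional calculus for Hermitian matrices. The matrix \<open>B\<close> is determined by \<open>A\<close>: it does not
  depend on the chosen diagonalization.
\<close>

definition herm_fun :: "(real \<Rightarrow> real) \<Rightarrow> complex^'n^'n \<Rightarrow> complex^'n^'n" where
  "herm_fun g A = (THE B. \<exists>U d. unitary U \<and> A = U ** diag_mat d ** ctranspose U \<and>
     B = U ** diag_mat (\<lambda>i. g (d i)) ** ctranspose U)"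

text \<open>
  \<open>tr (A log A)\<close>. The value of \<open>ln 0\<close> is multiplied by the eigenvalue \<open>0\<close>, which gives the
  convention \<open>0 log 0 = 0\<close>; for the same reason the zero rows and columns outside the corner do
  not contribute.
\<close>

definition neg_entropy :: "complex^'n^'n \<Rightarrow> real" where
  "neg_entropy A = Re (trace (A ** herm_fun ln A))"


subsection \<open>The optimization problem\<close>

primrec times_differentiable_on ::
  "nat \<Rightarrow> ('a::real_normed_vector \<Rightarrow> real) \<Rightarrow> 'a set \<Rightarrow> bool" where
  "times_differentiable_on 0 g U \<longleftrightarrow> continuous_on U g"
| "times_differentiable_on (Suc m) g U \<longleftrightarrow> g differentiable_on U \<and>
     (\<forall>v. times_differentiable_on m (\<lambda>x. frechet_derivative g (at x) v) U)"

text \<open>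
  Smoothness on a set with empty interior, such as \<open>feasible I\<close>: there is an infinitely
  differentiable extension to an open neighbourhood.
\<close>

definition smooth_on :: "('a::real_normed_vector) set \<Rightarrow> ('a \<Rightarrow> real) \<Rightarrow> bool" where
  "smooth_on S g \<longleftrightarrow> (\<exists>U h. open U \<and> S \<subseteq> U \<and> (\<forall>x\<in>S. h x = g x) \<and>
     (\<forall>m. times_differentiable_on m h U))"

definition expected_cost ::
  "'w measure \<Rightarrow> (('n::finite, 'k::finite) profile \<Rightarrow> 'w \<Rightarrow> real) \<Rightarrow> ('n, 'k) profile \<Rightarrow> real" where
  "expected_cost P f X = (\<integral>w. f X w \<partial>P)"

definition regularized_cost ::
  "(('n::finite, 'k::finite) profile \<Rightarrow> real) \<Rightarrow> real \<Rightarrow> ('n, 'k) profile \<Rightarrow> real" where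
  "regularized_cost F \<tau> X = F X + \<tau> * (\<Sum>k\<in>UNIV. neg_entropy (X $ k))"

definition replace :: "('n::finite, 'k::finite) profile \<Rightarrow> 'k \<Rightarrow> complex^'n^'n \<Rightarrow> ('n, 'k) profile" where
  "replace X k A = (\<chi> l. if l = k then A else X $ l)"

text \<open>
  \<open>G\<close> is a gradient matrix of \<open>F\<close> at \<open>X\<close> with respect to \<open>X\<^sub>k\<close>, for the inner product
  \<open>tr (G H)\<close> of Hermitian matrices. As \<open>F\<close> only needs to be defined on the feasible set, where
  the trace is fixed, \<open>G\<close> is determined up to a real multiple of \<open>corner_one (I k)\<close>; if \<open>F\<close> is
  differentiable on a neighbourhood, its usual gradient is one such \<open>G\<close>.
\<close>

definition indiv_gradient ::
  "('k::finite \<Rightarrow> 'n::finite set) \<Rightarrow> (('n, 'k) profile \<Rightarrow> real) \<Rightarrow> 'k \<Rightarrow> ('n, 'k) profile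
     \<Rightarrow> complex^'n^'n \<Rightarrow> bool" where
  "indiv_gradient I F k X G \<longleftrightarrow> G \<in> corner (I k) \<and> hermitian G \<and>
     ((\<lambda>A. F (replace X k A)) has_derivative (\<lambda>H. Re (trace (G ** H))))
       (at (X $ k) within spectraplex (I k))"


subsection \<open>Asynchronous updates\<close>

text \<open>
  Time starts at \<open>1\<close> throughout; values of the processes at time \<open>0\<close> are never used.
  \<open>Ks n\<close> is the random set of agents updating at epoch \<open>n\<close>.
\<close>

definition update_count :: "(nat \<Rightarrow> 'a \<Rightarrow> 'k set) \<Rightarrow> 'k \<Rightarrow> nat \<Rightarrow> 'a \<Rightarrow> nat" where
  "update_count Ks k n \<omega> = (\<Sum>j=1..n. of_bool (k \<in> Ks j \<omega>))"

text \<open>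
  An update taking place at epoch \<open>n\<close> itself counts, as it does in \<open>update_count\<close>. As long as an
  agent has never updated, time is counted from its initialization at \<open>1\<close>.
\<close>

definition delay :: "(nat \<Rightarrow> 'a \<Rightarrow> 'k set) \<Rightarrow> 'k \<Rightarrow> nat \<Rightarrow> 'a \<Rightarrow> nat" where
  "delay Ks k n \<omega> = n - Max (insert 1 {j \<in> {1..n}. k \<in> Ks j \<omega>})"

definition async_recursion ::
  "('k::finite \<Rightarrow> 'n::finite set) \<Rightarrow> real \<Rightarrow> real \<Rightarrow> 'a measure \<Rightarrow> (nat \<Rightarrow> 'a \<Rightarrow> 'k set)
     \<Rightarrow> (nat \<Rightarrow> 'a \<Rightarrow> ('n, 'k) profile) \<Rightarrow> (nat \<Rightarrow> 'a \<Rightarrow> ('n, 'k) profile)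
     \<Rightarrow> (nat \<Rightarrow> 'a \<Rightarrow> ('n, 'k) profile) \<Rightarrow> bool" where
  "async_recursion I \<tau> \<gamma> M Ks Vhat Y X \<longleftrightarrow> (\<forall>\<omega>\<in>space M. \<forall>k.
     Y 1 \<omega> $ k = 0 \<and>
     (\<forall>n\<ge>1. Y (n + 1) \<omega> $ k = Y n \<omega> $ k -
        (\<gamma> / real (update_count Ks k n \<omega>) * of_bool (k \<in> Ks n \<omega>)) *\<^sub>R
          (Vhat n \<omega> $ k + \<tau> *\<^sub>R (Y n \<omega> $ k))) \<and>
     (\<forall>n\<ge>1. X n \<omega> $ k = gibbs (I k) (Y n \<omega> $ k)))"

definition homogeneous_markov_chain :: "'a measure \<Rightarrow> (nat \<Rightarrow> 'a \<Rightarrow> 'k set) \<Rightarrow> bool" where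
  "homogeneous_markov_chain M Ks \<longleftrightarrow>
     (\<forall>n\<ge>1. Ks n \<in> measurable M (count_space UNIV)) \<and>
     (\<exists>Q :: 'k set \<Rightarrow> 'k set pmf. \<forall>n\<ge>1. \<forall>A B.
        measure M {\<omega> \<in> space M. \<forall>j\<in>{1..n}. Ks j \<omega> = A j} > 0 \<longrightarrow>
        cond_prob M (\<lambda>\<omega>. Ks (n + 1) \<omega> = B) (\<lambda>\<omega>. \<forall>j\<in>{1..n}. Ks j \<omega> = A j) = pmf (Q (A n)) B)"

text \<open>Every state that can be reached is recurrent. Irreducibility is not required.\<close>

definition recurrent_chain :: "'a measure \<Rightarrow> (nat \<Rightarrow> 'a \<Rightarrow> 'k set) \<Rightarrow> bool" where
  "recurrent_chain M Ks \<longleftrightarrow> (\<forall>n\<ge>1. \<forall>A. measure M {\<omega> \<in> space M. Ks n \<omega> = A} > 0 \<longrightarrow>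
     cond_prob M (\<lambda>\<omega>. \<exists>m>n. Ks m \<omega> = A) (\<lambda>\<omega>. Ks n \<omega> = A) = 1)"

definition positive_update_rates :: "'a measure \<Rightarrow> (nat \<Rightarrow> 'a \<Rightarrow> 'k set) \<Rightarrow> bool" where
  "positive_update_rates M Ks \<longleftrightarrow>
     (\<forall>k. AE \<omega> in M. \<exists>r>0. (\<lambda>n. real (update_count Ks k n \<omega>) / real n) \<longlonglongrightarrow> r)"

text \<open>
  The history up to epoch \<open>n\<close> of the process of iterates together with its update sets.
  \<open>Ks n\<close> has to be included: an estimate that is unbiased given \<open>X 1, \<dots>, X n\<close> alone may be
  biased on the event \<open>k \<in> Ks n\<close>, the only one on which it is used. For instance, with
  \<open>F = 0\<close> and a fixed traceless \<open>C\<close>, take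
  \<open>Vhat n $ k = (of_bool (k \<in> Ks n) - p\<^sub>n) *\<^sub>R C\<close>, where \<open>p\<^sub>n\<close> is the conditional probability of
  \<open>k \<in> Ks n\<close> given \<open>Ks 1, \<dots>, Ks (n - 1)\<close>; the iterates then need not converge to the minimizer.
\<close>

definition history ::
  "'a measure \<Rightarrow> (nat \<Rightarrow> 'a \<Rightarrow> 'k::finite set) \<Rightarrow> (nat \<Rightarrow> 'a \<Rightarrow> ('n::finite, 'k) profile)
     \<Rightarrow> nat \<Rightarrow> 'a measure" where
  "history M Ks X n = sigma (space M)
     (\<Union>m\<in>{1..n}. {X m -` B \<inter> space M | B. B \<in> sets borel} \<union>
                  {Ks m -` S \<inter> space M | S. S \<in> UNIV})"

definition has_cond_exp ::
  "'a measure \<Rightarrow> 'a measure \<Rightarrow> ('a \<Rightarrow> complex^'n^'n) \<Rightarrow> ('a \<Rightarrow> complex^'n^'n) \<Rightarrow> bool" where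
  "has_cond_exp M G Z W \<longleftrightarrow> (\<forall>i j.
     (AE \<omega> in M. real_cond_exp M G (\<lambda>\<omega>. Re (Z \<omega> $ i $ j)) \<omega> = Re (W \<omega> $ i $ j)) \<and>
     (AE \<omega> in M. real_cond_exp M G (\<lambda>\<omega>. Im (Z \<omega> $ i $ j)) \<omega> = Im (W \<omega> $ i $ j)))"

definition bounded_hermitian_estimates ::
  "('k::finite \<Rightarrow> 'n::finite set) \<Rightarrow> 'a measure \<Rightarrow> (nat \<Rightarrow> 'a \<Rightarrow> ('n, 'k) profile) \<Rightarrow> bool" where
  "bounded_hermitian_estimates I M Vhat \<longleftrightarrow>
     (\<forall>n\<ge>1. Vhat n \<in> borel_measurable M) \<and>
     (\<forall>n\<ge>1. \<forall>k. \<forall>\<omega>\<in>space M. Vhat n \<omega> $ k \<in> corner (I k) \<and> hermitian (Vhat n \<omega> $ k)) \<and>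
     (\<exists>C. \<forall>n\<ge>1. \<forall>k. AE \<omega> in M. norm (Vhat n \<omega> $ k) \<le> C)"

definition delayed_profile ::
  "(nat \<Rightarrow> 'a \<Rightarrow> 'k::finite set) \<Rightarrow> (nat \<Rightarrow> 'a \<Rightarrow> ('n::finite, 'k) profile) \<Rightarrow> nat \<Rightarrow> 'a \<Rightarrow> ('n, 'k) profile" where
  "delayed_profile Ks X n \<omega> = (\<chi> l. X (n - delay Ks l n \<omega>) \<omega> $ l)"

end

theory Submission
  imports Defs
begin

text \<open>
  The regularized cost \<open>F + \<tau> h\<close>, where \<open>h\<close> is the sum of the negative entropies of the agents, is a
  Lyapunov function of the process, and it stays one under asynchronous updates. Write \<open>X = gibbs Y\<close> and let
  the residual be \<open>w = \<nabla>F(X) + \<tau> Y\<close>. As \<open>Y\<close> is a subgradient of \<open>h\<close> at \<open>X\<close>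
  (\<open>neg_entropy_strongly_convex\<close>), a change of \<open>X\<close> changes the regularized cost by at most \<open>w \<bullet> \<Delta>X\<close> up to
  second order. If agent \<open>k\<close> updates with step size \<open>a\<close> and without noise, then \<open>\<Delta>Y\<^sub>k = - a w\<^sub>k\<close>, and the
  Gibbs map is strongly monotone on bounded sets (\<open>gibbs_strongly_monotone\<close>), so that
  \<open>w\<^sub>k \<bullet> \<Delta>X\<^sub>k = - (1/a) \<Delta>Y\<^sub>k \<bullet> \<Delta>X\<^sub>k \<le> - c a \<parallel>w\<^sub>k\<parallel>\<^sup>2\<close>. Every agent thus contributes a decrease of its own,
  whatever the others do (\<open>regularized_descent_step\<close>). It follows that \<open>a \<parallel>w\<^sub>k\<parallel>\<^sup>2\<close> is summable over the
  updates of \<open>k\<close>. The residual moves slowly and all agents update at positive rates, so it tends to zero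
  (\<open>slowly_varying_tendsto_0\<close>), and a small residual means that \<open>X\<close> is close to the point where the
  residual vanishes (\<open>residual_controls_distance\<close>). That point exists by Brouwer's theorem and is
  the unique minimizer of the regularized cost (\<open>equilibrium_exists\<close>, \<open>equilibrium_unique_minimizer\<close>).

  Noise is removed beforehand. The weighted noise terms are of size \<open>O(1/n)\<close> and orthogonal, because past
  noise is a function of the history: on the bounded set where the traceless parts of the dual variables
  live, the Gibbs map has a continuous inverse (\<open>centered_dual_from_iterate\<close>). Hence the noise series
  converges almost surely, and its tails \<open>s\<^sub>n\<close> have mean size \<open>O(1/\<surd>n)\<close>, so that
  \<open>\<parallel>s\<^sub>n\<parallel> / n\<close> is summable (\<open>orthogonal_series_tails\<close>). The shifted process \<open>Y - s\<close> follows the recursion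
  without noise, up to errors that are summable against the step sizes, and the argument above
  applies to it (\<open>async_trajectory_converges\<close>). The delays cause an error of the size of a single step,
  since an agent does not move between its updates (\<open>last_update_close\<close>).

  The matrix inequalities need no calculus of matrix functions. For two Hermitian matrices the squared
  overlaps of their eigenvectors form a doubly stochastic matrix, and averaging a scalar inequality
  between eigenvalues against it gives the matrix inequality (\<open>inner_udiag_diff\<close>).

  Finally, the minimum of \<open>F\<close> and its value at the regularized minimizer differ by at most \<open>\<tau>\<close> times the
  oscillation of the entropy, and by compactness the minimizers approach the optimal set as \<open>\<tau>\<close> tends to
  zero (\<open>regularized_minimizer_approximates\<close>).
\<close>

section \<open>Hermitian matrices and their spectral decomposition\<close>

lemma matrix_add_rdistrib: "((A::complex^'n^'m) + B) ** (C::complex^'k^'n) = A ** C + B ** C"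
  by (simp add: vec_eq_iff matrix_matrix_mult_def sum.distrib algebra_simps)

lemma matrix_diff_rdistrib: "((A::complex^'n^'m) - B) ** (C::complex^'k^'n) = A ** C - B ** C"
  by (simp add: vec_eq_iff matrix_matrix_mult_def sum_subtractf algebra_simps)

lemma matrix_diff_ldistrib: "(A::complex^'n^'m) ** ((B::complex^'k^'n) - C) = A ** B - A ** C"
  by (simp add: vec_eq_iff matrix_matrix_mult_def sum_subtractf algebra_simps)

lemma matrix_scaleR_left: "(c *\<^sub>R (A::complex^'n^'m)) ** (B::complex^'k^'n) = c *\<^sub>R (A ** B)"
  by (simp add: vec_eq_iff matrix_matrix_mult_def scaleR_sum_right)

lemma matrix_scaleR_right: "(A::complex^'n^'m) ** (c *\<^sub>R (B::complex^'k^'n)) = c *\<^sub>R (A ** B)"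
  by (simp add: vec_eq_iff matrix_matrix_mult_def scaleR_sum_right)

lemma ctranspose_mult: "ctranspose (A ** B) = ctranspose B ** ctranspose (A::complex^'n^'n)"
  by (simp add: vec_eq_iff matrix_matrix_mult_def ctranspose_def mult.commute)

lemma ctranspose_ctranspose [simp]: "ctranspose (ctranspose A) = A"
  by (simp add: vec_eq_iff ctranspose_def)

lemma ctranspose_add: "ctranspose (A + B) = ctranspose A + ctranspose B"
  by (simp add: vec_eq_iff ctranspose_def)

lemma ctranspose_diff: "ctranspose (A - B) = ctranspose A - ctranspose B"
  by (simp add: vec_eq_iff ctranspose_def)

lemma ctranspose_scaleR: "ctranspose (c *\<^sub>R A) = c *\<^sub>R ctranspose A"
  by (simp add: vec_eq_iff ctranspose_def)

lemma ctranspose_mat_1 [simp]: "ctranspose (mat 1) = mat 1"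
  by (auto simp add: vec_eq_iff ctranspose_def mat_def)

lemma ctranspose_diag_mat [simp]: "ctranspose (diag_mat d) = diag_mat d"
  by (auto simp add: vec_eq_iff ctranspose_def diag_mat_def)

lemma hermitian_add: "hermitian A \<Longrightarrow> hermitian B \<Longrightarrow> hermitian (A + B)"
  by (simp add: hermitian_def ctranspose_add)

lemma hermitian_diff: "hermitian A \<Longrightarrow> hermitian B \<Longrightarrow> hermitian (A - B)"
  by (simp add: hermitian_def ctranspose_diff)

lemma hermitian_scaleR: "hermitian A \<Longrightarrow> hermitian (c *\<^sub>R A)"
  by (simp add: hermitian_def ctranspose_scaleR)

lemma hermitian_mat_1: "hermitian (mat 1)"
  by (simp add: hermitian_def)

lemma hermitian_0: "hermitian 0"
  by (simp add: hermitian_def ctranspose_def vec_eq_iff)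

lemma hermitian_entry: "hermitian A \<Longrightarrow> cnj (A $ i $ j) = A $ j $ i"
  by (metis (no_types, lifting) hermitian_def ctranspose_def vec_lambda_beta)

lemma inner_eq_trace: "A \<bullet> B = Re (trace (A ** ctranspose B))" for A B :: "complex^'n^'n"
  by (simp add: inner_vec_def inner_complex_def trace_def matrix_matrix_mult_def ctranspose_def)

lemma inner_eq_trace_hermitian: "hermitian B \<Longrightarrow> A \<bullet> B = Re (trace (A ** B))"
  for A B :: "complex^'n^'n"
  by (simp add: inner_eq_trace hermitian_def)

lemma trace_hermitian: "hermitian A \<Longrightarrow> trace A = complex_of_real (Re (trace A))"
  for A :: "complex^'n^'n"
proof -
  assume A: "hermitian A"
  have "Im (A $ i $ i) = 0" for i
    using arg_cong[OF hermitian_entry[OF A, of i i], of Im] by simp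
  then show ?thesis by (simp add: trace_def complex_eq_iff)
qed

text \<open>
  A maximizer of the Rayleigh quotient is an eigenvector: for self-adjoint \<open>f\<close> with maximal
  quotient \<open>\<lambda>\<close>, the form \<open>\<lambda> \<parallel>w\<parallel>\<^sup>2 - w \<bullet> f w\<close> is nonnegative and vanishes at the maximizer,
  so that its linear part there vanishes in every direction of the invariant subspace.
\<close>

lemma selfadjoint_eigenvector:
  fixes f :: "'a::euclidean_space \<Rightarrow> 'a"
  assumes f: "linear f" and sa: "\<And>v w. f v \<bullet> w = v \<bullet> f w"
    and C: "subspace C" and inv: "\<And>v. v \<in> C \<Longrightarrow> f v \<in> C" and ne: "\<exists>v\<in>C. v \<noteq> 0"
  shows "\<exists>v\<in>C. \<exists>l. norm v = 1 \<and> f v = l *\<^sub>R v"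
proof -
  let ?S = "sphere 0 1 \<inter> C"
  have "compact ?S" by (intro compact_Int_closed closed_subspace C) simp
  moreover obtain u where "u \<in> C" "u \<noteq> 0" using ne by blast
  then have "(1 / norm u) *\<^sub>R u \<in> ?S" using C by (auto simp: subspace_scale)
  then have "?S \<noteq> {}" by blast
  moreover have "continuous_on ?S (\<lambda>v. v \<bullet> f v)"
    using f by (intro continuous_intros linear_continuous_on) (simp add: linear_conv_bounded_linear)
  ultimately obtain v where v: "v \<in> ?S" and max: "\<And>w. w \<in> ?S \<Longrightarrow> w \<bullet> f w \<le> v \<bullet> f v"
    by (metis continuous_attains_sup)
  define l where "l = v \<bullet> f v"
  have le: "w \<bullet> f w \<le> l * (w \<bullet> w)" if "w \<in> C" for w
  proof (cases "w = 0")
    case False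
    have "(1 / norm w) *\<^sub>R w \<in> ?S" using C that False by (auto simp: subspace_scale)
    from max[OF this] have "(w \<bullet> f w) / (norm w)\<^sup>2 \<le> l"
      by (simp add: l_def linear_scale[OF f] power2_eq_square)
    then show ?thesis using False by (simp add: field_simps dot_square_norm)
  qed (simp add: linear_0[OF f])
  have vv: "v \<bullet> v = 1" using v by (simp add: dot_square_norm)
  define b where "b = l *\<^sub>R v - f v"
  have bC: "b \<in> C" unfolding b_def using v inv C by (simp add: subspace_diff subspace_scale)
  define c where "c = l * (b \<bullet> b) - b \<bullet> f b"
  have quad: "0 \<le> 2 * t * (b \<bullet> b) + t\<^sup>2 * c" for t
  proof -
    have "v + t *\<^sub>R b \<in> C" using v bC C by (simp add: subspace_add subspace_scale)
    from le[OF this] show ?thesis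
      using sa[of v b] vv
      by (simp add: c_def b_def l_def linear_add[OF f] linear_scale[OF f] linear_diff[OF f]
          inner_add_left inner_add_right inner_diff_left inner_diff_right
          power2_eq_square algebra_simps inner_commute)
  qed
  have "b \<bullet> b = 0"
  proof (rule ccontr)
    assume "b \<bullet> b \<noteq> 0"
    then have pos: "b \<bullet> b > 0" by (simp add: order_less_le)
    define t where "t = - (b \<bullet> b) / (\<bar>c\<bar> + 1)"
    have t: "t < 0" using pos by (auto simp: t_def field_simps)
    have "t\<^sup>2 * c \<le> t\<^sup>2 * (\<bar>c\<bar> + 1)" by (intro mult_left_mono) auto
    also have "\<dots> = - t * (b \<bullet> b)"
    proof -
      have "t * (\<bar>c\<bar> + 1) = - (b \<bullet> b)" by (simp add: t_def)
      then show ?thesis by (simp add: power2_eq_square mult.assoc)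
    qed
    finally have "2 * t * (b \<bullet> b) + t\<^sup>2 * c \<le> t * (b \<bullet> b)" by linarith
    also have "\<dots> < 0" using t pos by (simp add: mult_neg_pos)
    finally show False using quad[of t] by linarith
  qed
  then have "f v = l *\<^sub>R v" by (simp add: b_def)
  then show ?thesis using v by auto
qed

definition cinner :: "complex^'n \<Rightarrow> complex^'n \<Rightarrow> complex" where
  "cinner v w = (\<Sum>i\<in>UNIV. cnj (v $ i) * w $ i)"

lemma Re_cinner: "Re (cinner v w) = v \<bullet> w"
  by (simp add: cinner_def inner_vec_def inner_complex_def)

lemma cinner_sub: "cinner v (w - u) = cinner v w - cinner v u"
  by (simp add: cinner_def algebra_simps sum_subtractf)

lemma cinner_sum: "cinner v (sum g S) = (\<Sum>s\<in>S. cinner v (g s))"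
  by (simp add: cinner_def sum_distrib_left sum.swap[of _ S])

lemma cinner_scale: "cinner v (c *s w) = c * cinner v w"
  by (simp add: cinner_def sum_distrib_left algebra_simps)

lemma cinner_scaleR: "cinner v (c *\<^sub>R w) = of_real c * cinner v w"
  unfolding cinner_def sum_distrib_left vector_scaleR_component
  by (intro sum.cong refl) (simp add: scaleR_conv_of_real)

lemma cinner_cnj: "cnj (cinner v w) = cinner w v"
  by (simp add: cinner_def mult.commute)

lemma cinner_hermitian: "hermitian A \<Longrightarrow> cinner (A *v v) w = cinner v (A *v w)"
  unfolding cinner_def matrix_vector_mult_def
  by (simp add: sum_distrib_left sum_distrib_right hermitian_entry)
     (subst sum.swap, simp add: mult.commute mult.left_commute)

lemma inner_hermitian: "hermitian A \<Longrightarrow> (A *v v) \<bullet> w = v \<bullet> (A *v w)" for A :: "complex^'n^'n"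
  by (simp add: cinner_hermitian flip: Re_cinner)

lemma cinner_self: "cinner v v = of_real ((norm v)\<^sup>2)"
  by (simp add: complex_eq_iff Re_cinner dot_square_norm) (simp add: cinner_def)

text \<open>
  A largest orthonormal set of eigenvectors spans: otherwise its orthogonal complement, which is
  invariant, contains another eigenvector. Completeness reads \<open>\<Sum>\<^sub>s s s\<^sup>* = 1\<close>, and taking traces shows
  that the set has as many elements as there are indices.
\<close>

lemma hermitian_eigenbasis:
  fixes A :: "complex^'n^'n"
  assumes A: "hermitian A"
  obtains S where "finite S" "card S = CARD('n)"
    "\<And>s. s \<in> S \<Longrightarrow> \<exists>l::real. A *v s = l *\<^sub>R s"
    "\<And>i j. (\<Sum>s\<in>S. s $ i * cnj (s $ j)) = (if i = j then 1 else 0)"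
proof -
  define E where "E S \<longleftrightarrow> finite S \<and> (\<forall>s\<in>S. norm s = 1 \<and> (\<exists>l::real. A *v s = l *\<^sub>R s)) \<and>
    (\<forall>s\<in>S. \<forall>t\<in>S. s \<noteq> t \<longrightarrow> cinner s t = 0)" for S
  have bound: "card S < Suc (DIM(complex^'n))" if "E S" for S
  proof -
    have "pairwise orthogonal S"
      using that unfolding E_def pairwise_def orthogonal_def
      by (metis Re_cinner zero_complex.simps(1))
    moreover have "0 \<notin> S" using that unfolding E_def by fastforce
    ultimately show ?thesis
      using pairwise_orthogonal_independent independent_bound by (metis less_Suc_eq_le)
  qed
  have "E {}" by (simp add: E_def)
  with bound obtain S where S: "E S" and mx: "\<And>T. E T \<Longrightarrow> card T \<le> card S"
    using ex_has_greatest_nat[of E "{}" card "Suc (DIM(complex^'n))"] by (metis less_imp_le)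
  have fin: "finite S" and eig: "\<And>s. s \<in> S \<Longrightarrow> \<exists>l::real. A *v s = l *\<^sub>R s"
    and nrm: "\<And>s. s \<in> S \<Longrightarrow> norm s = 1"
    and orth: "\<And>s t. s \<in> S \<Longrightarrow> t \<in> S \<Longrightarrow> s \<noteq> t \<Longrightarrow> cinner s t = 0"
    using S by (auto simp: E_def)
  define C where "C = {v. \<forall>s\<in>S. cinner s v = 0}"
  have sub: "subspace C"
    by (auto simp: subspace_def C_def cinner_scaleR) (simp_all add: cinner_def algebra_simps sum.distrib)
  have inv: "A *v v \<in> C" if "v \<in> C" for v
  proof -
    have "cinner s (A *v v) = 0" if s: "s \<in> S" for s
    proof -
      obtain l :: real where "A *v s = l *\<^sub>R s" using eig[OF s] by blast
      then have "cinner s (A *v v) = cinner (l *\<^sub>R s) v" using cinner_hermitian[OF A] by metis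
      also have "\<dots> = cnj (cinner v (l *\<^sub>R s))" by (simp add: cinner_cnj)
      also have "\<dots> = of_real l * cinner s v" by (simp add: cinner_scaleR cinner_cnj)
      finally show ?thesis using \<open>v \<in> C\<close> s by (simp add: C_def)
    qed
    then show ?thesis by (simp add: C_def)
  qed
  have C0: "v = 0" if "v \<in> C" for v
  proof (rule ccontr)
    assume "v \<noteq> 0"
    then have "\<exists>v\<in>C. v \<noteq> 0" using that by blast
    from selfadjoint_eigenvector[OF _ inner_hermitian[OF A] sub inv this]
    obtain e and l :: real where e: "e \<in> C" "norm e = 1" "A *v e = l *\<^sub>R e"
      by (auto simp: matrix_vector_mul_linear)
    have "e \<notin> S"
    proof
      assume "e \<in> S"
      then have "cinner e e = 0" using e by (simp add: C_def)
      then show False using e by (simp add: cinner_self)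
    qed
    have "cinner s e = 0 \<and> cinner e s = 0" if "s \<in> S" for s
    proof -
      have "cinner s e = 0" using e that by (simp add: C_def)
      then show ?thesis using cinner_cnj[of s e] by simp
    qed
    then have "E (insert e S)" using S e by (auto simp: E_def)
    from mx[OF this] show False using \<open>e \<notin> S\<close> fin by simp
  qed
  have expand: "v = (\<Sum>s\<in>S. cinner s v *s s)" for v
  proof -
    have "v - (\<Sum>s\<in>S. cinner s v *s s) \<in> C"
      unfolding C_def
    proof (safe)
      fix t assume t: "t \<in> S"
      have "cinner t (\<Sum>s\<in>S. cinner s v *s s) = (\<Sum>s\<in>S. cinner s v * cinner t s)"
        by (simp add: cinner_sum cinner_scale)
      also have "\<dots> = (\<Sum>s\<in>S. if s = t then cinner t v else 0)"
        using orth[OF t] nrm[OF t] by (intro sum.cong) (auto simp: cinner_self)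
      also have "\<dots> = cinner t v" using fin t by simp
      finally show "cinner t (v - (\<Sum>s\<in>S. cinner s v *s s)) = 0" by (simp add: cinner_sub)
    qed
    from C0[OF this] show ?thesis by simp
  qed
  have compl: "(\<Sum>s\<in>S. s $ i * cnj (s $ j)) = (if i = j then 1 else 0)" for i j
  proof -
    have "(axis j 1 :: complex^'n) $ i = (\<Sum>s\<in>S. cinner s (axis j 1) *s s) $ i"
      using expand[of "axis j 1"] by simp
    also have "\<dots> = (\<Sum>s\<in>S. s $ i * cnj (s $ j))"
      by (simp add: cinner_def axis_def if_distrib mult.commute cong: if_cong)
    finally show ?thesis by (simp add: axis_def)
  qed
  have "of_nat (card S) = (\<Sum>s\<in>S. cinner s s)" using nrm by (simp add: cinner_self)
  also have "\<dots> = (\<Sum>i\<in>UNIV. \<Sum>s\<in>S. s $ i * cnj (s $ i))"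
    unfolding cinner_def by (subst sum.swap) (simp add: mult.commute)
  also have "\<dots> = of_nat CARD('n)" by (simp add: compl)
  finally have "card S = CARD('n)" using of_nat_eq_iff by blast
  then show thesis using that fin eig compl by blast
qed

definition udiag :: "complex^'n^'n \<Rightarrow> ('n \<Rightarrow> real) \<Rightarrow> complex^'n^'n" where
  "udiag U d = U ** diag_mat d ** ctranspose U"

lemma diag_mat_mult: "diag_mat d ** (A::complex^'n^'n) = (\<chi> i j. of_real (d i) * A $ i $ j)"
  by (simp add: vec_eq_iff matrix_matrix_mult_def diag_mat_def if_distrib[of "\<lambda>x. x * _"] cong: if_cong)

lemma mult_diag_mat: "(A::complex^'n^'n) ** diag_mat d = (\<chi> i j. A $ i $ j * of_real (d j))"
  by (simp add: vec_eq_iff matrix_matrix_mult_def diag_mat_def if_distrib cong: if_cong)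

lemma udiag_entry: "udiag U d $ i $ j = (\<Sum>l\<in>UNIV. of_real (d l) * (U $ i $ l * cnj (U $ j $ l)))"
  unfolding udiag_def mult_diag_mat
  by (simp add: matrix_matrix_mult_def ctranspose_def algebra_simps)

theorem hermitian_spectral:
  fixes A :: "complex^'n^'n"
  assumes A: "hermitian A"
  obtains U d where "unitary U" "A = udiag U d"
proof -
  obtain S where S: "finite S" "card S = CARD('n)" "\<And>s. s \<in> S \<Longrightarrow> \<exists>l::real. A *v s = l *\<^sub>R s"
    "\<And>i j. (\<Sum>s\<in>S. s $ i * cnj (s $ j)) = (if i = j then 1 else 0)"
    using hermitian_eigenbasis[OF A] by blast
  obtain p where p: "bij_betw p (UNIV::'n set) S"
    using finite_same_card_bij[OF finite S(1)] S(2) by metis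
  have pS: "p j \<in> S" for j using p by (auto simp: bij_betw_def)
  define U where "U = (\<chi> i j. p j $ i)"
  obtain d where d: "A *v p j = (d j) *\<^sub>R p j" for j using S(3)[OF pS] by metis
  have "(\<Sum>l\<in>UNIV. p l $ i * cnj (p l $ j)) = (if i = j then 1 else 0)" for i j
    using S(4) sum.reindex_bij_betw[OF p, of "\<lambda>s. s $ i * cnj (s $ j)"] by simp
  then have U: "unitary U"
    by (simp add: unitary_def vec_eq_iff matrix_matrix_mult_def ctranspose_def mat_def U_def)
  have "(\<Sum>l\<in>UNIV. A $ i $ l * p j $ l) = p j $ i * of_real (d j)" for i j
  proof -
    have "(A *v p j) $ i = d j *\<^sub>R (p j $ i)" by (simp add: d)
    then show ?thesis by (simp add: matrix_vector_mult_def scaleR_conv_of_real[where 'a=complex])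
  qed
  then have "A ** U = U ** diag_mat d"
    unfolding mult_diag_mat by (simp add: vec_eq_iff matrix_matrix_mult_def U_def)
  then have "A ** (U ** ctranspose U) = udiag U d" by (simp add: udiag_def matrix_mul_assoc)
  then show thesis using that U by (simp add: unitary_def)
qed

lemma unitary_left: "unitary U \<Longrightarrow> ctranspose U ** U = mat 1"
  unfolding unitary_def using matrix_left_right_inverse by blast

lemma hermitian_udiag: "hermitian (udiag U d)"
  by (simp add: hermitian_def udiag_def ctranspose_mult matrix_mul_assoc)

lemma udiag_add: "udiag U (\<lambda>i. f i + g i) = udiag U f + udiag U g"
  unfolding vec_eq_iff udiag_entry vector_add_component sum.distrib[symmetric]
  by (intro allI sum.cong refl) (simp add: distrib_right)

lemma udiag_diff: "udiag U (\<lambda>i. f i - g i) = udiag U f - udiag U g"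
  unfolding vec_eq_iff udiag_entry vector_minus_component sum_subtractf[symmetric]
  by (intro allI sum.cong refl) (simp add: left_diff_distrib)

lemma udiag_cmult: "udiag U (\<lambda>i. c * f i) = c *\<^sub>R udiag U f"
  unfolding vec_eq_iff udiag_entry vector_scaleR_component scaleR_sum_right
  by (intro allI sum.cong refl) (simp add: scaleR_conv_of_real)

lemma udiag_1: "unitary U \<Longrightarrow> udiag U (\<lambda>_. 1) = mat 1" for U :: "complex^'n^'n"
proof -
  have "diag_mat (\<lambda>_. 1) = (mat 1 :: complex^'n^'n)" by (simp add: diag_mat_def mat_def vec_eq_iff)
  then show "unitary U \<Longrightarrow> udiag U (\<lambda>_. 1) = mat 1" 
    by (simp add: udiag_def unitary_def)
qed

lemma udiag_mult:
  fixes U :: "complex^'n^'n"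
  assumes "unitary U"
  shows "udiag U f ** udiag U g = udiag U (\<lambda>i. f i * g i)"
proof -
  have "udiag U f ** udiag U g = U ** diag_mat f ** (ctranspose U ** U) ** diag_mat g ** ctranspose U"
    by (simp add: udiag_def matrix_mul_assoc)
  also have "\<dots> = U ** (diag_mat f ** diag_mat g) ** ctranspose U"
    by (simp add: unitary_left[OF assms] matrix_mul_assoc)
  also have "diag_mat f ** diag_mat g = (diag_mat (\<lambda>i. f i * g i) :: complex^'n^'n)"
    by (simp add: diag_mat_mult) (simp add: diag_mat_def vec_eq_iff)
  finally show ?thesis by (simp add: udiag_def)
qed

text \<open>
  The matrix \<open>U\<^sup>*BW\<close> intertwines the two diagonal matrices, so each of its nonzero entries links equal
  eigenvalues, and it goes on intertwining them after a function is applied to both.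
\<close>

lemma udiag_intertwine:
  fixes U W B :: "complex^'n^'n"
  assumes U: "unitary U" and W: "unitary W" and eq: "udiag U d ** B = B ** udiag W e"
  shows "udiag U (\<lambda>i. g (d i)) ** B = B ** udiag W (\<lambda>i. g (e i))"
proof -
  let ?m = "ctranspose U ** B ** W"
  have shape: "ctranspose U ** (udiag U f ** B) ** W = diag_mat f ** ?m"
    "ctranspose U ** (B ** udiag W f) ** W = ?m ** diag_mat f" for f :: "'n \<Rightarrow> real"
  proof -
    have "ctranspose U ** (udiag U f ** B) ** W = (ctranspose U ** U) ** diag_mat f ** ?m"
      by (simp add: udiag_def matrix_mul_assoc)
    then show "ctranspose U ** (udiag U f ** B) ** W = diag_mat f ** ?m" using unitary_left[OF U] by simp
    have "ctranspose U ** (B ** udiag W f) ** W = ?m ** diag_mat f ** (ctranspose W ** W)"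
      by (simp add: udiag_def matrix_mul_assoc)
    then show "ctranspose U ** (B ** udiag W f) ** W = ?m ** diag_mat f" using unitary_left[OF W] by simp
  qed
  have "diag_mat d ** ?m = ?m ** diag_mat e" using shape eq by metis
  then have "of_real (d i) * ?m $ i $ j = ?m $ i $ j * of_real (e j)" for i j
    by (simp add: diag_mat_mult mult_diag_mat vec_eq_iff)
  then have "?m $ i $ j = 0 \<or> d i = e j" for i j by (metis mult.commute mult_cancel_left of_real_eq_iff)
  then have "of_real (g (d i)) * ?m $ i $ j = ?m $ i $ j * of_real (g (e j))" for i j
    by (metis mult.commute mult_zero_left)
  then have "diag_mat (\<lambda>i. g (d i)) ** ?m = ?m ** diag_mat (\<lambda>i. g (e i))"
    by (simp add: diag_mat_mult mult_diag_mat vec_eq_iff)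
  then have "U ** (ctranspose U ** (udiag U (\<lambda>i. g (d i)) ** B) ** W) ** ctranspose W
    = U ** (ctranspose U ** (B ** udiag W (\<lambda>i. g (e i))) ** W) ** ctranspose W"
    using shape by metis
  moreover have "U ** (ctranspose U ** Z ** W) ** ctranspose W = Z" for Z
  proof -
    have "U ** (ctranspose U ** Z ** W) ** ctranspose W = (U ** ctranspose U) ** Z ** (W ** ctranspose W)"
      by (simp add: matrix_mul_assoc)
    then show ?thesis using U W by (simp add: unitary_def)
  qed
  ultimately show ?thesis by metis
qed

lemma herm_fun_udiag:
  assumes "unitary U"
  shows "herm_fun g (udiag U d) = udiag U (\<lambda>i. g (d i))"
  unfolding herm_fun_def
proof (rule the_equality)
  show "\<exists>W e. unitary W \<and> udiag U d = W ** diag_mat e ** ctranspose W \<and>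
     udiag U (\<lambda>i. g (d i)) = W ** diag_mat (\<lambda>i. g (e i)) ** ctranspose W"
    using assms by (auto simp: udiag_def)
next
  fix B assume "\<exists>W e. unitary W \<and> udiag U d = W ** diag_mat e ** ctranspose W \<and>
     B = W ** diag_mat (\<lambda>i. g (e i)) ** ctranspose W"
  then obtain W e where W: "unitary W" "udiag U d = udiag W e" "B = udiag W (\<lambda>i. g (e i))"
    by (auto simp: udiag_def)
  then show "B = udiag U (\<lambda>i. g (d i))"
    using udiag_intertwine[OF assms W(1), of d "mat 1" e g] by simp
qed

section \<open>Comparing two spectral decompositions\<close>

text \<open>
  The squared moduli of the entries of \<open>U\<^sup>*W\<close> form a doubly stochastic matrix. Averaging against it
  turns a scalar inequality between an eigenvalue of one Hermitian matrix and an eigenvalue of another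
  into a trace inequality, without assuming that the matrices commute; this is how Klein's inequality
  is proved, and the inequalities for exponentials and entropies below are obtained in this way.
\<close>

definition overlap :: "complex^'n^'n \<Rightarrow> complex^'n^'n \<Rightarrow> 'n \<Rightarrow> 'n \<Rightarrow> real" where
  "overlap U W i j = (cmod ((ctranspose U ** W) $ i $ j))\<^sup>2"

lemma overlap_nonneg: "0 \<le> overlap U W i j"
  by (simp add: overlap_def)

lemma overlap_row:
  assumes "unitary U" "unitary W"
  shows "(\<Sum>j\<in>UNIV. overlap U W i j) = 1"
proof -
  let ?m = "ctranspose U ** W"
  have "?m ** ctranspose ?m = ctranspose U ** (W ** ctranspose W) ** U"
    by (simp add: ctranspose_mult matrix_mul_assoc)
  also have "\<dots> = mat 1" using assms unitary_left by (simp add: unitary_def)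
  finally have "(?m ** ctranspose ?m) $ i $ i = 1" by (simp add: mat_def)
  moreover have "(?m ** ctranspose ?m) $ i $ i = (\<Sum>j\<in>UNIV. of_real (overlap U W i j))"
    unfolding matrix_matrix_mult_def[of ?m] overlap_def
    by (simp add: ctranspose_def complex_norm_square del: of_real_power)
  ultimately show ?thesis by (metis of_real_1 of_real_eq_iff of_real_sum)
qed

lemma overlap_sym: "overlap U W i j = overlap W U j i"
proof -
  have "ctranspose U ** W = ctranspose (ctranspose W ** U)" by (simp add: ctranspose_mult)
  then have "(ctranspose U ** W) $ i $ j = cnj ((ctranspose W ** U) $ j $ i)"
    by (simp add: ctranspose_def)
  then show ?thesis by (simp add: overlap_def)
qed

lemma overlap_column:
  assumes "unitary U" "unitary W"
  shows "(\<Sum>i\<in>UNIV. overlap U W i j) = 1"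
  using overlap_row[OF assms(2,1)] by (simp add: overlap_sym[of U])

lemma overlap_marginals:
  assumes "unitary U" "unitary W"
  shows "(\<Sum>i\<in>UNIV. f i) = (\<Sum>i\<in>UNIV. \<Sum>j\<in>UNIV. overlap U W i j * f i)"
    and "(\<Sum>j\<in>UNIV. g j) = (\<Sum>i\<in>UNIV. \<Sum>j\<in>UNIV. overlap U W i j * g j)"
proof -
  show "(\<Sum>i\<in>UNIV. f i) = (\<Sum>i\<in>UNIV. \<Sum>j\<in>UNIV. overlap U W i j * f i)"
    by (simp add: overlap_row[OF assms] flip: sum_distrib_right)
  show "(\<Sum>j\<in>UNIV. g j) = (\<Sum>i\<in>UNIV. \<Sum>j\<in>UNIV. overlap U W i j * g j)"
    by (subst sum.swap) (simp add: overlap_column[OF assms] flip: sum_distrib_right)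
qed

lemma inner_udiag:
  "udiag U f \<bullet> udiag W g = (\<Sum>i\<in>UNIV. \<Sum>j\<in>UNIV. overlap U W i j * (f i * g j))"
proof -
  let ?m = "ctranspose U ** W"
  have "trace (udiag U f ** udiag W g) = trace (U ** (diag_mat f ** ?m ** diag_mat g ** ctranspose W))"
    by (simp add: udiag_def matrix_mul_assoc)
  also have "\<dots> = trace ((diag_mat f ** ?m) ** (diag_mat g ** ctranspose ?m))"
    by (subst trace_mul_sym) (simp add: ctranspose_mult matrix_mul_assoc)
  also have "\<dots> = (\<Sum>i\<in>UNIV. \<Sum>j\<in>UNIV. of_real (overlap U W i j * (f i * g j)))"
    unfolding diag_mat_mult
    by (simp add: trace_def matrix_matrix_mult_def[of "\<chi> i j. _ i j"] ctranspose_def[of "_ ** _"]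
        overlap_def complex_norm_square mult_ac del: of_real_power)
  finally show ?thesis by (simp add: inner_eq_trace_hermitian[OF hermitian_udiag])
qed

lemma overlap_self: "unitary U \<Longrightarrow> overlap U U i j = (if i = j then 1 else 0)"
  by (simp add: overlap_def unitary_left mat_def)

lemma inner_udiag_same: "unitary U \<Longrightarrow> udiag U f \<bullet> udiag U g = (\<Sum>i\<in>UNIV. f i * g i)"
proof -
  assume U: "unitary U"
  have "(\<Sum>j\<in>UNIV. overlap U U i j * (f i * g j)) = f i * g i" for i
  proof -
    have "(\<Sum>j\<in>UNIV. overlap U U i j * (f i * g j)) = (\<Sum>j\<in>UNIV. if i = j then f i * g i else 0)"
      by (intro sum.cong) (auto simp: overlap_self[OF U])
    then show ?thesis by simp
  qed
  then show ?thesis unfolding inner_udiag by simp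
qed

lemma inner_udiag_diff:
  assumes "unitary U" "unitary W"
  shows "(udiag U f - udiag W g) \<bullet> (udiag U f' - udiag W g') =
    (\<Sum>i\<in>UNIV. \<Sum>j\<in>UNIV. overlap U W i j * ((f i - g j) * (f' i - g' j)))"
proof -
  have "udiag W g \<bullet> udiag U f' = (\<Sum>i\<in>UNIV. \<Sum>j\<in>UNIV. overlap U W i j * (f' i * g j))"
    unfolding inner_commute[of "udiag W g"] by (rule inner_udiag)
  moreover have "udiag U f \<bullet> udiag U f' = (\<Sum>i\<in>UNIV. \<Sum>j\<in>UNIV. overlap U W i j * (f i * f' i))"
    unfolding inner_udiag_same[OF assms(1)] by (rule overlap_marginals(1)[OF assms])
  moreover have "udiag W g \<bullet> udiag W g' = (\<Sum>i\<in>UNIV. \<Sum>j\<in>UNIV. overlap U W i j * (g j * g' j))"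
    unfolding inner_udiag_same[OF assms(2)] by (rule overlap_marginals(2)[OF assms])
  moreover have "udiag U f \<bullet> udiag W g' = (\<Sum>i\<in>UNIV. \<Sum>j\<in>UNIV. overlap U W i j * (f i * g' j))"
    by (rule inner_udiag)
  moreover have "overlap U W i j * ((f i - g j) * (f' i - g' j)) = overlap U W i j * (f i * f' i)
    - overlap U W i j * (f i * g' j) - overlap U W i j * (f' i * g j) + overlap U W i j * (g j * g' j)" for i j
    by (simp add: algebra_simps)
  ultimately show ?thesis
    by (simp only: inner_diff_left inner_diff_right sum_subtractf sum.distrib)
qed

lemma norm_udiag: "unitary U \<Longrightarrow> (norm (udiag U d))\<^sup>2 = (\<Sum>i\<in>UNIV. (d i)\<^sup>2)"
  unfolding power2_norm_eq_inner by (simp add: inner_udiag_same power2_eq_square)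

lemma eigenvalue_le_norm: "unitary U \<Longrightarrow> \<bar>d i\<bar> \<le> norm (udiag U d)"
proof -
  assume U: "unitary U"
  have "(d i)\<^sup>2 \<le> (\<Sum>i\<in>UNIV. (d i)\<^sup>2)" by (rule member_le_sum) auto
  then have "(d i)\<^sup>2 \<le> (norm (udiag U d))\<^sup>2" by (simp add: norm_udiag[OF U])
  then show ?thesis by (metis abs_le_square_iff abs_norm_cancel)
qed

lemma inner_mat_1_udiag: "unitary U \<Longrightarrow> udiag U d \<bullet> mat 1 = (\<Sum>i\<in>UNIV. d i)"
  using inner_udiag_same[of U d "\<lambda>_. 1"] by (simp add: udiag_1)

lemma Re_trace_eq_inner: "Re (trace A) = A \<bullet> mat 1" for A :: "complex^'n^'n"
  by (simp add: inner_eq_trace)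


section \<open>The exponential in a corner\<close>

lemma subspace_corner: "subspace (corner S)"
  by (auto simp: subspace_def corner_def)

lemma corner_one_diag: "corner_one S = diag_mat (\<lambda>i. if i \<in> S then 1 else 0)"
  by (auto simp: corner_one_def diag_mat_def vec_eq_iff)

lemma hermitian_corner_one: "hermitian (corner_one S)"
  by (simp add: hermitian_def corner_one_diag)

lemma corner_one_in_corner: "corner_one S \<in> corner S"
  by (auto simp: corner_def corner_one_def)

lemma corner_iff: "A \<in> corner S \<longleftrightarrow> corner_one S ** A = A \<and> A ** corner_one S = A"
  unfolding corner_one_diag diag_mat_mult mult_diag_mat
  by (auto simp: corner_def vec_eq_iff)

lemma corner_one_idem: "corner_one S ** corner_one S = corner_one S"
  using corner_one_in_corner corner_iff by blast

lemma corner_hermitian_right: "hermitian A \<Longrightarrow> A ** corner_one S = A \<Longrightarrow> A \<in> corner S"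
  unfolding corner_iff
  by (metis ctranspose_mult hermitian_corner_one hermitian_def)

abbreviation cocorner :: "'n set \<Rightarrow> complex^'n^'n" where
  "cocorner S \<equiv> mat 1 - corner_one S"

lemma cocorner_mult: "corner_one S ** cocorner S = 0" "cocorner S ** corner_one S = 0"
  by (simp_all add: matrix_diff_ldistrib matrix_diff_rdistrib corner_one_idem)

lemma corner_cocorner: "A \<in> corner S \<Longrightarrow> A ** cocorner S = 0"
  by (simp add: matrix_diff_ldistrib corner_iff)

lemma cocorner_idem: "cocorner S ** cocorner S = cocorner S"
  by (simp add: matrix_diff_ldistrib[of "cocorner S"] cocorner_mult)

lemma hermitian_cocorner: "hermitian (cocorner S)"
  by (simp add: hermitian_diff hermitian_corner_one hermitian_mat_1)

lemma inner_corner_cocorner: "A \<in> corner S \<Longrightarrow> A \<bullet> cocorner S = 0"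
  by (simp add: inner_eq_trace_hermitian hermitian_cocorner corner_cocorner trace_def)

lemma inner_corner_one: "A \<in> corner S \<Longrightarrow> A \<bullet> corner_one S = Re (trace A)"
  using inner_corner_cocorner[of A S] by (simp add: Re_trace_eq_inner inner_diff_right)

lemma corner_one_inner_self: "corner_one S \<bullet> corner_one S = real (card S)"
  unfolding inner_corner_one[OF corner_one_in_corner] by (simp add: trace_def corner_one_def if_distrib[of Re] sum.If_cases cong: if_cong)

lemma corner_power_udiag:
  assumes "unitary U"
  shows "corner_power S (udiag U d) m = udiag U (\<lambda>i. d i ^ m) ** corner_one S"
proof (induction m)
  case 0
  then show ?case by (simp add: udiag_1 assms)
next
  case (Suc m)
  then show ?case by (simp add: matrix_mul_assoc udiag_mult assms)
qed

lemma udiag_sum: "udiag U f = (\<Sum>l\<in>UNIV. f l *\<^sub>R udiag U (\<lambda>i. if i = l then 1 else 0))"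
proof -
  have "udiag U f = udiag U (\<lambda>i. \<Sum>l\<in>UNIV. f l * (if i = l then 1 else 0))"
    by (simp add: if_distrib cong: if_cong)
  also have "\<dots> = (\<Sum>l\<in>UNIV. udiag U (\<lambda>i. f l * (if i = l then 1 else 0)))"
  proof -
    have "udiag U (\<lambda>i. \<Sum>l\<in>L. g l i) = (\<Sum>l\<in>L. udiag U (g l))" if "finite L" for L :: "'a set" and g
      using that
      by (induction L) (simp_all add: udiag_add, simp add: vec_eq_iff udiag_entry)
    then show ?thesis by simp
  qed
  finally show ?thesis by (simp only: udiag_cmult)
qed

lemma matrix_sum_mult: "(\<Sum>l\<in>L. f l) ** (B::complex^'n^'n) = (\<Sum>l\<in>L. f l ** B)"
  by (induction L rule: infinite_finite_induct) (simp_all add: matrix_add_rdistrib)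

lemma corner_exp_udiag:
  assumes "unitary U"
  shows "corner_exp S (udiag U d) = udiag U (\<lambda>i. exp (d i)) ** corner_one S"
proof -
  define E where "E l = udiag U (\<lambda>i. if i = l then 1 else 0) ** corner_one S" for l
  have eq: "udiag U f ** corner_one S = (\<Sum>l\<in>UNIV. f l *\<^sub>R E l)" for f
    by (subst udiag_sum) (simp add: matrix_sum_mult matrix_scaleR_left E_def)
  have "(\<lambda>m. \<Sum>l\<in>UNIV. (d l ^ m /\<^sub>R fact m) *\<^sub>R E l) sums (\<Sum>l\<in>UNIV. exp (d l) *\<^sub>R E l)"
    by (intro sums_sum sums_scaleR_left exp_converges)
  moreover have "corner_power S (udiag U d) m /\<^sub>R fact m = (\<Sum>l\<in>UNIV. (d l ^ m /\<^sub>R fact m) *\<^sub>R E l)" for m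
    by (simp add: corner_power_udiag assms eq scaleR_sum_right)
  ultimately show ?thesis unfolding corner_exp_def by (simp add: eq sums_iff)
qed

lemma corner_power_corner: "A \<in> corner S \<Longrightarrow> corner_one S ** corner_power S A m = corner_power S A m"
  by (induction m) (simp_all add: corner_one_idem matrix_mul_assoc corner_iff)

lemma corner_exp_shift:
  assumes A: "A \<in> corner S"
  shows "corner_exp S (A + c *\<^sub>R cocorner S) = corner_exp S A"
proof -
  have "corner_power S (A + c *\<^sub>R cocorner S) m = corner_power S A m" for m
  proof (induction m)
    case (Suc m)
    have "cocorner S ** corner_power S A m = cocorner S ** (corner_one S ** corner_power S A m)"
      by (simp add: corner_power_corner[OF A])
    also have "\<dots> = 0" unfolding matrix_mul_assoc cocorner_mult by simp
    finally show ?case using Suc by (simp add: matrix_add_rdistrib matrix_scaleR_left)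
  qed simp
  then show ?thesis by (simp add: corner_exp_def)
qed

text \<open>
  The zero rows and columns outside the corner contribute a unit block to the full exponential.
  Subtracting a large multiple \<open>t\<close> of the complementary projection makes this block as small as desired,
  so that the exponential of the corner becomes accessible to a spectral decomposition in the full space.
\<close>

lemma udiag_exp_corner:
  assumes W: "unitary W" and A: "A \<in> corner S" and eq: "udiag W y = A - t *\<^sub>R cocorner S"
  shows "udiag W (\<lambda>i. exp (y i)) = corner_exp S A + exp (- t) *\<^sub>R cocorner S"
proof -
  have "udiag W y ** cocorner S = (- t) *\<^sub>R cocorner S"
    unfolding eq matrix_diff_rdistrib[of A] matrix_scaleR_left cocorner_idem corner_cocorner[OF A]
    by simp
  also have "\<dots> = cocorner S ** udiag W (\<lambda>_. - t)"
    using udiag_cmult[of W "- t" "\<lambda>_. 1"]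
    by (simp only: udiag_1[OF W] matrix_scaleR_right matrix_mul_rid mult_1_right)
  finally have "udiag W (\<lambda>i. exp (y i)) ** cocorner S = cocorner S ** udiag W (\<lambda>_. exp (- t))"
    using udiag_intertwine[OF W W, of y _ "\<lambda>_. - t" exp] by simp
  also have "\<dots> = exp (- t) *\<^sub>R cocorner S"
    using udiag_cmult[of W "exp (- t)" "\<lambda>_. 1"]
    by (simp only: udiag_1[OF W] matrix_scaleR_right matrix_mul_rid mult_1_right)
  finally have 1: "udiag W (\<lambda>i. exp (y i)) ** cocorner S = exp (- t) *\<^sub>R cocorner S" .
  have "udiag W (\<lambda>i. exp (y i)) ** corner_one S = corner_exp S A"
    using corner_exp_udiag[OF W, of S y] corner_exp_shift[OF A, of "- t"] by (simp add: eq)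
  then show ?thesis using 1 by (simp add: matrix_diff_ldistrib algebra_simps)
qed

lemma corner_exp_eq:
  assumes "unitary U" "A \<in> corner S" "A = udiag U d"
  shows "corner_exp S A = udiag U (\<lambda>i. exp (d i)) - cocorner S"
proof -
  have "udiag U d = A - 0 *\<^sub>R cocorner S" using assms(3) by simp
  from udiag_exp_corner[OF assms(1,2) this] show ?thesis by simp
qed

lemma corner_exp_corner:
  assumes A: "A \<in> corner S" "hermitian A"
  shows "corner_exp S A \<in> corner S" "hermitian (corner_exp S A)"
proof -
  obtain U d where U: "unitary U" "A = udiag U d" using hermitian_spectral[OF A(2)] .
  show "hermitian (corner_exp S A)"
    unfolding corner_exp_eq[OF U(1) A(1) U(2)]
    by (intro hermitian_diff hermitian_udiag hermitian_cocorner)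
  then show "corner_exp S A \<in> corner S"
    by (intro corner_hermitian_right)
       (simp_all add: U(2) corner_exp_udiag[OF U(1)] corner_one_idem flip: matrix_mul_assoc)
qed

lemma corner_exp_trace_bounds:
  assumes A: "A \<in> corner S" "hermitian A"
  shows "exp (- norm A) * card S \<le> Re (trace (corner_exp S A))"
    "Re (trace (corner_exp S A)) \<le> exp (norm A) * card S"
proof -
  obtain U d where U: "unitary U" "A = udiag U d" using hermitian_spectral[OF A(2)] .
  have W: "unitary (mat 1 :: complex^'a^'a)" by (simp add: unitary_def)
  define g :: "'a \<Rightarrow> real" where "g i = (if i \<in> S then 1 else 0)" for i
  have P: "corner_one S = udiag (mat 1) g"
    by (simp add: udiag_def corner_one_diag g_def[abs_def])
  have "Re (trace (corner_exp S A)) = corner_exp S A \<bullet> corner_one S"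
    by (simp add: inner_corner_one corner_exp_corner A)
  also have "\<dots> = udiag U (\<lambda>i. exp (d i)) \<bullet> corner_one S"
    using inner_corner_cocorner[OF corner_one_in_corner, of S]
    unfolding corner_exp_eq[OF U(1) A(1) U(2)] inner_diff_left[of "udiag _ _"]
    by (simp only: inner_commute[of "cocorner S"])
  also have "\<dots> = (\<Sum>i\<in>UNIV. \<Sum>j\<in>UNIV. overlap U (mat 1) i j * (exp (d i) * g j))"
    by (simp add: P inner_udiag)
  finally have eq: "Re (trace (corner_exp S A)) = \<dots>" .
  have c: "real (card S) = (\<Sum>i\<in>UNIV. \<Sum>j\<in>UNIV. overlap U (mat 1) i j * g j)"
    by (simp add: g_def sum.If_cases flip: overlap_marginals(2)[OF U(1) W])
  have d: "\<bar>d i\<bar> \<le> norm A" for i using eigenvalue_le_norm[OF U(1)] U(2) by metis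
  show "exp (- norm A) * card S \<le> Re (trace (corner_exp S A))"
    unfolding eq c sum_distrib_left
  proof (intro sum_mono)
    fix i j
    have "exp (- norm A) \<le> exp (d i)" using d[of i] by simp
    then show "exp (- norm A) * (overlap U (mat 1) i j * g j) \<le> overlap U (mat 1) i j * (exp (d i) * g j)"
      using mult_right_mono[of _ _ "overlap U (mat 1) i j * g j"]
      by (simp add: overlap_nonneg g_def mult_ac)
  qed
  show "Re (trace (corner_exp S A)) \<le> exp (norm A) * card S"
    unfolding eq c sum_distrib_left
  proof (intro sum_mono)
    fix i j
    have "exp (d i) \<le> exp (norm A)" using d[of i] by simp
    then show "overlap U (mat 1) i j * (exp (d i) * g j) \<le> exp (norm A) * (overlap U (mat 1) i j * g j)"
      using mult_right_mono[of _ _ "overlap U (mat 1) i j * g j"]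
      by (simp add: overlap_nonneg g_def mult_ac)
  qed
qed

section \<open>Entropy and Gibbs matrices\<close>

lemma quadratic_form_inner:
  "Re (\<Sum>i\<in>UNIV. \<Sum>j\<in>UNIV. cnj (v $ i) * A $ i $ j * v $ j) = A \<bullet> (\<chi> i j. v $ i * cnj (v $ j))"
  for A :: "complex^'n^'n"
proof -
  have "Re (cnj (v $ i) * A $ i $ j * v $ j) = (A $ i $ j) \<bullet> (v $ i * cnj (v $ j))" for i j
    by (simp add: inner_complex_def algebra_simps)
  then show ?thesis by (simp add: inner_vec_def)
qed

lemma psd_iff: "psd A \<longleftrightarrow> hermitian A \<and> (\<forall>v. 0 \<le> A \<bullet> (\<chi> i j. v $ i * cnj (v $ j)))"
  unfolding psd_def quadratic_form_inner ..

lemma quadratic_form_udiag: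
  "udiag U d \<bullet> (\<chi> i j. v $ i * cnj (v $ j)) =
    (\<Sum>l\<in>UNIV. d l * (cmod (\<Sum>i\<in>UNIV. cnj (U $ i $ l) * v $ i))\<^sup>2)"
proof -
  define z where "z l = (\<Sum>i\<in>UNIV. cnj (U $ i $ l) * v $ i)" for l
  have z: "of_real ((cmod (z l))\<^sup>2) = (\<Sum>i\<in>UNIV. \<Sum>j\<in>UNIV. cnj (v $ i) * (U $ i $ l * cnj (U $ j $ l)) * v $ j)" for l
  proof -
    have "of_real ((cmod (z l))\<^sup>2) = cnj (z l) * z l" unfolding complex_norm_square by (rule mult.commute)
    also have "\<dots> = (\<Sum>i\<in>UNIV. \<Sum>j\<in>UNIV. (U $ i $ l * cnj (v $ i)) * (cnj (U $ j $ l) * v $ j))"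
      unfolding z_def cnj_sum sum_product by simp
    finally show ?thesis by (simp add: mult_ac)
  qed
  have "(\<Sum>i\<in>UNIV. \<Sum>j\<in>UNIV. cnj (v $ i) * udiag U d $ i $ j * v $ j)
    = (\<Sum>i\<in>UNIV. \<Sum>j\<in>UNIV. \<Sum>l\<in>UNIV. of_real (d l) * (cnj (v $ i) * (U $ i $ l * cnj (U $ j $ l)) * v $ j))"
    by (intro sum.cong refl) (simp add: udiag_entry sum_distrib_left sum_distrib_right mult_ac)
  also have "\<dots> = (\<Sum>i\<in>UNIV. \<Sum>l\<in>UNIV. \<Sum>j\<in>UNIV. of_real (d l) * (cnj (v $ i) * (U $ i $ l * cnj (U $ j $ l)) * v $ j))"
    by (intro sum.cong refl sum.swap)
  also have "\<dots> = (\<Sum>l\<in>UNIV. \<Sum>i\<in>UNIV. \<Sum>j\<in>UNIV. of_real (d l) * (cnj (v $ i) * (U $ i $ l * cnj (U $ j $ l)) * v $ j))"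
    by (rule sum.swap)
  also have "\<dots> = (\<Sum>l\<in>UNIV. of_real (d l * (cmod (z l))\<^sup>2))"
    by (simp only: of_real_mult z sum_distrib_left)
  finally show ?thesis
    unfolding quadratic_form_inner[symmetric] z_def[symmetric] by simp
qed

lemma psd_udiag: "(\<And>i. 0 \<le> d i) \<Longrightarrow> psd (udiag U d)"
  unfolding psd_iff quadratic_form_udiag by (auto intro!: hermitian_udiag sum_nonneg)

lemma psd_eigenvalue_nonneg:
  assumes U: "unitary U" and psd: "psd (udiag U d)"
  shows "0 \<le> d k"
proof -
  define v where "v = (\<chi> i. U $ i $ k)"
  have "(\<Sum>i\<in>UNIV. cnj (U $ i $ l) * v $ i) = (if l = k then 1 else 0)" for l
    using arg_cong[OF unitary_left[OF U], of "\<lambda>A. A $ l $ k"]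
    by (simp add: v_def matrix_matrix_mult_def ctranspose_def mat_def)
  then have "udiag U d \<bullet> (\<chi> i j. v $ i * cnj (v $ j)) = d k"
    by (simp add: quadratic_form_udiag if_distrib[of cmod] if_distrib[of "\<lambda>x. x\<^sup>2"]
        if_distrib[of "\<lambda>x. _ * x"] cong: if_cong)
  then show ?thesis using psd unfolding psd_iff by metis
qed

lemma spectraplex_spectrum:
  assumes "X \<in> spectraplex S"
  obtains U p where "unitary U" "X = udiag U p" "\<And>i. 0 \<le> p i" "\<And>i. p i \<le> 1" "(\<Sum>i\<in>UNIV. p i) = 1"
proof -
  have X: "psd X" "trace X = 1" using assms by (auto simp: spectraplex_def)
  then obtain U p where U: "unitary U" "X = udiag U p"
    using hermitian_spectral[of X] by (auto simp: psd_def)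
  have p: "0 \<le> p i" for i using psd_eigenvalue_nonneg U X(1) by metis
  have s: "(\<Sum>i\<in>UNIV. p i) = 1"
    using X(2) inner_mat_1_udiag[OF U(1), of p] by (simp add: U(2) flip: Re_trace_eq_inner)
  have "p i \<le> (\<Sum>i\<in>UNIV. p i)" for i using p by (intro member_le_sum) auto
  then show thesis using that U p s by auto
qed

lemma spectraplex_corner: "X \<in> spectraplex S \<Longrightarrow> X \<in> corner S"
  by (simp add: spectraplex_def)

lemma spectraplex_hermitian: "X \<in> spectraplex S \<Longrightarrow> hermitian X"
  by (simp add: spectraplex_def psd_def)

lemma spectraplex_norm_le_1:
  assumes X: "X \<in> spectraplex S"
  shows "norm X \<le> 1"
proof -
  obtain U p where U: "unitary U" "X = udiag U p" "\<And>i. 0 \<le> p i" "\<And>i. p i \<le> 1" "(\<Sum>i\<in>UNIV. p i) = 1"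
    using spectraplex_spectrum[OF X] by blast
  have "(norm X)\<^sup>2 = (\<Sum>i\<in>UNIV. (p i)\<^sup>2)" using norm_udiag U by metis
  also have "\<dots> \<le> (\<Sum>i\<in>UNIV. p i)"
    using U(3,4) by (intro sum_mono) (metis mult.right_neutral mult_left_mono power2_eq_square)
  finally show ?thesis using U(5) by (simp add: power_le_one_iff)
qed

lemma closed_spectraplex: "closed (spectraplex S)"
proof -
  have eq: "spectraplex S = corner S \<inter> {A. ctranspose A = A} \<inter>
     (\<Inter>v. {A. 0 \<le> A \<bullet> (\<chi> i j. v $ i * cnj (v $ j))}) \<inter> {A. trace A = 1}"
    by (auto simp: spectraplex_def psd_iff hermitian_def)
  have c1: "closed (corner S)" by (intro closed_subspace subspace_corner)
  have c2: "closed {A::complex^'a^'a. ctranspose A = A}"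
    unfolding ctranspose_def by (intro closed_Collect_eq continuous_intros)
  have c3: "closed {A::complex^'a^'a. trace A = 1}"
    unfolding trace_def by (intro closed_Collect_eq continuous_intros)
  have c4: "closed (\<Inter>v. {A. 0 \<le> A \<bullet> (\<chi> i j. v $ i * cnj (v $ j))})"
    by (intro closed_INT ballI closed_Collect_le continuous_intros)
  show ?thesis unfolding eq by (intro closed_Int c1 c2 c3 c4)
qed

lemma convex_spectraplex: "convex (spectraplex S)"
proof (rule convexI)
  fix A B u v assume "A \<in> spectraplex S" "B \<in> spectraplex S" and uv: "0 \<le> u" "0 \<le> v" "u + v = (1::real)"
  then have A: "A \<in> corner S" "psd A" "trace A = 1" and B: "B \<in> corner S" "psd B" "trace B = 1"
    by (auto simp: spectraplex_def)
  have "trace (u *\<^sub>R A + v *\<^sub>R B) = u *\<^sub>R trace A + v *\<^sub>R trace B"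
    by (simp add: trace_def sum.distrib scaleR_sum_right)
  also have "\<dots> = 1" using A B uv by (simp add: scaleR_conv_of_real flip: of_real_add)
  finally show "u *\<^sub>R A + v *\<^sub>R B \<in> spectraplex S"
    using A B uv subspace_corner[of S]
    by (simp add: spectraplex_def psd_iff hermitian_add hermitian_scaleR subspace_add subspace_scale inner_add_left)
qed

lemma neg_entropy_udiag:
  assumes "unitary U"
  shows "neg_entropy (udiag U p) = (\<Sum>i\<in>UNIV. p i * ln (p i))"
  unfolding neg_entropy_def herm_fun_udiag[OF assms] inner_eq_trace_hermitian[OF hermitian_udiag, symmetric]
  by (rule inner_udiag_same[OF assms])

lemma neg_entropy_nonpos:
  assumes X: "X \<in> spectraplex S"
  shows "neg_entropy X \<le> 0"
proof -
  obtain U p where U: "unitary U" "X = udiag U p" "\<And>i. 0 \<le> p i" "\<And>i. p i \<le> 1" "(\<Sum>i\<in>UNIV. p i) = 1"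
    using spectraplex_spectrum[OF X] by blast
  have "p i * ln (p i) \<le> 0" for i
    using U(3)[of i] U(4)[of i] by (cases "p i = 0") (auto intro!: mult_nonneg_nonpos)
  then show ?thesis unfolding U(2) neg_entropy_udiag[OF U(1)] by (intro sum_nonpos)
qed

lemma nonneg_of_exp_perturbation:
  fixes a b :: real
  assumes "\<And>t. 0 \<le> t \<Longrightarrow> 0 \<le> a + exp (- t) * b"
  shows "0 \<le> a"
proof (rule tendsto_lowerbound)
  show "((\<lambda>t. a + exp (- t) * b) \<longlongrightarrow> a) at_top"
    by (rule tendsto_eq_intros tendsto_mult_left_zero filterlim_compose[OF exp_at_bot filterlim_uminus_at_bot_at_top] refl)+ simp
  show "\<forall>\<^sub>F t in at_top. 0 \<le> a + exp (- t) * b"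
    using eventually_ge_at_top[of "0::real"] by eventually_elim (rule assms)
qed simp

text \<open>
  Only the vectors supported in \<open>S\<close> matter for a matrix of the corner, and on these the added term
  vanishes.
\<close>

lemma psd_corner:
  fixes A :: "complex^'n^'n"
  assumes A: "A \<in> corner S" and psd: "psd (A + c *\<^sub>R cocorner S)"
  shows "psd A"
  unfolding psd_iff
proof (intro conjI allI)
  have "A = (A + c *\<^sub>R cocorner S) - c *\<^sub>R cocorner S" by simp
  also have "hermitian \<dots>"
    using psd by (intro hermitian_diff hermitian_scaleR hermitian_cocorner) (simp add: psd_def)
  finally show "hermitian A" .
  fix v :: "complex^'n"
  define w where "w = (\<chi> i. if i \<in> S then v $ i else 0)"
  let ?w = "\<chi> i j. w $ i * cnj (w $ j)"
  have "A \<bullet> (\<chi> i j. v $ i * cnj (v $ j)) = A \<bullet> ?w"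
    unfolding inner_vec_def using A by (intro sum.cong refl) (auto simp: corner_def w_def)
  moreover have "cocorner S \<bullet> ?w = 0"
    unfolding inner_vec_def by (intro sum.neutral ballI) (auto simp: w_def corner_one_def mat_def)
  moreover have "0 \<le> (A + c *\<^sub>R cocorner S) \<bullet> ?w" using psd unfolding psd_iff by blast
  ultimately show "0 \<le> A \<bullet> (\<chi> i j. v $ i * cnj (v $ j))"
    by (simp add: inner_add_left)
qed

lemma psd_corner_exp:
  fixes A :: "complex^'n^'n"
  assumes A: "A \<in> corner S" "hermitian A"
  shows "psd (corner_exp S A)"
proof -
  obtain U d where U: "unitary U" "A = udiag U d" using hermitian_spectral[OF A(2)] .
  have "corner_exp S A + 1 *\<^sub>R cocorner S = udiag U (\<lambda>i. exp (d i))"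
    using corner_exp_eq[OF U(1) A(1) U(2)] by simp
  moreover have "psd (udiag U (\<lambda>i. exp (d i)))" by (intro psd_udiag) simp
  ultimately show ?thesis using psd_corner[OF corner_exp_corner(1)[OF A]] by metis
qed

text \<open>
  The scalar form of Klein's inequality, with the quadratic gap that makes the entropy strongly convex.
  With \<open>q = exp y\<close>, the bound \<open>p ln (p/q) \<ge> 2 p (1 - \<surd>(q/p))\<close> shows that the divergence on the right is at least
  \<open>(\<surd>p - \<surd>q)\<^sup>2\<close>, and \<open>\<surd>p + \<surd>q\<close> is bounded.
\<close>

lemma scalar_klein:
  fixes p y c :: real
  assumes p: "0 \<le> p" "p \<le> c" and q: "exp y \<le> c"
  shows "(p - exp y)\<^sup>2 \<le> 4 * c * (p * ln p - p * y - p + exp y)"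
proof -
  define q where "q = exp y"
  have q0: "0 < q" "q \<le> c" "y = ln q" using q by (auto simp: q_def)
  have a: "(sqrt p - sqrt q)\<^sup>2 \<le> p * ln p - p * y - p + q"
  proof (cases "p = 0")
    case True then show ?thesis using q0 by simp
  next
    case False
    then have p0: "0 < p" using p by simp
    have "ln (sqrt (q / p)) \<le> sqrt (q / p) - 1" using p0 q0 by (intro ln_le_minus_one) simp
    moreover have "ln (sqrt (q / p)) = (ln q - ln p) / 2" using p0 q0 by (simp add: ln_sqrt ln_div)
    ultimately have "p * (ln q - ln p) \<le> p * (2 * sqrt (q / p) - 2)"
      using p0 by (intro mult_left_mono) auto
    moreover have "p * sqrt (q / p) = sqrt p * sqrt q"
      using p0 by (simp add: real_sqrt_divide) (metis mult.commute real_div_sqrt less_imp_le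
          times_divide_eq_left)
    ultimately show ?thesis using p0 q0 by (simp add: power2_diff algebra_simps)
  qed
  have "(p - q)\<^sup>2 = (sqrt p - sqrt q)\<^sup>2 * (sqrt p + sqrt q)\<^sup>2"
    using p q0 by (simp add: square_diff_square_factored flip: power_mult_distrib)
       (simp add: algebra_simps)
  also have "(sqrt p + sqrt q)\<^sup>2 \<le> 4 * c"
  proof -
    have "(sqrt p + sqrt q)\<^sup>2 \<le> 2 * ((sqrt p)\<^sup>2 + (sqrt q)\<^sup>2)"
      using sum_squares_bound[of "sqrt p" "sqrt q"] by (simp add: power2_sum algebra_simps)
    then show ?thesis using p q0 by simp
  qed
  also have "(sqrt p - sqrt q)\<^sup>2 * (4 * c) \<le> (p * ln p - p * y - p + q) * (4 * c)"
    using a p by (intro mult_right_mono) auto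
  finally have "(p - q)\<^sup>2 \<le> (p * ln p - p * y - p + q) * (4 * c)" by (simp add: mult_left_mono)
  then show ?thesis by (simp add: q_def mult.commute)
qed

text \<open>
  In the proof of Klein's inequality, \<open>1 + CARD('n)\<close> bounds the trace of the exponential, hence its
  eigenvalues; the factor \<open>4\<close> is that of the scalar inequality.
\<close>

definition entropy_modulus :: "'n::finite itself \<Rightarrow> real" where
  "entropy_modulus _ = 1 / (4 * (1 + real CARD('n)))"

lemma entropy_modulus_pos: "0 < entropy_modulus TYPE('n::finite)"
  by (simp add: entropy_modulus_def add_pos_nonneg)

text \<open>
  The scalar inequality is averaged over the eigenvalues of \<open>X\<close> and of \<open>Y - t Q\<close>, where \<open>Q\<close> is the
  complementary projection. The block outside the corner then contributes a multiple of \<open>exp (- t)\<close> to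
  the trace, which disappears as \<open>t\<close> grows.
\<close>

lemma neg_entropy_klein:
  fixes X Y :: "complex^'n^'n"
  assumes X: "X \<in> spectraplex S" and Y: "Y \<in> corner S" "hermitian Y"
    and tr: "trace (corner_exp S Y) = 1"
  shows "entropy_modulus TYPE('n) * (norm (X - corner_exp S Y))\<^sup>2 \<le> neg_entropy X - X \<bullet> Y"
proof -
  let ?G = "corner_exp S Y"
  define n where "n = real CARD('n)"
  define c where "c = 1 + n"
  have c1: "1 \<le> c" by (simp add: c_def n_def)
  define b where "b = cocorner S \<bullet> mat 1"
  have b: "b = n - card S"
    using inner_corner_one[OF corner_one_in_corner, of S] corner_one_inner_self[of S]
    by (simp add: b_def inner_diff_left n_def)
      (metis Re_trace_eq_inner trace_I Re_complex_of_real of_real_of_nat_eq)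
  have bn: "0 \<le> b" "b \<le> n" by (simp_all add: b n_def card_mono)
  obtain U p where U: "unitary U" "X = udiag U p" "\<And>i. 0 \<le> p i" "\<And>i. p i \<le> 1" "(\<Sum>i\<in>UNIV. p i) = 1"
    using spectraplex_spectrum[OF X] by blast
  have GC: "?G \<in> corner S" using corner_exp_corner Y by blast
  have XG: "X - ?G \<in> corner S" using GC spectraplex_corner[OF X] subspace_corner[of S] by (simp add: subspace_diff)
  have "0 \<le> 4 * c * (neg_entropy X - X \<bullet> Y) - (norm (X - ?G))\<^sup>2 + exp (- t) * (4 * c * b)" if t: "0 \<le> t" for t
  proof -
    obtain W y where W: "unitary W" "Y - t *\<^sub>R cocorner S = udiag W y"
      using hermitian_spectral[OF hermitian_diff[OF Y(2) hermitian_scaleR[OF hermitian_cocorner]]] .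
    have E: "udiag W (\<lambda>i. exp (y i)) = ?G + exp (- t) *\<^sub>R cocorner S"
      by (rule udiag_exp_corner[OF W(1) Y(1) W(2)[symmetric]])
    have sumE: "(\<Sum>i\<in>UNIV. exp (y i)) = 1 + exp (- t) * b"
      unfolding inner_mat_1_udiag[OF W(1), symmetric] E inner_add_left b_def
      using tr by (simp flip: Re_trace_eq_inner[of ?G])
    have ec: "exp (y j) \<le> c" for j
    proof -
      have "exp (y j) \<le> (\<Sum>i\<in>UNIV. exp (y i))" by (rule member_le_sum) auto
      also have "\<dots> \<le> 1 + 1 * b" unfolding sumE using t bn by (intro add_left_mono mult_right_mono) auto
      finally show ?thesis using bn by (simp add: c_def)
    qed
    have "(norm (X - ?G))\<^sup>2 \<le> (norm (X - udiag W (\<lambda>i. exp (y i))))\<^sup>2"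
    proof -
      have eq: "X - udiag W (\<lambda>i. exp (y i)) = (X - ?G) + (- exp (- t)) *\<^sub>R cocorner S" by (simp add: E)
      have "orthogonal (X - ?G) ((- exp (- t)) *\<^sub>R cocorner S)"
        using inner_corner_cocorner[OF XG] by (simp add: orthogonal_def)
      from norm_add_Pythagorean[OF this] show ?thesis unfolding eq by simp
    qed
    also have "\<dots> = (\<Sum>i\<in>UNIV. \<Sum>j\<in>UNIV. overlap U W i j * (p i - exp (y j))\<^sup>2)"
      unfolding power2_norm_eq_inner unfolding U(2) inner_udiag_diff[OF U(1) W(1)] by (simp add: power2_eq_square)
    also have "\<dots> \<le> (\<Sum>i\<in>UNIV. \<Sum>j\<in>UNIV. overlap U W i j * (4 * c * (p i * ln (p i) - p i * y j - p i + exp (y j))))"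
      using U(3,4) c1 ec by (intro sum_mono mult_left_mono scalar_klein overlap_nonneg) (auto intro: order_trans)
    also have "\<dots> = 4 * c * (\<Sum>i\<in>UNIV. \<Sum>j\<in>UNIV. overlap U W i j * (p i * ln (p i))
        - overlap U W i j * (p i * y j) - overlap U W i j * p i + overlap U W i j * exp (y j))"
      unfolding sum_distrib_left by (intro sum.cong refl) (simp add: algebra_simps)
    also have "\<dots> = 4 * c * (neg_entropy X - X \<bullet> (Y - t *\<^sub>R cocorner S) - 1 + (1 + exp (- t) * b))"
      unfolding sum_subtractf sum.distrib unfolding overlap_marginals[OF U(1) W(1), symmetric]
        inner_udiag[symmetric] W(2) sumE U(5) U(2) neg_entropy_udiag[OF U(1)] ..
    also have "X \<bullet> (Y - t *\<^sub>R cocorner S) = X \<bullet> Y"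
      using inner_corner_cocorner[OF spectraplex_corner[OF X]] by (simp only: inner_diff_right[of X Y] inner_scaleR_right)
    finally show ?thesis by (simp add: algebra_simps)
  qed
  from nonneg_of_exp_perturbation[OF this]
  have "(norm (X - ?G))\<^sup>2 \<le> 4 * c * (neg_entropy X - X \<bullet> Y)" by simp
  then show ?thesis using c1 by (simp add: entropy_modulus_def c_def[unfolded n_def, symmetric] field_simps)
qed

text \<open>
  The exponential of \<open>Y\<close> and \<open>Y\<close> itself commute, so \<open>p = e\<^sup>y\<close> for any eigenvalues \<open>p > 0\<close> and \<open>y\<close> of
  overlapping eigenvectors.
\<close>

lemma neg_entropy_corner_exp:
  assumes Y: "Y \<in> corner S" "hermitian Y"
  shows "neg_entropy (corner_exp S Y) = corner_exp S Y \<bullet> Y"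
proof -
  let ?G = "corner_exp S Y"
  obtain W y where W: "unitary W" "Y = udiag W y" using hermitian_spectral[OF Y(2)] .
  have GC: "?G \<in> corner S" "hermitian ?G" using corner_exp_corner Y by blast+
  obtain U p where U: "unitary U" "?G = udiag U p" using hermitian_spectral[OF GC(2)] .
  let ?m = "ctranspose U ** W"
  have E: "udiag W (\<lambda>i. exp (y i)) = ?G + cocorner S" using corner_exp_eq[OF W(1) Y(1) W(2)] by simp
  have "udiag U p ** udiag W (\<lambda>i. exp (y i)) = udiag U p ** udiag U p"
    unfolding E matrix_add_ldistrib using corner_cocorner[OF GC(1)] by (simp add: U(2))
  also have "\<dots> = udiag U (\<lambda>i. p i * p i)" by (rule udiag_mult[OF U(1)])
  finally have "ctranspose U ** (udiag U p ** udiag W (\<lambda>i. exp (y i))) ** W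
    = ctranspose U ** udiag U (\<lambda>i. p i * p i) ** W" by simp
  moreover have "ctranspose U ** (udiag U p ** udiag W (\<lambda>i. exp (y i))) ** W
    = (ctranspose U ** U) ** diag_mat p ** ?m ** diag_mat (\<lambda>i. exp (y i)) ** (ctranspose W ** W)"
    by (simp add: udiag_def matrix_mul_assoc)
  moreover have "ctranspose U ** udiag U (\<lambda>i. p i * p i) ** W
    = (ctranspose U ** U) ** diag_mat (\<lambda>i. p i * p i) ** ?m"
    by (simp add: udiag_def matrix_mul_assoc)
  ultimately have m: "diag_mat p ** ?m ** diag_mat (\<lambda>i. exp (y i)) = diag_mat (\<lambda>i. p i * p i) ** ?m"
    by (simp add: unitary_left U(1) W(1))
  have "of_real (p i) * ?m $ i $ j * of_real (exp (y j)) = of_real (p i * p i) * ?m $ i $ j" for i j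
    using arg_cong[OF m, of "\<lambda>A. A $ i $ j"] by (simp only: diag_mat_mult mult_diag_mat vec_lambda_beta)
  then have "?m $ i $ j * of_real (p i * (p i - exp (y j))) = 0" for i j
    by (simp only: of_real_mult of_real_diff) (simp only: algebra_simps cancel_comm_monoid_add_class.diff_cancel)
  then have "?m $ i $ j = 0 \<or> p i = 0 \<or> p i = exp (y j)" for i j
    by (simp only: mult_eq_0_iff of_real_eq_0_iff right_minus_eq)
  then have "overlap U W i j * (p i * y j) = overlap U W i j * (p i * ln (p i))" for i j
    by (metis overlap_def ln_exp mult_zero_left norm_zero power_zero_numeral)
  moreover have "?G \<bullet> Y = (\<Sum>i\<in>UNIV. \<Sum>j\<in>UNIV. overlap U W i j * (p i * y j))"
    unfolding U(2) unfolding W(2) inner_udiag ..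
  ultimately have "?G \<bullet> Y = (\<Sum>i\<in>UNIV. \<Sum>j\<in>UNIV. overlap U W i j * (p i * ln (p i)))" by presburger
  then show ?thesis by (simp add: U neg_entropy_udiag overlap_marginals(1)[OF U(1) W(1), symmetric])
qed

definition gibbs_log :: "'n set \<Rightarrow> complex^'n^'n \<Rightarrow> complex^'n^'n" where
  "gibbs_log S A = A - ln (Re (trace (corner_exp S A))) *\<^sub>R corner_one S"

context
  fixes S :: "'n::finite set" and Y :: "complex^'n^'n"
  assumes S: "S \<noteq> {}" and Y: "Y \<in> corner S" "hermitian Y"
begin

lemma corner_exp_trace_pos: "0 < Re (trace (corner_exp S Y))"
proof -
  have "0 < exp (- norm Y) * card S" using S by (simp add: card_gt_0_iff)
  then show ?thesis using corner_exp_trace_bounds(1)[OF Y] by linarith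
qed

lemma gibbs_scaleR: "gibbs S Y = (1 / Re (trace (corner_exp S Y))) *\<^sub>R corner_exp S Y"
  unfolding gibbs_def
  by (subst trace_hermitian[OF corner_exp_corner(2)[OF Y]])
     (simp add: vec_eq_iff scaleR_conv_of_real[where 'a=complex])

lemma gibbs_log_corner: "gibbs_log S Y \<in> corner S" "hermitian (gibbs_log S Y)"
  unfolding gibbs_log_def using Y subspace_corner[of S] corner_one_in_corner[of S]
  by (auto intro!: hermitian_diff hermitian_scaleR hermitian_corner_one simp: subspace_diff subspace_scale)

text \<open>Normalizing the exponential amounts to subtracting a multiple of the identity from \<open>Y\<close>.\<close>

lemma gibbs_eq_corner_exp: "gibbs S Y = corner_exp S (gibbs_log S Y)"
proof -
  define c where "c = ln (Re (trace (corner_exp S Y)))"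
  obtain U d where U: "unitary U" "Y = udiag U d" using hermitian_spectral[OF Y(2)] .
  have "udiag U (\<lambda>i. d i - c) = Y - c *\<^sub>R mat 1"
    using udiag_cmult[of U c "\<lambda>_. 1"] by (simp add: udiag_diff U udiag_1)
  also have "\<dots> = gibbs_log S Y + (- c) *\<^sub>R cocorner S"
    by (simp add: gibbs_log_def c_def algebra_simps)
  finally have "corner_exp S (udiag U (\<lambda>i. d i - c)) = corner_exp S (gibbs_log S Y)"
    using corner_exp_shift[OF gibbs_log_corner(1), of "- c"] by simp
  moreover have "corner_exp S (udiag U (\<lambda>i. d i - c)) = udiag U (\<lambda>i. exp (- c) * exp (d i)) ** corner_one S"
    by (simp add: corner_exp_udiag[OF U(1)] exp_diff exp_minus field_simps)
  also have "\<dots> = exp (- c) *\<^sub>R corner_exp S Y"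
    by (simp add: udiag_cmult matrix_scaleR_left corner_exp_udiag[OF U(1)] U(2))
  also have "exp (- c) = 1 / Re (trace (corner_exp S Y))"
    using corner_exp_trace_pos by (simp add: c_def exp_minus field_simps)
  finally show ?thesis by (simp add: gibbs_scaleR)
qed

lemma trace_gibbs: "trace (gibbs S Y) = 1"
proof -
  have "trace (gibbs S Y) = (1 / Re (trace (corner_exp S Y))) *\<^sub>R trace (corner_exp S Y)"
    unfolding gibbs_scaleR by (simp add: trace_def scaleR_sum_right)
  also have "\<dots> = 1"
    using corner_exp_trace_pos
    by (subst (2) trace_hermitian[OF corner_exp_corner(2)[OF Y]]) (simp add: scaleR_conv_of_real)
  finally show ?thesis .
qed

lemma gibbs_in_spectraplex: "gibbs S Y \<in> spectraplex S"
  using psd_corner_exp[OF gibbs_log_corner] corner_exp_corner(1)[OF gibbs_log_corner] trace_gibbs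
  by (simp add: spectraplex_def gibbs_eq_corner_exp)

end

lemma spectraplex_diff_inner_corner_one:
  "A \<in> spectraplex S \<Longrightarrow> B \<in> spectraplex S \<Longrightarrow> (A - B) \<bullet> corner_one S = 0"
  by (simp add: inner_diff_left inner_corner_one spectraplex_def)

text \<open>
  The Gibbs variational principle with a quadratic gap: \<open>Y\<close> is a subgradient of the entropy at
  \<open>gibbs S Y\<close>, although the entropy is not differentiable at the boundary. The uniqueness of minimizers,
  the Lipschitz continuity of the Gibbs map and the decrease of the regularized cost all rest on this.
\<close>

lemma neg_entropy_strongly_convex:
  fixes Y :: "complex^'n^'n"
  assumes S: "S \<noteq> {}" and Y: "Y \<in> corner S" "hermitian Y" and X: "X \<in> spectraplex S"
  shows "neg_entropy (gibbs S Y) + Y \<bullet> (X - gibbs S Y) + entropy_modulus TYPE('n) * (norm (X - gibbs S Y))\<^sup>2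
     \<le> neg_entropy X"
proof -
  let ?L = "gibbs_log S Y"
  note L = gibbs_log_corner[OF S Y] and eq = gibbs_eq_corner_exp[OF S Y] 
  have "entropy_modulus TYPE('n) * (norm (X - gibbs S Y))\<^sup>2 \<le> neg_entropy X - X \<bullet> ?L"
    using neg_entropy_klein[OF X L] trace_gibbs[OF S Y] by (simp add: eq)
  moreover have "neg_entropy (gibbs S Y) = gibbs S Y \<bullet> ?L"
    using neg_entropy_corner_exp[OF L] by (simp add: eq)
  moreover have "(X - gibbs S Y) \<bullet> ?L = (X - gibbs S Y) \<bullet> Y"
    using spectraplex_diff_inner_corner_one[OF X gibbs_in_spectraplex[OF S Y]]
    by (simp only: gibbs_log_def inner_diff_right inner_scaleR_right)
  ultimately show ?thesis by (simp add: inner_diff_left inner_commute[of Y])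
qed

text \<open>
  The strong convexity estimates at \<open>Y\<close> and at \<open>Y'\<close>, each applied to the Gibbs matrix of the other, add
  up to a lower bound for \<open>(Y - Y') \<bullet> (gibbs S Y - gibbs S Y')\<close>.
\<close>

lemma gibbs_lipschitz:
  fixes Y Y' :: "complex^'n^'n"
  assumes S: "S \<noteq> {}" and Y: "Y \<in> corner S" "hermitian Y" and Y': "Y' \<in> corner S" "hermitian Y'"
  shows "norm (gibbs S Y - gibbs S Y') \<le> norm (Y - Y') / (2 * entropy_modulus TYPE('n))"
proof -
  let ?m = "entropy_modulus TYPE('n)" and ?G = "gibbs S Y" and ?G' = "gibbs S Y'"
  have "2 * (?m * (norm (?G - ?G'))\<^sup>2) \<le> (Y - Y') \<bullet> (?G - ?G')"
    using neg_entropy_strongly_convex[OF S Y gibbs_in_spectraplex[OF S Y']]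
      neg_entropy_strongly_convex[OF S Y' gibbs_in_spectraplex[OF S Y]]
    by (simp add: norm_minus_commute[of ?G' ?G] inner_diff_left inner_diff_right)
  also have "\<dots> \<le> norm (Y - Y') * norm (?G - ?G')" by (rule norm_cauchy_schwarz)
  finally have "norm (?G - ?G') * (2 * ?m * norm (?G - ?G')) \<le> norm (?G - ?G') * norm (Y - Y')"
    by (simp add: power2_eq_square mult_ac)
  then have "2 * ?m * norm (?G - ?G') \<le> norm (Y - Y')"
    by (cases "norm (?G - ?G') = 0") (simp_all only: mult_le_cancel_left_pos zero_less_norm_iff
        norm_eq_zero norm_zero mult_zero_right norm_ge_zero simp_thms)
  then show ?thesis using entropy_modulus_pos[where 'n='n] by (simp add: field_simps)
qed

text \<open>
  The Gibbs map forgets multiples of the identity; \<open>center S\<close> is the orthogonal projection that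
  removes them.
\<close>

definition center :: "'n::finite set \<Rightarrow> complex^'n^'n \<Rightarrow> complex^'n^'n" where
  "center S A = A - ((A \<bullet> corner_one S) / card S) *\<^sub>R corner_one S"

lemma linear_center: "linear (center S)"
  by (rule linearI) (simp_all add: center_def inner_add_left add_divide_distrib algebra_simps)

lemma center_corner: "A \<in> corner S \<Longrightarrow> center S A \<in> corner S"
  unfolding center_def using subspace_corner[of S] corner_one_in_corner[of S]
  by (simp add: subspace_diff subspace_scale)

lemma center_hermitian: "hermitian A \<Longrightarrow> hermitian (center S A)"
  unfolding center_def by (intro hermitian_diff hermitian_scaleR hermitian_corner_one)

lemma inner_center_corner_one: "S \<noteq> {} \<Longrightarrow> center S A \<bullet> corner_one S = 0"
  by (simp add: center_def inner_diff_left corner_one_inner_self)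

lemma inner_center: "center S A \<bullet> B = A \<bullet> center S B"
  by (simp add: center_def inner_diff_left inner_diff_right inner_commute)

lemma norm_center_le: "norm (center S A) \<le> norm A"
proof (cases "S = {}")
  case True then show ?thesis by (simp add: center_def)
next
  case False
  define B where "B = ((A \<bullet> corner_one S) / card S) *\<^sub>R corner_one S"
  have "orthogonal (center S A) B"
    using inner_center_corner_one[OF False] by (simp add: orthogonal_def B_def)
  from norm_add_Pythagorean[OF this] have "(norm (center S A + B))\<^sup>2 = (norm (center S A))\<^sup>2 + (norm B)\<^sup>2" .
  moreover have "center S A + B = A" by (simp only: center_def B_def diff_add_cancel)
  ultimately have "(norm (center S A))\<^sup>2 \<le> (norm A)\<^sup>2" by simp
  then show ?thesis by (rule power2_le_imp_le) (rule norm_ge_zero)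
qed

lemma center_idem: "A \<bullet> corner_one S = 0 \<Longrightarrow> center S A = A"
  by (simp add: center_def)

lemma center_add_corner_one: "S \<noteq> {} \<Longrightarrow> center S (A + c *\<^sub>R corner_one S) = center S A"
  by (simp add: center_def inner_add_left corner_one_inner_self algebra_simps add_divide_distrib)

lemma gibbs_center:
  assumes S: "S \<noteq> {}" and Y: "Y \<in> corner S" "hermitian Y"
  shows "gibbs S (center S Y) = gibbs S Y"
proof -
  let ?Z = "center S Y"
  note Z = center_corner[OF Y(1)] center_hermitian[OF Y(2), of S]
  let ?m = "entropy_modulus TYPE('a)" and ?G = "gibbs S Y" and ?G' = "gibbs S ?Z"
  have 0: "(?G - ?G') \<bullet> corner_one S = 0"
    by (intro spectraplex_diff_inner_corner_one gibbs_in_spectraplex S Y Z)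
  have "2 * (?m * (norm (?G - ?G'))\<^sup>2) \<le> (Y - ?Z) \<bullet> (?G - ?G')"
    using neg_entropy_strongly_convex[OF S Y gibbs_in_spectraplex[OF S Z]]
      neg_entropy_strongly_convex[OF S Z gibbs_in_spectraplex[OF S Y]]
    by (simp add: norm_minus_commute[of ?G' ?G] inner_diff_left inner_diff_right)
  also have "\<dots> = 0" using 0 by (simp add: center_def inner_commute)
  finally show ?thesis using entropy_modulus_pos[where 'n='a] by (simp add: mult_le_0_iff)
qed

text \<open>
  The logarithms of the Gibbs matrices have bounded spectra, and there
  \<open>(a - b) (e\<^sup>a - e\<^sup>b) \<ge> c (a - b)\<^sup>2\<close>. They differ from \<open>Y\<close> and \<open>Y'\<close> by multiples of the identity, which are
  invisible to differences of Gibbs matrices and are removed by centering.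
\<close>

lemma gibbs_strongly_monotone:
  fixes S :: "'n::finite set"
  assumes S: "S \<noteq> {}" 
  shows "\<exists>c>0. \<forall>Y Y'. Y \<in> corner S \<longrightarrow> hermitian Y \<longrightarrow> Y' \<in> corner S \<longrightarrow> hermitian Y' \<longrightarrow>
    norm Y \<le> R \<longrightarrow> norm Y' \<le> R \<longrightarrow>
    c * (norm (center S (Y - Y')))\<^sup>2 \<le> (Y - Y') \<bullet> (gibbs S Y - gibbs S Y')"
proof -
  define B where "B = R + (R + ln (card S)) * norm (corner_one S)"
  have card1: "1 \<le> real (card S)" using S by (simp add: Suc_leI card_gt_0_iff)
  have bound: "norm (gibbs_log S Y) \<le> B" if Y: "Y \<in> corner S" "hermitian Y" and R: "norm Y \<le> R" for Y
  proof -
    let ?t = "Re (trace (corner_exp S Y))"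
    have t: "exp (- R) \<le> ?t" "?t \<le> exp (R + ln (card S))"
    proof -
      have "exp (- R) * 1 \<le> exp (- norm Y) * card S" using R card1 by (intro mult_mono) auto
      then show "exp (- R) \<le> ?t" using corner_exp_trace_bounds(1)[OF Y] by simp
      have "exp (norm Y) * card S \<le> exp R * card S" using R by (intro mult_right_mono) auto
      also have "exp R * card S = exp (R + ln (card S))" using card1 by (simp add: exp_add)
      finally show "?t \<le> exp (R + ln (card S))"
        using corner_exp_trace_bounds(2)[OF Y] by linarith
    qed
    have "- R \<le> ln ?t" "ln ?t \<le> R + ln (card S)"
      using ln_ge_iff[OF corner_exp_trace_pos[OF S Y], of "- R"] t(1)
        ln_mono[OF t(2) corner_exp_trace_pos[OF S Y]] by simp_all
    then have "\<bar>ln ?t\<bar> \<le> R + ln (card S)" using ln_ge_zero[OF card1] by linarith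
    then have "\<bar>ln ?t\<bar> * norm (corner_one S) \<le> (R + ln (card S)) * norm (corner_one S)"
      by (intro mult_right_mono) auto
    moreover have "norm (gibbs_log S Y) \<le> norm Y + \<bar>ln ?t\<bar> * norm (corner_one S)"
      unfolding gibbs_log_def by (metis norm_triangle_ineq4 norm_scaleR)
    ultimately show ?thesis using R by (simp add: B_def)
  qed
  have main: "exp (- B) * (norm (center S (Y - Y')))\<^sup>2 \<le> (Y - Y') \<bullet> (gibbs S Y - gibbs S Y')"
    if Y: "Y \<in> corner S" "hermitian Y" "norm Y \<le> R" and Y': "Y' \<in> corner S" "hermitian Y'" "norm Y' \<le> R"
    for Y Y'
  proof -
    let ?L = "gibbs_log S Y" and ?L' = "gibbs_log S Y'"
    note L = gibbs_log_corner[OF S Y(1,2)] and L' = gibbs_log_corner[OF S Y'(1,2)]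
    obtain U d where U: "unitary U" "?L = udiag U d" using hermitian_spectral[OF L(2)] .
    obtain W e where W: "unitary W" "?L' = udiag W e" using hermitian_spectral[OF L'(2)] .
    have de: "- B \<le> d i" "- B \<le> e i" for i
      using eigenvalue_le_norm[OF U(1), of d i] eigenvalue_le_norm[OF W(1), of e i] bound[OF Y] bound[OF Y']
      unfolding U(2) W(2) by linarith+
    have scal: "exp (- B) * ((a - b) * (a - b)) \<le> (a - b) * (exp a - exp b)" if "- B \<le> a" "- B \<le> b" for a b
    proof -
      have *: "exp (- B) * (a - b) \<le> exp a - exp b" if "- B \<le> b" "b \<le> a" for a b :: real
      proof -
        have "exp (- B) * (a - b) \<le> exp b * (exp (a - b) - 1)"
          using that exp_ge_add_one_self[of "a - b"] by (intro mult_mono) (auto simp: le_diff_eq add.commute)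
        also have "\<dots> = exp a - exp b" by (simp add: algebra_simps flip: exp_add)
        finally show ?thesis .
      qed
      show ?thesis
      proof (cases "b \<le> a")
        case True
        then show ?thesis using mult_left_mono[OF *[OF that(2) True], of "a - b"] by (simp add: mult_ac)
      next
        case False
        then show ?thesis using mult_left_mono[OF *[OF that(1), of b], of "b - a"] by (simp add: algebra_simps)
      qed
    qed
    have "exp (- B) * (norm (?L - ?L'))\<^sup>2 =
      (\<Sum>i\<in>UNIV. \<Sum>j\<in>UNIV. overlap U W i j * (exp (- B) * ((d i - e j) * (d i - e j))))"
      unfolding power2_norm_eq_inner unfolding U(2) W(2) inner_udiag_diff[OF U(1) W(1)]
      by (simp add: sum_distrib_left mult_ac)
    also have "\<dots> \<le> (\<Sum>i\<in>UNIV. \<Sum>j\<in>UNIV. overlap U W i j * ((d i - e j) * (exp (d i) - exp (e j))))"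
      using de by (intro sum_mono mult_left_mono scal overlap_nonneg)
    also have "\<dots> = (?L - ?L') \<bullet> (udiag U (\<lambda>i. exp (d i)) - udiag W (\<lambda>i. exp (e i)))"
      unfolding U(2) W(2) inner_udiag_diff[OF U(1) W(1)] ..
    also have "udiag U (\<lambda>i. exp (d i)) - udiag W (\<lambda>i. exp (e i)) = gibbs S Y - gibbs S Y'"
      using corner_exp_eq[OF U(1) L(1) U(2)] corner_exp_eq[OF W(1) L'(1) W(2)]
      by (simp add: gibbs_eq_corner_exp[OF S Y(1,2)] gibbs_eq_corner_exp[OF S Y'(1,2)])
    finally have 1: "exp (- B) * (norm (?L - ?L'))\<^sup>2 \<le> (?L - ?L') \<bullet> (gibbs S Y - gibbs S Y')" .
    define r where "r = ln (Re (trace (corner_exp S Y'))) - ln (Re (trace (corner_exp S Y)))"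
    have diff: "?L - ?L' = (Y - Y') + r *\<^sub>R corner_one S"
      by (simp add: gibbs_log_def r_def algebra_simps)
    have "(gibbs S Y - gibbs S Y') \<bullet> corner_one S = 0"
      by (intro spectraplex_diff_inner_corner_one gibbs_in_spectraplex S Y Y')
    then have 2: "(?L - ?L') \<bullet> (gibbs S Y - gibbs S Y') = (Y - Y') \<bullet> (gibbs S Y - gibbs S Y')"
      unfolding diff inner_add_left inner_scaleR_left by (simp add: inner_commute[of "corner_one S"])
    have "norm (center S (Y - Y')) \<le> norm (?L - ?L')"
      unfolding center_add_corner_one[OF S, of "Y - Y'" r, symmetric] diff by (rule norm_center_le)
    then have "exp (- B) * (norm (center S (Y - Y')))\<^sup>2 \<le> exp (- B) * (norm (?L - ?L'))\<^sup>2"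
      by (intro mult_left_mono power_mono) auto
    then show ?thesis using 1 2 by linarith
  qed
  show ?thesis by (rule exI[of _ "exp (- B)"]) (use main in auto)
qed

section \<open>Smooth convex costs on the feasible set\<close>

lemma spectraplex_contains_perturbed_center:
  fixes T :: "complex^'n^'n"
  assumes S: "S \<noteq> {}" and T: "T \<in> corner S" "hermitian T" "T \<bullet> corner_one S = 0"
    and small: "norm T \<le> 1 / card S"
  shows "(1 / card S) *\<^sub>R corner_one S + T \<in> spectraplex S"
proof -
  let ?A = "(1 / card S) *\<^sub>R corner_one S + T"
  have card: "0 < real (card S)" using S by (simp add: card_gt_0_iff)
  obtain U d where U: "unitary U" "T = udiag U d" using hermitian_spectral[OF T(2)] .
  have "udiag U (\<lambda>i. 1 / card S * 1 + d i) = (1 / card S) *\<^sub>R mat 1 + T"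
    unfolding udiag_add udiag_cmult by (simp only: udiag_1[OF U(1)] U(2))
  also have "\<dots> = ?A + (1 / card S) *\<^sub>R cocorner S" by (simp add: algebra_simps)
  finally have eq: "udiag U (\<lambda>i. 1 / card S * 1 + d i) = ?A + (1 / card S) *\<^sub>R cocorner S" .
  have "psd (udiag U (\<lambda>i. 1 / card S * 1 + d i))"
  proof (rule psd_udiag)
    fix i
    show "0 \<le> 1 / card S * 1 + d i"
    proof -
      have "\<bar>d i\<bar> \<le> norm T" unfolding U(2) by (rule eigenvalue_le_norm[OF U(1)])
      then have "\<bar>d i\<bar> \<le> 1 / card S" using small by (rule order_trans)
      then show ?thesis by (simp only: abs_le_iff mult_1_right) simp
    qed
  qed
  then have "psd (?A + (1 / card S) *\<^sub>R cocorner S)" unfolding eq .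
  moreover have A: "?A \<in> corner S"
    using T(1) subspace_corner[of S] corner_one_in_corner[of S] by (simp add: subspace_add subspace_scale)
  ultimately have psd: "psd ?A" by (rule psd_corner[rotated])
  have "Re (trace ?A) = 1"
    unfolding inner_corner_one[OF A, symmetric] using T(3) S
    by (simp add: inner_add_left corner_one_inner_self)
  then have "trace ?A = 1" using trace_hermitian[of ?A] psd by (simp add: psd_def)
  then show ?thesis using A psd by (simp add: spectraplex_def)
qed

text \<open>
  Differences of matrices of the spectraplex contain a ball of traceless Hermitian matrices, so testing
  against them controls the norm. This transfers bounds for directional derivatives to gradient
  matrices, which are determined by such tests only. The case \<open>T = 0\<close> is separate since \<open>c\<close> may be
  negative when the spectraplex is a single point.
\<close>

lemma traceless_norm_le:
  fixes T :: "complex^'n^'n"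
  assumes S: "S \<noteq> {}" and T: "T \<in> corner S" "hermitian T" "T \<bullet> corner_one S = 0"
    and test: "\<And>A B. A \<in> spectraplex S \<Longrightarrow> B \<in> spectraplex S \<Longrightarrow> T \<bullet> (A - B) \<le> c * norm (A - B)"
  shows "norm T \<le> c \<or> T = 0"
proof (cases "T = 0")
  case False
  have card: "0 < real (card S)" using S by (simp add: card_gt_0_iff)
  define e where "e = 1 / (card S * norm T)"
  have e: "0 < e" "norm (e *\<^sub>R T) \<le> 1 / card S" using False card by (simp_all add: e_def)
  define B where "B = (1 / card S) *\<^sub>R corner_one S"
  have "B + e *\<^sub>R T \<in> spectraplex S"
    unfolding B_def using T e(2) subspace_corner[of S]
    by (intro spectraplex_contains_perturbed_center[OF S] hermitian_scaleR) (auto simp: subspace_scale)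
  moreover have "B + 0 \<in> spectraplex S"
    unfolding B_def using subspace_corner[of S]
    by (intro spectraplex_contains_perturbed_center[OF S] hermitian_0) (auto simp: subspace_0)
  moreover note test
  ultimately have "T \<bullet> (B + e *\<^sub>R T - (B + 0)) \<le> c * norm (B + e *\<^sub>R T - (B + 0))" by blast
  then have "e * (norm T * norm T) \<le> e * (c * norm T)"
    using e by (simp add: dot_square_norm power2_eq_square mult_ac)
  then have "norm T \<le> c" using e False by simp
  then show ?thesis ..
qed simp

lemma times_differentiable_1_lipschitz:
  fixes g :: "'a::euclidean_space \<Rightarrow> real"
  assumes g: "times_differentiable_on 1 g U" and U: "open U" and S: "compact S" "convex S" "S \<subseteq> U"
  shows "\<exists>L\<ge>0. \<forall>x\<in>S. \<forall>y\<in>S. \<bar>g x - g y\<bar> \<le> L * norm (x - y)"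
proof -
  let ?D = "\<lambda>x. frechet_derivative g (at x)"
  have der: "(g has_derivative ?D x) (at x)" if "x \<in> S" for x
  proof -
    have "g differentiable at x"
      using g U S that by (auto simp: differentiable_on_def at_within_open[OF _ U] subset_eq)
    then show ?thesis by (simp add: frechet_derivative_works)
  qed
  define N where "N x = (\<Sum>b\<in>Basis. \<bar>?D x b\<bar>)" for x
  have cont: "continuous_on S (\<lambda>x. ?D x b)" for b
  proof (rule continuous_on_subset[OF _ S(3)])
    show "continuous_on U (\<lambda>x. ?D x b)" using g by simp
  qed
  then have "compact (N ` S)"
    unfolding N_def by (intro compact_continuous_image S(1) continuous_intros)
  then have "bounded (N ` S)" by (rule compact_imp_bounded)
  then obtain B where "\<forall>y\<in>N ` S. norm y \<le> B" unfolding bounded_iff by blast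
  then have B: "N x \<le> \<bar>B\<bar>" if "x \<in> S" for x using that by fastforce
  have "onorm (?D x) \<le> \<bar>B\<bar>" if x: "x \<in> S" for x
  proof (rule onorm_bound)
    fix w
    have lin: "linear (?D x)" using der[OF x] has_derivative_linear by blast
    have "?D x w = ?D x (\<Sum>b\<in>Basis. (w \<bullet> b) *\<^sub>R b)" by (simp add: euclidean_representation)
    also have "\<dots> = (\<Sum>b\<in>Basis. (w \<bullet> b) * ?D x b)" using lin by (simp add: linear_sum linear_scale)
    also have "norm \<dots> \<le> (\<Sum>b\<in>Basis. norm w * \<bar>?D x b\<bar>)"
      by (intro sum_norm_le) (simp add: abs_mult mult_right_mono Basis_le_norm)
    also have "\<dots> \<le> \<bar>B\<bar> * norm w"
      using mult_left_mono[OF B[OF x], of "norm w"]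
      by (simp add: N_def mult.commute[of _ "norm w"] flip: sum_distrib_left)
    finally show "norm (?D x w) \<le> \<bar>B\<bar> * norm w" .
  qed simp
  with differentiable_bound[OF S(2) has_derivative_at_withinI[OF der], of "\<bar>B\<bar>"]
  show ?thesis by (intro exI[of _ "\<bar>B\<bar>"]) auto
qed

text \<open>
  The field is the derivative of a smooth extension. Its Lipschitz constant comes from the second
  derivatives, which are bounded on a compact set, and the mean value theorem along segments gives the
  second-order estimate.
\<close>

lemma smooth_on_derivative_field:
  fixes F :: "'a::euclidean_space \<Rightarrow> real"
  assumes F: "smooth_on S F" and S: "compact S" "convex S"
  obtains D L where "0 \<le> L" "\<And>x. linear (D x)"
    "\<And>x y v. x \<in> S \<Longrightarrow> y \<in> S \<Longrightarrow> \<bar>D x v - D y v\<bar> \<le> L * norm (x - y) * norm v"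
    "\<And>x y. x \<in> S \<Longrightarrow> y \<in> S \<Longrightarrow> \<bar>F y - F x - D x (y - x)\<bar> \<le> L * (norm (y - x))\<^sup>2"
    "\<And>x. x \<in> S \<Longrightarrow> (F has_derivative D x) (at x within S)"
proof -
  obtain U h where U: "open U" "S \<subseteq> U" and h: "\<And>x. x \<in> S \<Longrightarrow> h x = F x"
    and td: "times_differentiable_on m h U" for m
    using F unfolding smooth_on_def by blast
  define D where "D x = (if x \<in> S then frechet_derivative h (at x) else (\<lambda>_. 0))" for x
  have der: "(h has_derivative D x) (at x)" if "x \<in> S" for x
  proof -
    have "h differentiable at x"
      using td[of 1] U that by (auto simp: differentiable_on_def at_within_open[OF _ U(1)] subset_eq)
    then show ?thesis using that by (simp add: D_def frechet_derivative_works)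
  qed
  have derF: "(F has_derivative D x) (at x within S)" if "x \<in> S" for x
    using has_derivative_transform[OF that _ has_derivative_at_withinI[OF der[OF that]], of F] h by simp
  have lin: "linear (D x)" for x
  proof (cases "x \<in> S")
    case True
    then show ?thesis using has_derivative_linear[OF der[OF True]] by simp
  next
    case False
    then have "D x = (\<lambda>_. 0)" by (simp add: D_def)
    then show ?thesis by (simp add: linear_iff)
  qed
  have "\<exists>L\<ge>0. \<forall>x\<in>S. \<forall>y\<in>S. \<bar>D x b - D y b\<bar> \<le> L * norm (x - y)" for b
  proof -
    have "times_differentiable_on 1 (\<lambda>x. frechet_derivative h (at x) b) U"
      using td[of 2] by (simp add: numeral_2_eq_2)
    from times_differentiable_1_lipschitz[OF this U(1) S U(2)] show ?thesis by (simp add: D_def)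
  qed
  then obtain l where l: "\<And>b. 0 \<le> l b" "\<And>b x y. x \<in> S \<Longrightarrow> y \<in> S \<Longrightarrow> \<bar>D x b - D y b\<bar> \<le> l b * norm (x - y)"
    by metis
  define L where "L = (\<Sum>b\<in>Basis. l b)"
  have L0: "0 \<le> L" unfolding L_def using l(1) by (intro sum_nonneg)
  have lip: "\<bar>D x v - D y v\<bar> \<le> L * norm (x - y) * norm v" if xy: "x \<in> S" "y \<in> S" for x y v
  proof -
    have rep: "D z v = (\<Sum>b\<in>Basis. (v \<bullet> b) * D z b)" for z
    proof -
      have "D z v = D z (\<Sum>b\<in>Basis. (v \<bullet> b) *\<^sub>R b)" by (simp add: euclidean_representation)
      also have "\<dots> = (\<Sum>b\<in>Basis. (v \<bullet> b) * D z b)" using lin by (simp add: linear_sum linear_scale)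
      finally show ?thesis .
    qed
    have "D x v - D y v = (\<Sum>b\<in>Basis. (v \<bullet> b) * (D x b - D y b))"
      unfolding rep by (simp add: right_diff_distrib sum_subtractf)
    also have "\<bar>\<dots>\<bar> \<le> (\<Sum>b\<in>Basis. norm v * (l b * norm (x - y)))"
      unfolding real_norm_def[symmetric]
    proof (intro sum_norm_le)
      fix b :: 'a assume b: "b \<in> Basis"
      show "norm ((v \<bullet> b) * (D x b - D y b)) \<le> norm v * (l b * norm (x - y))"
        unfolding norm_mult using l(2)[OF xy] Basis_le_norm[OF b, of v] by (intro mult_mono) auto
    qed
    also have "\<dots> = L * norm (x - y) * norm v"
      by (simp add: L_def sum_distrib_left sum_distrib_right mult_ac)
    finally show ?thesis .
  qed
  have quad: "\<bar>F y - F x - D x (y - x)\<bar> \<le> L * (norm (y - x))\<^sup>2" if xy: "x \<in> S" "y \<in> S" for x y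
  proof -
    let ?T = "closed_segment x y"
    have T: "?T \<subseteq> S" using closed_segment_subset[OF xy S(2)] .
    have "norm (F y - F x - D x (y - x)) \<le> norm (y - x) * (L * norm (y - x))"
    proof (rule differentiable_bound_linearization[where S = ?T])
      show "x + t *\<^sub>R (y - x) \<in> ?T" if "t \<in> {0..1}" for t
        using that by (auto simp: in_segment algebra_simps)
      show "(F has_derivative D z) (at z within ?T)" if "z \<in> ?T" for z
        using derF has_derivative_subset T that by blast
      fix z assume z: "z \<in> ?T"
      show "onorm (D z - D x) \<le> L * norm (y - x)"
      proof (rule onorm_bound)
        fix w
        have "norm ((D z - D x) w) \<le> L * norm (z - x) * norm w"
          using lip[of z x w] z T xy by auto
        also have "\<dots> \<le> L * norm (y - x) * norm w"
          using L0 dist_in_closed_segment(1)[of z x y] z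
          by (intro mult_right_mono mult_left_mono) (auto simp: dist_norm norm_minus_commute)
        finally show "norm ((D z - D x) w) \<le> L * norm (y - x) * norm w" .
      qed (simp add: L0)
    qed simp
    then show ?thesis by (simp add: power2_eq_square mult_ac)
  qed
  show thesis using that[OF L0 lin lip quad derF] .
qed

text \<open>
  Along the segment from \<open>x\<close> to \<open>y\<close>, convexity bounds the increment of \<open>F\<close> over an initial part from
  above and the second-order estimate bounds it from below; letting that part shrink leaves the
  derivative.
\<close>

lemma convex_on_first_order:
  fixes F :: "'a::euclidean_space \<Rightarrow> real"
  assumes F: "convex_on S F" and xy: "x \<in> S" "y \<in> S" and D: "linear D"
    and quad: "\<And>z. z \<in> S \<Longrightarrow> \<bar>F z - F x - D (z - x)\<bar> \<le> L * (norm (z - x))\<^sup>2"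
  shows "F x + D (y - x) \<le> F y"
proof (rule field_le_epsilon)
  fix e :: real assume e: "0 < e"
  define q where "q = L * (norm (y - x))\<^sup>2"
  have "\<exists>t. 0 < t \<and> t \<le> 1 \<and> t * \<bar>q\<bar> \<le> e"
  proof (intro exI conjI)
    show "0 < min 1 (e / (\<bar>q\<bar> + 1))" "min 1 (e / (\<bar>q\<bar> + 1)) \<le> 1" using e by auto
    have "min 1 (e / (\<bar>q\<bar> + 1)) * \<bar>q\<bar> \<le> e / (\<bar>q\<bar> + 1) * (\<bar>q\<bar> + 1)" using e by (intro mult_mono) auto
    then show "min 1 (e / (\<bar>q\<bar> + 1)) * \<bar>q\<bar> \<le> e" by simp
  qed
  then obtain t where t: "0 < t" "t \<le> 1" "t * \<bar>q\<bar> \<le> e" by blast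
  define z where "z = (1 - t) *\<^sub>R x + t *\<^sub>R y"
  have z: "z \<in> S" "z - x = t *\<^sub>R (y - x)"
    using convexD[OF convex_on_imp_convex[OF F] xy, of "1 - t" t] t by (simp_all add: z_def algebra_simps)
  have "F z \<le> (1 - t) * F x + t * F y" unfolding z_def using F xy t by (intro convex_onD) auto
  moreover have "F x + t * D (y - x) - t * t * q \<le> F z"
  proof -
    have "\<bar>F z - F x - t * D (y - x)\<bar> \<le> L * (t * norm (y - x))\<^sup>2"
      using quad[OF z(1)] t unfolding z(2) linear_scale[OF D] by simp
    also have "\<dots> = t * t * q" by (simp add: q_def power2_eq_square)
    finally show ?thesis by linarith
  qed
  ultimately have "t * (F x + D (y - x)) \<le> t * (F y + t * q)" by (simp add: algebra_simps)
  then have "F x + D (y - x) \<le> F y + t * q" using t by simp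
  then show "F x + D (y - x) \<le> F y + e" using t mult_left_mono[OF abs_ge_self[of q], of t] by linarith
qed

lemma norm_profile_le:
  fixes X :: "('n::finite, 'k::finite) profile" and c :: real
  assumes "\<And>k. norm (X $ k) \<le> c"
  shows "norm X \<le> CARD('k) * c"
proof -
  have "norm X \<le> (\<Sum>k\<in>UNIV. norm (X $ k))" unfolding norm_vec_def by (rule L2_set_le_sum) simp
  also have "\<dots> \<le> (\<Sum>k\<in>(UNIV::'k set). c)" using assms by (rule sum_mono)
  finally show ?thesis by simp
qed

lemma norm_profile_component: "norm (X $ k) \<le> norm X"
  by (rule Finite_Cartesian_Product.norm_nth_le)

lemma norm_profile_sq: "(norm X)\<^sup>2 = (\<Sum>k\<in>UNIV. (norm (X $ k))\<^sup>2)" for X :: "('n::finite, 'k::finite) profile"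
  by (simp add: power2_norm_eq_inner inner_vec_def[of X X])

lemma compact_feasible: "compact (feasible I)" for I :: "'k::finite \<Rightarrow> 'n::finite set"
proof -
  have "feasible I = (\<Inter>k. (\<lambda>X. X $ k) -` spectraplex (I k))" by (auto simp: feasible_def)
  moreover have "closed \<dots>"
    by (intro closed_INT ballI closed_vimage closed_spectraplex continuous_intros)
  moreover have "bounded (feasible I)"
    unfolding bounded_iff
  proof (intro exI ballI)
    fix X assume "X \<in> feasible I"
    then show "norm X \<le> CARD('k) * (1::real)"
      by (intro norm_profile_le) (auto simp: feasible_def intro: spectraplex_norm_le_1)
  qed
  ultimately show ?thesis by (simp add: compact_eq_bounded_closed)
qed

lemma convex_feasible: "convex (feasible I)" for I :: "'b::finite \<Rightarrow> 'a::finite set"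
proof (rule convexI)
  fix X Y :: "('a, 'b) profile" and u v :: real
  assume XY: "X \<in> feasible I" "Y \<in> feasible I" and uv: "0 \<le> u" "0 \<le> v" "u + v = 1"
  have "u *\<^sub>R X $ k + v *\<^sub>R Y $ k \<in> spectraplex (I k)" for k
    using XY by (intro convexD[OF convex_spectraplex _ _ uv]) (auto simp: feasible_def)
  then show "u *\<^sub>R X + v *\<^sub>R Y \<in> feasible I" by (simp add: feasible_def)
qed

lemma axis_sum: "X = (\<Sum>k\<in>UNIV. axis k (X $ k))" for X :: "('n::finite, 'k::finite) profile"
  by (simp add: vec_eq_iff axis_def if_distrib[of "\<lambda>x. x $ _"] cong: if_cong)

lemma replace_axis: "replace X k A = X + axis k (A - X $ k)"
  by (simp add: vec_eq_iff replace_def axis_def)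

text \<open>
  The directional derivative along a segment of the feasible set identifies an individual gradient
  with the derivative of a smooth extension, on the directions that matter.
\<close>

lemma indiv_gradient_derivative:
  fixes X :: "('n::finite, 'k::finite) profile"
  assumes X: "X \<in> feasible I" and G: "indiv_gradient I F k X G"
    and D: "(F has_derivative D) (at X within feasible I)" and A: "A \<in> spectraplex (I k)"
  shows "G \<bullet> (A - X $ k) = D (axis k (A - X $ k))"
proof -
  define d where "d = A - X $ k"
  have Xk: "X $ k \<in> spectraplex (I k)" using X by (simp add: feasible_def)
  define p where "p t = X $ k + t *\<^sub>R d" for t
  have p: "p t \<in> spectraplex (I k)" if "t \<in> {0..1}" for t
    using convexD_alt[OF convex_spectraplex Xk A, of t] that by (simp add: p_def d_def algebra_simps)
  have P: "replace X k (p t) \<in> feasible I" if "t \<in> {0..1}" for t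
    using p[OF that] X by (simp add: feasible_def replace_def)
  have "((\<lambda>t. F (replace X k (p t))) has_derivative (\<lambda>t. Re (trace (G ** (t *\<^sub>R d))))) (at 0 within {0..1})"
  proof (rule has_derivative_in_compose[where f = p and g = "\<lambda>A. F (replace X k A)"
        and f' = "\<lambda>t. t *\<^sub>R d" and g' = "\<lambda>H. Re (trace (G ** H))"])
    show "(p has_derivative (\<lambda>t. t *\<^sub>R d)) (at 0 within {0..1})"
      unfolding p_def by (auto intro!: derivative_eq_intros)
    have "((\<lambda>A. F (replace X k A)) has_derivative (\<lambda>H. Re (trace (G ** H)))) (at (p 0) within spectraplex (I k))"
      using G by (simp add: indiv_gradient_def p_def)
    then show "((\<lambda>A. F (replace X k A)) has_derivative (\<lambda>H. Re (trace (G ** H)))) (at (p 0) within p ` {0..1})"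
      using p by (rule_tac has_derivative_subset) auto
  qed
  moreover have "hermitian d"
    unfolding d_def using A Xk by (intro hermitian_diff) (auto intro: spectraplex_hermitian)
  then have "Re (trace (G ** (t *\<^sub>R d))) = t * (G \<bullet> d)" for t
    by (simp flip: inner_eq_trace_hermitian[OF hermitian_scaleR])
  ultimately have 1: "((\<lambda>t. F (replace X k (p t))) has_vector_derivative (G \<bullet> d)) (at 0 within cbox 0 1)"
    by (simp add: has_vector_derivative_def)
  have "((\<lambda>t. F (replace X k (p t))) has_derivative (\<lambda>t. D (axis k (t *\<^sub>R d)))) (at 0 within {0..1})"
  proof (rule has_derivative_in_compose[where f = "\<lambda>t. replace X k (p t)" and g = F
        and f' = "\<lambda>t. axis k (t *\<^sub>R d)" and g' = D])
    have "bounded_linear (axis k :: complex^'n^'n \<Rightarrow> _)"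
      unfolding linear_conv_bounded_linear[symmetric]
      by (rule linearI) (simp_all add: vec_eq_iff axis_def)
    then have "((\<lambda>t. axis k (t *\<^sub>R d) :: ('n, 'k) profile) has_derivative (\<lambda>t. axis k (t *\<^sub>R d))) (at 0 within {0..1})"
      by (rule bounded_linear.has_derivative) (auto intro!: derivative_eq_intros)
    from has_derivative_add[OF has_derivative_const[of X] this]
    show "((\<lambda>t. replace X k (p t)) has_derivative (\<lambda>t. axis k (t *\<^sub>R d))) (at 0 within {0..1})"
      by (simp add: replace_axis p_def)
    have "(F has_derivative D) (at (replace X k (p 0)) within feasible I)"
    proof -
      have "replace X k (p 0) = X" by (simp add: replace_def p_def vec_eq_iff)
      then show ?thesis using D by simp
    qed
    then show "(F has_derivative D) (at (replace X k (p 0)) within (\<lambda>t. replace X k (p t)) ` {0..1})"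
      using P by (rule_tac has_derivative_subset) auto
  qed
  moreover have "D (axis k (t *\<^sub>R d)) = t * D (axis k d)" for t
  proof -
    have "axis k (t *\<^sub>R d) = t *\<^sub>R (axis k d :: ('n, 'k) profile)" by (simp add: vec_eq_iff axis_def)
    then show ?thesis using linear_scale[OF has_derivative_linear[OF D]] by simp
  qed
  ultimately have 2: "((\<lambda>t. F (replace X k (p t))) has_vector_derivative D (axis k d)) (at 0 within cbox 0 1)"
    by (simp add: has_vector_derivative_def)
  show ?thesis
    using vector_derivative_unique_within_closed_interval[OF _ _ 1 2] by (simp add: d_def)
qed

locale smooth_convex_problem =
  fixes I :: "'k::finite \<Rightarrow> 'n::finite set"
    and F :: "('n, 'k) profile \<Rightarrow> real" and V :: "('n, 'k) profile \<Rightarrow> ('n, 'k) profile"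
  assumes nonempty: "\<And>k. I k \<noteq> {}"
    and smooth: "smooth_on (feasible I) F"
    and convex: "convex_on (feasible I) F"
    and gradient: "\<And>k X. X \<in> feasible I \<Longrightarrow> indiv_gradient I F k X (V X $ k)"
begin

text \<open>
  Gradient matrices are determined up to multiples of the identity; centering removes this freedom.
\<close>

definition G :: "('n, 'k) profile \<Rightarrow> ('n, 'k) profile" where
  "G X = (\<chi> k. center (I k) (V X $ k))"

definition traceless_profiles :: "('n, 'k) profile set" where
  "traceless_profiles = {Y. \<forall>k. Y $ k \<in> corner (I k) \<and> hermitian (Y $ k) \<and> Y $ k \<bullet> corner_one (I k) = 0}"

lemma feasibleD: "X \<in> feasible I \<Longrightarrow> X $ k \<in> spectraplex (I k)"
  by (simp add: feasible_def)

lemma subspace_traceless: "subspace traceless_profiles"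
  unfolding subspace_def traceless_profiles_def
  by (auto simp: hermitian_0 hermitian_add hermitian_scaleR inner_add_left
      subspace_0[OF subspace_corner] subspace_add[OF subspace_corner] subspace_scale[OF subspace_corner])

lemma G_traceless: "X \<in> feasible I \<Longrightarrow> G X \<in> traceless_profiles"
  using gradient[of X] unfolding traceless_profiles_def G_def indiv_gradient_def
  by (simp add: center_corner center_hermitian inner_center_corner_one nonempty)

text \<open>
  On tangent directions the gradient matrices agree with the derivative field of a smooth extension, and
  they inherit its properties.
\<close>

lemma gradient_properties:
  "\<exists>L\<ge>0. (\<forall>X\<in>feasible I. \<forall>X'\<in>feasible I. F X + G X \<bullet> (X' - X) \<le> F X' \<and>
      F X' \<le> F X + G X \<bullet> (X' - X) + L * (norm (X' - X))\<^sup>2 \<and> norm (G X - G X') \<le> L * norm (X - X'))"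
proof -
  obtain D L where L: "0 \<le> L" and lin: "\<And>X. linear (D X)"
    and lip: "\<And>X Y v. X \<in> feasible I \<Longrightarrow> Y \<in> feasible I \<Longrightarrow> \<bar>D X v - D Y v\<bar> \<le> L * norm (X - Y) * norm v"
    and quad: "\<And>X Y. X \<in> feasible I \<Longrightarrow> Y \<in> feasible I \<Longrightarrow> \<bar>F Y - F X - D X (Y - X)\<bar> \<le> L * (norm (Y - X))\<^sup>2"
    and der: "\<And>X. X \<in> feasible I \<Longrightarrow> (F has_derivative D X) (at X within feasible I)"
    by (rule smooth_on_derivative_field[OF smooth compact_feasible convex_feasible], rule that)
  have G1: "G X $ k \<bullet> (A - B) = D X (axis k (A - B))"
    if X: "X \<in> feasible I" and A: "A \<in> spectraplex (I k)" and B: "B \<in> spectraplex (I k)" for X k A B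
  proof -
    have ax: "axis k (A - B) = axis k (A - X $ k) - (axis k (B - X $ k) :: ('n, 'k) profile)"
      by (simp add: vec_eq_iff axis_def)
    have "G X $ k \<bullet> (A - B) = V X $ k \<bullet> (A - B)"
      using spectraplex_diff_inner_corner_one[OF A B] by (simp add: G_def inner_center center_idem)
    also have "\<dots> = V X $ k \<bullet> (A - X $ k) - V X $ k \<bullet> (B - X $ k)" by (simp add: inner_diff_right)
    also have "\<dots> = D X (axis k (A - X $ k)) - D X (axis k (B - X $ k))"
      using indiv_gradient_derivative[OF X gradient[OF X] der[OF X]] A B by simp
    finally show ?thesis by (simp add: ax linear_diff[OF lin])
  qed
  have GD: "G X \<bullet> (X' - X) = D X (X' - X)" if "X \<in> feasible I" "X' \<in> feasible I" for X X'
  proof -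
    have "D X (X' - X) = D X (\<Sum>k\<in>UNIV. axis k (X' $ k - X $ k))"
      using axis_sum[of "X' - X"] by simp
    also have "\<dots> = (\<Sum>k\<in>UNIV. G X $ k \<bullet> (X' $ k - X $ k))"
      using that by (simp add: linear_sum[OF lin] G1 feasibleD)
    finally show ?thesis by (simp add: inner_vec_def[of "G X"])
  qed
  have Glip: "norm (G X - G X') \<le> (CARD('k) * L) * norm (X - X')"
    if X: "X \<in> feasible I" and X': "X' \<in> feasible I" for X X'
  proof -
    have "norm ((G X - G X') $ k) \<le> L * norm (X - X')" for k
    proof -
      have T: "G X - G X' \<in> traceless_profiles"
        using G_traceless X X' subspace_traceless by (simp add: subspace_diff)
      have "norm ((G X - G X') $ k) \<le> L * norm (X - X') \<or> (G X - G X') $ k = 0"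
      proof (rule traceless_norm_le[OF nonempty])
        fix A B assume AB: "A \<in> spectraplex (I k)" "B \<in> spectraplex (I k)"
        have norm_axis: "norm (axis k Z :: ('n, 'k) profile) = norm Z" for Z
          by (simp add: norm_eq_sqrt_inner inner_axis_axis)
        have "(G X - G X') $ k \<bullet> (A - B) = D X (axis k (A - B)) - D X' (axis k (A - B))"
          using G1 X X' AB by (simp add: inner_diff_left)
        also have "\<dots> \<le> L * norm (X - X') * norm (axis k (A - B) :: ('n, 'k) profile)"
          using lip[OF X X'] by (simp add: abs_le_iff)
        finally show "(G X - G X') $ k \<bullet> (A - B) \<le> L * norm (X - X') * norm (A - B)"
          by (simp add: norm_axis)
      qed (use T in \<open>auto simp: traceless_profiles_def\<close>)
      then show ?thesis using L by auto
    qed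
    from norm_profile_le[of "G X - G X'", OF this] show ?thesis by (simp add: mult.assoc)
  qed
  have "F X + G X \<bullet> (X' - X) \<le> F X' \<and>
      F X' \<le> F X + G X \<bullet> (X' - X) + (CARD('k) * L) * (norm (X' - X))\<^sup>2"
    if X: "X \<in> feasible I" and X': "X' \<in> feasible I" for X X'
  proof
    show "F X + G X \<bullet> (X' - X) \<le> F X'"
      using convex_on_first_order[OF convex X X' lin quad[OF X]] by (simp add: GD X X')
    have "L * (norm (X' - X))\<^sup>2 \<le> (CARD('k) * L) * (norm (X' - X))\<^sup>2"
      using L mult_right_mono[of 1 "real CARD('k)" L] by (intro mult_right_mono) (auto simp: Suc_leI)
    then show "F X' \<le> F X + G X \<bullet> (X' - X) + (CARD('k) * L) * (norm (X' - X))\<^sup>2"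
      using quad[OF X X'] GD[OF X X'] by (simp add: abs_le_iff)
  qed
  then show ?thesis using Glip L by (intro exI[of _ "CARD('k) * L"]) simp
qed

end

section \<open>The regularized equilibrium and its limit\<close>

context smooth_convex_problem
begin

definition gibbs_profile :: "('n, 'k) profile \<Rightarrow> ('n, 'k) profile" where
  "gibbs_profile Y = (\<chi> k. gibbs (I k) (Y $ k))"

definition profile_entropy :: "('n, 'k) profile \<Rightarrow> real" where
  "profile_entropy X = (\<Sum>k\<in>UNIV. neg_entropy (X $ k))"

lemma regularized_cost_entropy: "regularized_cost F \<tau> X = F X + \<tau> * profile_entropy X"
  by (simp add: regularized_cost_def profile_entropy_def)

lemma traceless_component:
  assumes "Y \<in> traceless_profiles"
  shows "Y $ k \<in> corner (I k)" "hermitian (Y $ k)" "Y $ k \<bullet> corner_one (I k) = 0"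
  using assms by (auto simp: traceless_profiles_def)

lemma gibbs_profile_feasible: "Y \<in> traceless_profiles \<Longrightarrow> gibbs_profile Y \<in> feasible I"
  by (simp add: feasible_def gibbs_profile_def gibbs_in_spectraplex nonempty traceless_component)

lemma entropy_strongly_convex:
  assumes Y: "Y \<in> traceless_profiles" and X: "X \<in> feasible I"
  shows "profile_entropy (gibbs_profile Y) + Y \<bullet> (X - gibbs_profile Y)
    + entropy_modulus TYPE('n) * (norm (X - gibbs_profile Y))\<^sup>2 \<le> profile_entropy X"
proof -
  have "(\<Sum>k\<in>UNIV. neg_entropy (gibbs (I k) (Y $ k)) + Y $ k \<bullet> (X $ k - gibbs (I k) (Y $ k))
      + entropy_modulus TYPE('n) * (norm (X $ k - gibbs (I k) (Y $ k)))\<^sup>2) \<le> (\<Sum>k\<in>UNIV. neg_entropy (X $ k))"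
    by (intro sum_mono neg_entropy_strongly_convex nonempty traceless_component[OF Y] feasibleD[OF X])
  then show ?thesis
    by (simp add: profile_entropy_def inner_vec_def[of Y] norm_profile_sq sum.distrib sum_distrib_left gibbs_profile_def)
qed

lemma gibbs_profile_lipschitz:
  "\<exists>L\<ge>0. \<forall>Y\<in>traceless_profiles. \<forall>Y'\<in>traceless_profiles.
     (\<forall>k. norm (gibbs_profile Y $ k - gibbs_profile Y' $ k) \<le> L * norm (Y $ k - Y' $ k)) \<and>
     norm (gibbs_profile Y - gibbs_profile Y') \<le> L * norm (Y - Y')"
proof -
  define l where "l = 1 / (2 * entropy_modulus TYPE('n))"
  have l: "0 \<le> l" using entropy_modulus_pos[where 'n='n] by (simp add: l_def)
  have "norm (gibbs_profile Y $ k - gibbs_profile Y' $ k) \<le> CARD('k) * l * norm (Y $ k - Y' $ k) \<and>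
     norm (gibbs_profile Y - gibbs_profile Y') \<le> CARD('k) * l * norm (Y - Y')"
    if Y: "Y \<in> traceless_profiles" and Y': "Y' \<in> traceless_profiles" for Y Y' k
  proof -
    have comp: "norm (gibbs_profile Y $ k - gibbs_profile Y' $ k) \<le> l * norm (Y $ k - Y' $ k)" for k
      using gibbs_lipschitz[OF nonempty traceless_component(1,2)[OF Y] traceless_component(1,2)[OF Y'], of k]
      by (simp add: gibbs_profile_def l_def)
    have "l * norm (Y $ k - Y' $ k) \<le> CARD('k) * l * norm (Y $ k - Y' $ k)"
      using mult_right_mono[of 1 "real CARD('k)" "l * norm (Y $ k - Y' $ k)"] l by (simp add: Suc_leI mult.assoc)
    moreover have "l * norm (Y $ k - Y' $ k) \<le> l * norm (Y - Y')" for k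
      using norm_profile_component[of "Y - Y'" k] l by (simp add: mult_left_mono)
    then have "norm ((gibbs_profile Y - gibbs_profile Y') $ k) \<le> l * norm (Y - Y')" for k
      using comp[of k] order_trans by fastforce
    from norm_profile_le[OF this]
    have "norm (gibbs_profile Y - gibbs_profile Y') \<le> CARD('k) * l * norm (Y - Y')" by (simp add: mult.assoc)
    ultimately show ?thesis using comp[of k] by linarith
  qed
  then show ?thesis using l by (intro exI[of _ "CARD('k) * l"]) auto
qed

lemma gibbs_profile_strongly_monotone:
  "\<exists>c>0. \<forall>Y\<in>traceless_profiles. \<forall>Y'\<in>traceless_profiles. norm Y \<le> R \<longrightarrow> norm Y' \<le> R \<longrightarrow>
     (\<forall>k. c * (norm (Y $ k - Y' $ k))\<^sup>2 \<le> (Y $ k - Y' $ k) \<bullet> (gibbs_profile Y $ k - gibbs_profile Y' $ k))"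
proof -
  have "\<forall>k. \<exists>c>0. \<forall>A B. A \<in> corner (I k) \<longrightarrow> hermitian A \<longrightarrow> B \<in> corner (I k) \<longrightarrow> hermitian B \<longrightarrow>
    norm A \<le> R \<longrightarrow> norm B \<le> R \<longrightarrow>
    c * (norm (center (I k) (A - B)))\<^sup>2 \<le> (A - B) \<bullet> (gibbs (I k) A - gibbs (I k) B)"
    using gibbs_strongly_monotone[OF nonempty] by blast
  then obtain c where c: "\<And>k. 0 < c k" and mono: "\<And>k A B. A \<in> corner (I k) \<Longrightarrow> hermitian A \<Longrightarrow>
    B \<in> corner (I k) \<Longrightarrow> hermitian B \<Longrightarrow> norm A \<le> R \<Longrightarrow> norm B \<le> R \<Longrightarrow>
    c k * (norm (center (I k) (A - B)))\<^sup>2 \<le> (A - B) \<bullet> (gibbs (I k) A - gibbs (I k) B)"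
    by metis
  define m where "m = Min (range c)"
  have m: "0 < m" "m \<le> c k" for k using c by (auto simp: m_def)
  have "m * (norm (Y $ k - Y' $ k))\<^sup>2 \<le> (Y $ k - Y' $ k) \<bullet> (gibbs_profile Y $ k - gibbs_profile Y' $ k)"
    if Y: "Y \<in> traceless_profiles" and Y': "Y' \<in> traceless_profiles" and R: "norm Y \<le> R" "norm Y' \<le> R" for Y Y' k
  proof -
    have "center (I k) (Y $ k - Y' $ k) = Y $ k - Y' $ k"
      using traceless_component(3)[OF Y, of k] traceless_component(3)[OF Y', of k]
      by (intro center_idem) (simp add: inner_diff_left)
    then have "c k * (norm (Y $ k - Y' $ k))\<^sup>2 \<le> (Y $ k - Y' $ k) \<bullet> (gibbs (I k) (Y $ k) - gibbs (I k) (Y' $ k))"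
      using mono[OF traceless_component(1,2)[OF Y] traceless_component(1,2)[OF Y'], of k]
        R norm_profile_component[of Y k] norm_profile_component[of Y' k] by simp
    moreover have "m * (norm (Y $ k - Y' $ k))\<^sup>2 \<le> c k * (norm (Y $ k - Y' $ k))\<^sup>2"
      using m by (intro mult_right_mono) auto
    ultimately show ?thesis by (simp add: gibbs_profile_def)
  qed
  then show ?thesis using m by blast
qed

lemma zero_traceless: "0 \<in> traceless_profiles"
  by (rule subspace_0[OF subspace_traceless])

lemma feasible_nonempty: "feasible I \<noteq> {}"
  using gibbs_profile_feasible[OF zero_traceless] by blast

lemma continuous_on_F: "continuous_on (feasible I) F"
proof -
  obtain U h where "open U" "feasible I \<subseteq> U" "\<And>X. X \<in> feasible I \<Longrightarrow> h X = F X" "times_differentiable_on 0 h U"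
    using smooth unfolding smooth_on_def by blast
  then show ?thesis using continuous_on_cong continuous_on_subset by (metis times_differentiable_on.simps(1))
qed

text \<open>
  Existence of an equilibrium comes from Brouwer's theorem, applied to the best response
  \<open>X \<mapsto> gibbs (- \<nabla>F(X) / \<tau>)\<close>; by the two first-order inequalities for cost and entropy an equilibrium is
  the only minimizer of the regularized cost.
\<close>

lemma equilibrium_exists:
  assumes \<tau>: "0 < \<tau>"
  shows "\<exists>Y\<in>traceless_profiles. G (gibbs_profile Y) = - \<tau> *\<^sub>R Y"
proof -
  define T where "T X = (- 1 / \<tau>) *\<^sub>R G X" for X
  have T: "T X \<in> traceless_profiles" if "X \<in> feasible I" for X
    unfolding T_def using G_traceless[OF that] subspace_traceless by (rule subspace_scale[rotated])
  obtain L where L: "0 \<le> L" "\<And>X X'. X \<in> feasible I \<Longrightarrow> X' \<in> feasible I \<Longrightarrow> norm (G X - G X') \<le> L * norm (X - X')"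
    using gradient_properties by metis
  obtain l where l: "0 \<le> l" "\<And>Y Y'. Y \<in> traceless_profiles \<Longrightarrow> Y' \<in> traceless_profiles \<Longrightarrow>
     norm (gibbs_profile Y - gibbs_profile Y') \<le> l * norm (Y - Y')"
    using gibbs_profile_lipschitz by metis
  have "(l * (L / \<tau>))-lipschitz_on (feasible I) (\<lambda>X. gibbs_profile (T X))"
  proof (rule lipschitz_onI)
    fix X X' assume X: "X \<in> feasible I" "X' \<in> feasible I"
    have "norm (gibbs_profile (T X) - gibbs_profile (T X')) \<le> l * norm (T X - T X')" using l T X by blast
    also have "T X - T X' = (- 1 / \<tau>) *\<^sub>R (G X - G X')" by (simp add: T_def algebra_simps)
    also have "norm ((- 1 / \<tau>) *\<^sub>R (G X - G X')) = 1 / \<tau> * norm (G X - G X')" using \<tau> by simp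
    also have "l * \<dots> \<le> l * (1 / \<tau> * (L * norm (X - X')))"
      using L(2)[OF X] \<tau> l(1) by (intro mult_left_mono) auto
    finally show "dist (gibbs_profile (T X)) (gibbs_profile (T X')) \<le> l * (L / \<tau>) * dist X X'"
      by (simp add: dist_norm)
  qed (use l L \<tau> in simp)
  then have "continuous_on (feasible I) (\<lambda>X. gibbs_profile (T X))" by (rule lipschitz_on_continuous_on)
  then obtain X where X: "X \<in> feasible I" "gibbs_profile (T X) = X"
    using brouwer[OF compact_feasible convex_feasible feasible_nonempty, of "\<lambda>X. gibbs_profile (T X)"]
      gibbs_profile_feasible T by blast
  then show ?thesis using T[OF X(1)] \<tau> by (intro bexI[of _ "T X"]) (simp_all add: T_def[of X])
qed

lemma equilibrium_minimizes:
  assumes \<tau>: "0 < \<tau>" and Y: "Y \<in> traceless_profiles" "G (gibbs_profile Y) = - \<tau> *\<^sub>R Y" and Z: "Z \<in> feasible I"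
  shows "regularized_cost F \<tau> (gibbs_profile Y) + \<tau> * entropy_modulus TYPE('n) * (norm (Z - gibbs_profile Y))\<^sup>2
    \<le> regularized_cost F \<tau> Z"
proof -
  have "F (gibbs_profile Y) + G (gibbs_profile Y) \<bullet> (Z - gibbs_profile Y) \<le> F Z"
    using gradient_properties gibbs_profile_feasible[OF Y(1)] Z by blast
  moreover have "\<tau> * (profile_entropy (gibbs_profile Y) + Y \<bullet> (Z - gibbs_profile Y)
    + entropy_modulus TYPE('n) * (norm (Z - gibbs_profile Y))\<^sup>2) \<le> \<tau> * profile_entropy Z"
    using entropy_strongly_convex[OF Y(1) Z] \<tau> by (intro mult_left_mono) auto
  ultimately show ?thesis
    unfolding regularized_cost_entropy Y(2) by (simp add: algebra_simps)
qed

lemma equilibrium_unique_minimizer: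
  assumes \<tau>: "0 < \<tau>" and Y: "Y \<in> traceless_profiles" "G (gibbs_profile Y) = - \<tau> *\<^sub>R Y"
  shows "is_arg_min (regularized_cost F \<tau>) (\<lambda>Z. Z \<in> feasible I) Z \<longleftrightarrow> Z = gibbs_profile Y"
proof -
  have m: "0 < \<tau> * entropy_modulus TYPE('n)" using \<tau> entropy_modulus_pos[where 'n='n] by simp
  note le = equilibrium_minimizes[OF assms]
  have lt: "regularized_cost F \<tau> (gibbs_profile Y) < regularized_cost F \<tau> Z"
    if "Z \<in> feasible I" "Z \<noteq> gibbs_profile Y" for Z
  proof -
    have "0 < \<tau> * entropy_modulus TYPE('n) * (norm (Z - gibbs_profile Y))\<^sup>2" using m that by simp
    then show ?thesis using le[OF that(1)] by linarith
  qed
  then show ?thesis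
    unfolding is_arg_min_def using gibbs_profile_feasible[OF Y(1)] by (metis less_asym)
qed

lemma entropy_nonpos: "X \<in> feasible I \<Longrightarrow> profile_entropy X \<le> 0"
  unfolding profile_entropy_def using feasibleD neg_entropy_nonpos by (metis (mono_tags, lifting) sum_nonpos)

lemma entropy_lower_bound: "X \<in> feasible I \<Longrightarrow> profile_entropy (gibbs_profile 0) \<le> profile_entropy X"
  using entropy_strongly_convex[OF zero_traceless, of X] entropy_modulus_pos[where 'n='n]
  by (smt (verit) inner_zero_left mult_nonneg_nonneg zero_le_power2)

text \<open>
  Regularization costs at most \<open>\<tau>\<close> times the oscillation of the entropy, so its minimizers are nearly
  optimal for small \<open>\<tau>\<close>; by compactness they are then close to the set of optimal points.
\<close>

lemma regularized_minimizer_approximates: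
  "\<exists>\<epsilon> :: real \<Rightarrow> real. (\<epsilon> \<longlongrightarrow> 0) (at_right 0) \<and> (\<forall>\<tau> X. 0 < \<tau> \<longrightarrow>
     is_arg_min (regularized_cost F \<tau>) (\<lambda>Z. Z \<in> feasible I) X \<longrightarrow>
     (\<exists>S. is_arg_min F (\<lambda>Z. Z \<in> feasible I) S \<and> dist X S \<le> \<epsilon> \<tau>))"
proof -
  obtain S0 where S0: "S0 \<in> feasible I" "\<And>Z. Z \<in> feasible I \<Longrightarrow> F S0 \<le> F Z"
    using continuous_attains_inf[OF compact_feasible feasible_nonempty continuous_on_F] by blast
  define Opt where "Opt = {S. is_arg_min F (\<lambda>Z. Z \<in> feasible I) S}"
  have Opt_eq: "Opt = {Z \<in> feasible I. F Z = F S0}"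
    unfolding Opt_def is_arg_min_def using S0 by (auto simp: not_less intro: antisym)
  have Opt: "closed Opt" "Opt \<noteq> {}"
    unfolding Opt_eq using S0(1)
      continuous_closed_preimage_constant[OF continuous_on_F compact_imp_closed[OF compact_feasible]] by auto
  define xm where "xm \<tau> = (SOME X. is_arg_min (regularized_cost F \<tau>) (\<lambda>Z. Z \<in> feasible I) X)" for \<tau>
  have xm: "X = xm \<tau>" "X \<in> feasible I"
    if \<tau>: "0 < \<tau>" and min: "is_arg_min (regularized_cost F \<tau>) (\<lambda>Z. Z \<in> feasible I) X" for \<tau> X
  proof -
    obtain Y where "Y \<in> traceless_profiles" "G (gibbs_profile Y) = - \<tau> *\<^sub>R Y" using equilibrium_exists[OF \<tau>] by blast
    from equilibrium_unique_minimizer[OF \<tau> this] min show "X = xm \<tau>" by (simp add: xm_def)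
    show "X \<in> feasible I" using min by (simp add: is_arg_min_def)
  qed
  have xm': "is_arg_min (regularized_cost F \<tau>) (\<lambda>Z. Z \<in> feasible I) (xm \<tau>)" if "0 < \<tau>" for \<tau>
    using equilibrium_exists[OF that] equilibrium_unique_minimizer[OF that] unfolding xm_def by (metis someI_ex)
  define \<epsilon> where "\<epsilon> \<tau> = infdist (xm \<tau>) Opt" for \<tau>
  have "(\<epsilon> \<longlongrightarrow> 0) (at_right 0)"
  proof (rule tendstoI)
    fix e :: real assume e: "0 < e"
    define K where "K = {X \<in> feasible I. e \<le> infdist X Opt}"
    have K: "compact K"
    proof -
      have "K = feasible I \<inter> {X. e \<le> infdist X Opt}" by (auto simp: K_def)
      also have "compact \<dots>" by (intro compact_Int_closed compact_feasible closed_Collect_le continuous_intros)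
      finally show ?thesis .
    qed
    have "\<exists>\<delta>>0. \<forall>X\<in>K. F S0 + \<delta> \<le> F X"
    proof (cases "K = {}")
      case False
      have "continuous_on K F" by (rule continuous_on_subset[OF continuous_on_F]) (auto simp: K_def)
      then obtain X0 where X0: "X0 \<in> K" "\<And>X. X \<in> K \<Longrightarrow> F X0 \<le> F X"
        using continuous_attains_inf[OF K False] by blast
      have "X0 \<notin> Opt" using X0(1) e by (auto simp: K_def)
      then have "F S0 < F X0" using X0(1) S0(2)[of X0] by (auto simp: K_def Opt_eq order_less_le)
      then show ?thesis using X0(2) by (intro exI[of _ "F X0 - F S0"]) auto
    qed (auto intro: exI[of _ 1])
    then obtain \<delta> where \<delta>: "0 < \<delta>" "\<And>X. X \<in> K \<Longrightarrow> F S0 + \<delta> \<le> F X" by blast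
    define B where "B = - profile_entropy (gibbs_profile 0)"
    have B: "0 \<le> B" using entropy_nonpos[OF gibbs_profile_feasible[OF zero_traceless]] by (simp add: B_def)
    have "\<epsilon> \<tau> < e" if \<tau>: "\<tau> \<in> {0<..<\<delta> / (B + 1)}" for \<tau>
    proof (rule ccontr)
      assume "\<not> \<epsilon> \<tau> < e"
      have t: "0 < \<tau>" using \<tau> by simp
      have f: "xm \<tau> \<in> feasible I" using xm(2)[OF t xm'[OF t]] .
      then have "xm \<tau> \<in> K" using \<open>\<not> \<epsilon> \<tau> < e\<close> by (simp add: K_def \<epsilon>_def)
      moreover have "F (xm \<tau>) + \<tau> * profile_entropy (xm \<tau>) \<le> F S0 + \<tau> * profile_entropy S0"
        using xm'[OF t] S0(1) by (force simp: is_arg_min_def regularized_cost_entropy)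
      moreover have "\<tau> * (profile_entropy S0 - profile_entropy (xm \<tau>)) \<le> \<tau> * B"
        using entropy_nonpos[OF S0(1)] entropy_lower_bound[OF f] t
        by (intro mult_left_mono) (auto simp: B_def)
      then have "\<tau> * profile_entropy S0 - \<tau> * profile_entropy (xm \<tau>) \<le> \<tau> * B" by (simp add: algebra_simps)
      moreover have "\<tau> * B < \<delta>"
      proof -
        have "\<tau> * B \<le> \<tau> * (B + 1)" using t by (intro mult_left_mono) auto
        also have "\<dots> < \<delta>" using \<tau> B by (simp add: field_simps)
        finally show ?thesis .
      qed
      ultimately show False using \<delta>(2)[of "xm \<tau>"] by linarith
    qed
    then show "\<forall>\<^sub>F \<tau> in at_right 0. dist (\<epsilon> \<tau>) 0 < e"
      using eventually_at_right_real[of 0 "\<delta> / (B + 1)"] \<delta>(1) B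
      by (auto elim!: eventually_mono simp: \<epsilon>_def infdist_nonneg)
  qed
  moreover have "\<exists>S. is_arg_min F (\<lambda>Z. Z \<in> feasible I) S \<and> dist X S \<le> \<epsilon> \<tau>"
    if "0 < \<tau>" "is_arg_min (regularized_cost F \<tau>) (\<lambda>Z. Z \<in> feasible I) X" for \<tau> X
  proof -
    obtain S where "S \<in> Opt" "infdist X Opt = dist X S" using infdist_attains_inf[OF Opt] by blast
    then show ?thesis using xm(1)[OF that] by (auto simp: \<epsilon>_def Opt_def)
  qed
  ultimately show ?thesis by blast
qed

end

section \<open>Asynchronous descent along one trajectory\<close>

lemma summable_of_descent:
  fixes \<Phi> p q :: "nat \<Rightarrow> real"
  assumes p: "\<And>n. n \<ge> n0 \<Longrightarrow> 0 \<le> p n" and q: "summable q" and c: "0 < c"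
    and step: "\<And>n. n \<ge> n0 \<Longrightarrow> \<Phi> (Suc n) \<le> \<Phi> n - c * p n + q n" and lower: "\<And>n. n \<ge> n0 \<Longrightarrow> b \<le> \<Phi> n"
  shows "summable p"
proof -
  have "summable (\<lambda>n. q (n + n0))" using q by (simp add: summable_iff_shift)
  then obtain B where B: "\<And>n. (\<Sum>i<n. q (i + n0)) \<le> B"
    by (metis Bseq_def convergent_imp_Bseq summable_iff_convergent abs_le_D1 real_norm_def)
  have "c * (\<Sum>i<n. p (i + n0)) \<le> \<Phi> n0 - \<Phi> (n + n0) + (\<Sum>i<n. q (i + n0))" for n
  proof (induction n)
    case (Suc n)
    then show ?case using step[of "n + n0"] by (simp add: algebra_simps)
  qed simp
  then have "c * (\<Sum>i<n. p (i + n0)) \<le> \<Phi> n0 - b + B" for n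
    using lower[of "n + n0"] B[of n] by (smt (verit) le_add2)
  then have "(\<Sum>i<n. norm (p (i + n0))) \<le> (\<Phi> n0 - b + B) / c" for n
    using c p by (simp add: field_simps)
  then have "summable (\<lambda>n. norm (p (n + n0)))" by (intro summableI_nonneg_bounded) auto
  then show ?thesis by (metis summable_iff_shift summable_norm_cancel)
qed

lemma sum_split_nat: "n \<le> m \<Longrightarrow> (\<Sum>j=1..m. f j) = (\<Sum>j=1..n. f j) + (\<Sum>j=Suc n..m. f j)"
  for f :: "nat \<Rightarrow> 'a::comm_monoid_add"
  using sum.ub_add_nat[of 1 n f "m - n"] by simp

lemma count_ge:
  fixes N :: "nat \<Rightarrow> nat"
  assumes rate: "(\<lambda>n. real (N n) / real n) \<longlonglongrightarrow> r" and r: "\<rho> < r"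
  shows "\<forall>\<^sub>F n in sequentially. \<rho> * real n \<le> real (N n)"
  using order_tendstoD(1)[OF rate r] eventually_gt_at_top[of 0]
  by eventually_elim (simp add: field_simps)

lemma count_le:
  fixes N :: "nat \<Rightarrow> nat"
  assumes rate: "(\<lambda>n. real (N n) / real n) \<longlonglongrightarrow> r" and r: "r < \<rho>"
  shows "\<forall>\<^sub>F n in sequentially. real (N n) \<le> \<rho> * real n"
  using order_tendstoD(2)[OF rate r] eventually_gt_at_top[of 0]
  by eventually_elim (simp add: field_simps)

text \<open>
  A slowly varying quantity whose square is summable against the step sizes of one agent tends to zero.
  If it were at least \<open>2 d\<close> at a late epoch \<open>n\<close>, it would stay above \<open>d\<close> up to epoch \<open>(1 + h) n\<close>; in
  this window the agent makes a number of updates proportional to \<open>n\<close>, each of a size of order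
  \<open>1/n\<close>, so that the window contributes a fixed positive amount to the series.
\<close>

lemma slowly_varying_tendsto_0:
  fixes b :: "nat \<Rightarrow> real" and U :: "nat set" and N :: "nat \<Rightarrow> nat"
  assumes N: "\<And>n. N n = (\<Sum>j=1..n. of_bool (j \<in> U))"
    and rate: "(\<lambda>n. real (N n) / real n) \<longlonglongrightarrow> r" "0 < r" and g: "0 < g"
    and slow: "\<And>n. n \<ge> n0 \<Longrightarrow> \<bar>b (Suc n) - b n\<bar> \<le> C / real n" and C: "0 \<le> C"
    and sm: "summable (\<lambda>n. g / real (N n) * of_bool (n \<in> U) * (b n)\<^sup>2)" and b: "\<And>n. 0 \<le> b n"
  shows "b \<longlonglongrightarrow> 0"
proof (rule ccontr)
  assume "\<not> b \<longlonglongrightarrow> 0"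
  then obtain d where d: "0 < d" "\<exists>\<^sub>F n in sequentially. 2 * d \<le> b n"
  proof -
    assume *: "\<And>d. 0 < d \<Longrightarrow> \<exists>\<^sub>F n in sequentially. 2 * d \<le> b n \<Longrightarrow> thesis"
    obtain e where "0 < e" "\<not> (\<forall>\<^sub>F n in sequentially. dist (b n) 0 < e)"
      using \<open>\<not> b \<longlonglongrightarrow> 0\<close> unfolding tendsto_iff by blast
    then show thesis using *[of "e / 2"] b by (simp add: not_eventually not_less)
  qed
  define h where "h = min 1 (d / (C + 1))"
  have h: "0 < h" "h \<le> 1" "C * h \<le> d"
  proof -
    have "C * h \<le> C * (d / (C + 1))" using C by (intro mult_left_mono) (auto simp: h_def)
    also have "\<dots> \<le> d" using C d by (simp add: field_simps)
    finally show "C * h \<le> d" .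
  qed (use C d in \<open>auto simp: h_def\<close>)
  \<comment> \<open>The tolerance on the update rate that leaves at least \<open>r h n / 4\<close> updates in the window.\<close>
  define t where "t = r * h / 12"
  have t: "0 < t" using rate h by (simp add: t_def)
  define kp where "kp = d\<^sup>2 * (g * (r * h / 8))"
  have kp: "0 < kp" using d g rate h by (simp add: kp_def)
  let ?s = "\<lambda>n. g / real (N n) * of_bool (n \<in> U) * (b n)\<^sup>2"
  have s0: "0 \<le> ?s n" for n using g by simp
  obtain n1 where n1: "\<And>m n. n1 \<le> m \<Longrightarrow> norm (sum ?s {m..<n}) < kp"
    using sm kp unfolding summable_Cauchy by blast
  obtain n2 where n2: "\<And>n. n2 \<le> n \<Longrightarrow> (r - t) * real n \<le> real (N n)" "\<And>n. n2 \<le> n \<Longrightarrow> real (N n) \<le> (r + t) * real n"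
    using eventually_conj[OF count_ge[OF rate(1), of "r - t"] count_le[OF rate(1), of "r + t"]] t
    unfolding eventually_sequentially by auto
  have "\<forall>\<^sub>F n in sequentially. n0 + n1 + n2 + 1 \<le> n \<and> 2 / h \<le> real n"
    by (intro eventually_conj eventually_ge_at_top) (meson eventually_at_top_linorder nat_ceiling_le_eq)
  then obtain n where n: "2 * d \<le> b n" "n0 + n1 + n2 + 1 \<le> n" "2 / h \<le> real n"
    using frequently_eventually_frequently[OF d(2)] frequently_ex by (metis (mono_tags, lifting))
  define m where "m = n + nat \<lfloor>h * real n\<rfloor>"
  have hn: "0 \<le> h * real n" "2 \<le> h * real n" "h * real n \<le> real n"
    using h n by (auto simp: field_simps)
  have m: "n \<le> m" "real m \<le> real n + h * real n" "real n + h * real n / 2 \<le> real m"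
    unfolding m_def using hn by (auto simp: of_nat_nat) linarith+
  have m2: "real m \<le> 2 * real n" using m(2) hn by linarith
  have npos: "0 < real n" using n by simp
  have drift: "\<bar>b j - b n\<bar> \<le> C * (real j - real n) / real n" if "n \<le> j" for j
    using that
  proof (induction j rule: dec_induct)
    case (step j)
    have "C / real j \<le> C / real n" using step C npos by (intro divide_left_mono) auto
    then have "\<bar>b (Suc j) - b j\<bar> \<le> C / real n" using slow[of j] step n by linarith
    then show ?case using step(3) by (simp add: field_simps) (simp add: add_divide_distrib diff_divide_distrib)
  qed simp
  have big: "d \<le> b j" if "j \<in> {n..m}" for j
  proof -
    have "C * (real j - real n) / real n \<le> C * (h * real n) / real n"
      using that C m(2) by (intro divide_right_mono mult_left_mono) auto
    also have "\<dots> \<le> d" using h npos by simp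
    finally show ?thesis using drift[of j] that n(1) by auto
  qed
  have upd: "g / real m * of_bool (j \<in> U) \<le> g / real (N j) * of_bool (j \<in> U)" if j: "j \<in> {Suc n..m}" for j
  proof (cases "j \<in> U")
    case True
    have "N j \<le> (\<Sum>i=1..j. 1)" unfolding N by (intro sum_mono) auto
    then have "N j \<le> m" using j by simp
    moreover have "0 < N j" unfolding N using True j by (intro sum_pos2[of _ j]) auto
    ultimately show ?thesis using g by (simp add: divide_left_mono True)
  qed simp
  have "N m = N n + (\<Sum>j=Suc n..m. of_bool (j \<in> U))"
    unfolding N by (rule sum_split_nat[OF m(1)])
  then have cnt: "(\<Sum>j=Suc n..m. of_bool (j \<in> U)) = real (N m) - real (N n)" by simp
  have "r * h / 4 * real n \<le> real (N m) - real (N n)"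
  proof -
    have "(r - t) * real m - (r + t) * real n \<le> real (N m) - real (N n)"
      using n2(1)[of m] n2(2)[of n] n m(1) by linarith
    moreover have "(r - t) * real m - (r + t) * real n = r * (real m - real n) - t * (real m + real n)"
      by (simp add: algebra_simps)
    moreover have "r * (h * real n / 2) \<le> r * (real m - real n)" using m(3) rate by (intro mult_left_mono) auto
    moreover have "t * (real m + real n) \<le> t * (3 * real n)" using m2 t by (intro mult_left_mono) auto
    ultimately show ?thesis by (simp add: t_def algebra_simps)
  qed
  then have "kp \<le> d\<^sup>2 * (g / real m * (real (N m) - real (N n)))"
  proof -
    assume *: "r * h / 4 * real n \<le> real (N m) - real (N n)"
    have "r * h / 8 * real m \<le> r * h / 4 * real n" using m2 rate h by (simp add: field_simps)
    then have "r * h / 8 * real m \<le> real (N m) - real (N n)" using * by linarith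
    then have "g / real m * (r * h / 8 * real m) \<le> g / real m * (real (N m) - real (N n))"
      using g by (intro mult_left_mono) auto
    moreover have "0 < real m" using npos m(1) by simp
    ultimately have "g * (r * h / 8) \<le> g / real m * (real (N m) - real (N n))" by simp
    then show ?thesis unfolding kp_def by (intro mult_left_mono) auto
  qed
  also have "\<dots> = (\<Sum>j=Suc n..m. g / real m * of_bool (j \<in> U) * d\<^sup>2)"
    unfolding cnt[symmetric] sum_distrib_left by (intro sum.cong refl) (simp only: mult_ac)
  also have "\<dots> \<le> (\<Sum>j=Suc n..m. ?s j)"
    using big d g by (intro sum_mono mult_mono upd power_mono) auto
  also have "\<dots> = sum ?s {Suc n..<Suc m}" by (simp add: atLeastLessThanSuc_atLeastAtMost)
  also have "\<dots> < kp" using n1[of "Suc n" "Suc m"] n by simp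
  finally show False by simp
qed

text \<open>
  Between its last update and the present epoch, an agent moves only by that last update, whose size is
  inversely proportional to its number of updates so far.
\<close>

lemma last_update_close:
  fixes v :: "nat \<Rightarrow> 'a::real_normed_vector"
  assumes N: "N n = (\<Sum>j=1..n. of_bool (j \<in> U))" "0 < N n"
    and stay: "\<And>j. 1 \<le> j \<Longrightarrow> j \<notin> U \<Longrightarrow> v (Suc j) = v j"
    and move: "\<And>j. 1 \<le> j \<Longrightarrow> j \<in> U \<Longrightarrow> norm (v (Suc j) - v j) \<le> c / real (\<Sum>i=1..j. of_bool (i \<in> U))"
    and n: "1 \<le> n" and c: "0 \<le> c"
  shows "norm (v (n - (n - Max (insert 1 {j \<in> {1..n}. j \<in> U}))) - v n) \<le> c / real (N n)"
proof -
  let ?S = "insert 1 {j \<in> {1..n}. j \<in> U}"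
  define p where "p = Max ?S"
  have fin: "finite ?S" by simp
  have p: "p \<in> ?S" "\<And>j. j \<in> ?S \<Longrightarrow> j \<le> p" unfolding p_def using Max_in[OF fin] Max_ge[OF fin] by auto
  have p1: "1 \<le> p" "p \<le> n" using p(1) n by auto
  have const: "v j = v (Suc p)" if "Suc p \<le> j" "j \<le> n" for j
    using that
  proof (induction j rule: dec_induct)
    case (step j)
    then have "j \<notin> U" using p(2)[of j] by auto
    then show ?case using stay[of j] step by simp
  qed simp
  have "norm (v p - v n) \<le> c / real (N n)"
  proof (cases "p = n")
    case True then show ?thesis using c by simp
  next
    case False
    then have vn: "v n = v (Suc p)" using const[of n] p1 by simp
    have "p \<in> U"
    proof (rule ccontr)
      assume "p \<notin> U"
      then have "p = 1" using p(1) by auto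
      then have "j \<notin> U" if "1 \<le> j" "j \<le> n" for j using p(2)[of j] that \<open>p \<notin> U\<close> by (cases "j = 1") force+
      then have "N n = 0" unfolding N by (intro sum.neutral) auto
      then show False using N by simp
    qed
    moreover have "N n = (\<Sum>i=1..p. of_bool (i \<in> U))"
    proof -
      have "N n = (\<Sum>i=1..p. of_bool (i \<in> U)) + (\<Sum>i=Suc p..n. of_bool (i \<in> U))"
        unfolding N by (rule sum_split_nat[OF p1(2)])
      moreover have "(\<Sum>i=Suc p..n. of_bool (i \<in> U)) = (0::nat)"
      proof (intro sum.neutral ballI)
        fix i assume i: "i \<in> {Suc p..n}"
        then have "i \<notin> U" using p(2)[of i] p1 by auto
        then show "of_bool (i \<in> U) = (0::nat)" by simp
      qed
      ultimately show ?thesis by simp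
    qed
    ultimately show ?thesis using move[of p] p1 by (simp add: vn norm_minus_commute)
  qed
  moreover have "n - (n - p) = p" using p1 by simp
  ultimately show ?thesis unfolding p_def by simp
qed

context smooth_convex_problem
begin

definition residual :: "real \<Rightarrow> ('n, 'k) profile \<Rightarrow> ('n, 'k) profile" where
  "residual \<tau> z = G (gibbs_profile z) + \<tau> *\<^sub>R z"

text \<open>
  One asynchronous step decreases the regularized cost, because every agent contributes a term of a
  definite sign: by convexity of the entropy the change is at most \<open>w \<bullet> \<Delta>x\<close> up to second order, where
  \<open>w\<close> is the residual, and \<open>\<Delta>z\<close> points along \<open>- w\<close> while \<open>\<Delta>z \<bullet> \<Delta>x\<close> dominates \<open>\<parallel>\<Delta>z\<parallel>\<^sup>2\<close>.
\<close>

lemma regularized_descent_step: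
  assumes \<tau>: "0 < \<tau>"
  shows "\<exists>c>0. \<exists>C\<ge>0. \<forall>z z' a e. z \<in> traceless_profiles \<longrightarrow> z' \<in> traceless_profiles \<longrightarrow> norm z \<le> R \<longrightarrow> norm z' \<le> R \<longrightarrow>
     (\<forall>k. 0 \<le> a k \<and> z' $ k = z $ k - a k *\<^sub>R (residual \<tau> z $ k + e k) \<and>
        norm (residual \<tau> z $ k + e k) \<le> W \<and> norm (e k) \<le> W) \<longrightarrow>
     regularized_cost F \<tau> (gibbs_profile z') \<le> regularized_cost F \<tau> (gibbs_profile z)
       - c * (\<Sum>k\<in>UNIV. a k * (norm (residual \<tau> z $ k))\<^sup>2)
       + C * (\<Sum>k\<in>UNIV. a k * norm (e k)) + C * (\<Sum>k\<in>UNIV. (a k)\<^sup>2)"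
proof -
  obtain L where L: "0 \<le> L" "\<And>X X'. X \<in> feasible I \<Longrightarrow> X' \<in> feasible I \<Longrightarrow>
      F X' \<le> F X + G X \<bullet> (X' - X) + L * (norm (X' - X))\<^sup>2"
    using gradient_properties by metis
  obtain l where l: "0 \<le> l" "\<And>Y Y' k. Y \<in> traceless_profiles \<Longrightarrow> Y' \<in> traceless_profiles \<Longrightarrow>
     norm (gibbs_profile Y $ k - gibbs_profile Y' $ k) \<le> l * norm (Y $ k - Y' $ k)"
    using gibbs_profile_lipschitz by metis
  obtain c where c: "0 < c" "\<And>Y Y' k. Y \<in> traceless_profiles \<Longrightarrow> Y' \<in> traceless_profiles \<Longrightarrow> norm Y \<le> R \<Longrightarrow> norm Y' \<le> R \<Longrightarrow>
     c * (norm (Y $ k - Y' $ k))\<^sup>2 \<le> (Y $ k - Y' $ k) \<bullet> (gibbs_profile Y $ k - gibbs_profile Y' $ k)"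
    using gibbs_profile_strongly_monotone[of R] by metis
  define W' where "W' = \<bar>W\<bar>"
  define C where "C = max (c * W' + l * W') (\<tau> * l * W'\<^sup>2 + L * (l * W')\<^sup>2)"
  have C: "0 \<le> C" "c * W' + l * W' \<le> C" "\<tau> * l * W'\<^sup>2 + L * (l * W')\<^sup>2 \<le> C"
    using c l by (auto simp: C_def W'_def le_max_iff_disj)
  show ?thesis
  proof (rule exI[of _ "c / 2"], rule conjI, use c in simp, rule exI[of _ C], intro conjI allI impI)
    fix z z' a e
    assume z: "z \<in> traceless_profiles" and z': "z' \<in> traceless_profiles" and R: "norm z \<le> R" "norm z' \<le> R"
      and step: "\<forall>k. 0 \<le> a k \<and> z' $ k = z $ k - a k *\<^sub>R (residual \<tau> z $ k + e k) \<and>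
        norm (residual \<tau> z $ k + e k) \<le> W \<and> norm (e k) \<le> W"
    define w where "w = residual \<tau> z"
    define x where "x = gibbs_profile z"
    define D where "D = gibbs_profile z' - x"
    have x: "x \<in> feasible I" "gibbs_profile z' \<in> feasible I" using z z' by (simp_all add: x_def gibbs_profile_feasible)
    have "0 \<le> entropy_modulus TYPE('n) * (norm (x - gibbs_profile z'))\<^sup>2"
      using entropy_modulus_pos[where 'n='n] by simp
    then have "profile_entropy (gibbs_profile z') - z' \<bullet> D \<le> profile_entropy x"
      using entropy_strongly_convex[OF z' x(1)] by (simp add: D_def inner_diff_right)
    then have ent: "\<tau> * profile_entropy (gibbs_profile z') \<le> \<tau> * profile_entropy x + \<tau> * (z' \<bullet> D)"
      using mult_left_mono[of _ _ \<tau>] \<tau> by (fastforce simp: algebra_simps)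
    have "F (gibbs_profile z') \<le> F x + G x \<bullet> D + L * (norm D)\<^sup>2" using L(2)[OF x] by (simp add: D_def)
    with ent have "regularized_cost F \<tau> (gibbs_profile z') \<le> regularized_cost F \<tau> x
      + ((G x + \<tau> *\<^sub>R z') \<bullet> D + L * (norm D)\<^sup>2)"
      by (simp add: regularized_cost_entropy inner_add_left)
    also have "(G x + \<tau> *\<^sub>R z') \<bullet> D + L * (norm D)\<^sup>2
      = (\<Sum>k\<in>UNIV. w $ k \<bullet> D $ k + \<tau> * ((z' $ k - z $ k) \<bullet> D $ k) + L * (norm (D $ k))\<^sup>2)"
    proof -
      have "(G x + \<tau> *\<^sub>R z') \<bullet> D = (w + \<tau> *\<^sub>R (z' - z)) \<bullet> D"
        by (simp add: w_def residual_def x_def algebra_simps)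
      also have "\<dots> = (\<Sum>k\<in>UNIV. w $ k \<bullet> D $ k + \<tau> * ((z' $ k - z $ k) \<bullet> D $ k))"
        by (simp add: inner_vec_def[of _ D] inner_add_left)
      finally show ?thesis by (simp add: norm_profile_sq sum.distrib sum_distrib_left)
    qed
    also have "\<dots> \<le> (\<Sum>k\<in>UNIV. - (c / 2) * (a k * (norm (w $ k))\<^sup>2) + C * (a k * norm (e k)) + C * (a k)\<^sup>2)"
    proof (rule sum_mono)
      fix k
      have a: "0 \<le> a k" and zk: "z' $ k - z $ k = - (a k *\<^sub>R (w $ k + e k))"
        and W: "norm (w $ k + e k) \<le> W'" "norm (e k) \<le> W'"
        using step by (auto simp: w_def W'_def intro: order_trans abs_ge_self)
      have dz: "norm (z' $ k - z $ k) = a k * norm (w $ k + e k)" using a by (simp add: zk)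
      have D1: "norm (D $ k) \<le> a k * (l * norm (w $ k + e k))"
        using l(2)[OF z' z, of k] by (simp add: D_def x_def dz mult_ac)
      have "a k * (l * norm (w $ k + e k)) \<le> a k * (l * W')" using a l W by (intro mult_left_mono)
      with D1 have D2: "norm (D $ k) \<le> a k * (l * W')" by linarith
      have "w $ k \<bullet> D $ k \<le> - (c * (a k * (norm (w $ k + e k))\<^sup>2)) + norm (e k) * (a k * (l * W'))"
      proof (cases "a k = 0")
        case True then show ?thesis using D2 by simp
      next
        case False
        have "c * (a k * norm (w $ k + e k))\<^sup>2 \<le> (z' $ k - z $ k) \<bullet> D $ k"
          using c(2)[OF z' z R(2,1), of k] unfolding dz by (simp add: D_def x_def)
        also have "\<dots> = a k * (- (w $ k + e k) \<bullet> D $ k)"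
          by (simp only: zk inner_minus_left inner_scaleR_left mult_minus_right)
        finally have "a k * (c * (a k * (norm (w $ k + e k))\<^sup>2)) \<le> a k * (- (w $ k + e k) \<bullet> D $ k)"
          by (simp add: power2_eq_square mult_ac)
        then have "c * (a k * (norm (w $ k + e k))\<^sup>2) \<le> - (w $ k + e k) \<bullet> D $ k"
          using a False by simp
        moreover have "- (e k \<bullet> D $ k) \<le> norm (e k) * norm (D $ k)"
          using Cauchy_Schwarz_ineq2[of "e k" "D $ k"] by linarith
        moreover have "norm (e k) * norm (D $ k) \<le> norm (e k) * (a k * (l * W'))"
          using D2 by (intro mult_left_mono) auto
        ultimately show ?thesis by (simp add: inner_add_left inner_diff_left)
      qed
      moreover have "(norm (w $ k))\<^sup>2 / 2 - norm (e k) * W' \<le> (norm (w $ k + e k))\<^sup>2"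
      proof -
        have "norm (w $ k) \<le> norm (w $ k + e k) + norm (e k)"
          using norm_triangle_ineq4[of "w $ k + e k" "e k"] by simp
        then have "(norm (w $ k))\<^sup>2 \<le> (norm (w $ k + e k) + norm (e k))\<^sup>2" by (intro power_mono) auto
        also have "\<dots> \<le> 2 * (norm (w $ k + e k))\<^sup>2 + 2 * (norm (e k))\<^sup>2"
          using sum_squares_bound[of "norm (w $ k + e k)" "norm (e k)"] by (simp add: power2_sum)
        finally have "(norm (w $ k))\<^sup>2 / 2 - (norm (e k))\<^sup>2 \<le> (norm (w $ k + e k))\<^sup>2" by simp
        moreover have "(norm (e k))\<^sup>2 \<le> norm (e k) * W'" using W(2) by (simp add: power2_eq_square mult_left_mono)
        ultimately show ?thesis by linarith
      qed
      then have "c * (a k * ((norm (w $ k))\<^sup>2 / 2 - norm (e k) * W')) \<le> c * (a k * (norm (w $ k + e k))\<^sup>2)"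
        using c a by (intro mult_left_mono) auto
      moreover have "\<tau> * ((z' $ k - z $ k) \<bullet> D $ k) \<le> (a k)\<^sup>2 * (\<tau> * l * W'\<^sup>2)"
      proof -
        have "(z' $ k - z $ k) \<bullet> D $ k \<le> norm (z' $ k - z $ k) * norm (D $ k)" by (rule norm_cauchy_schwarz)
        also have "\<dots> \<le> (a k * W') * (a k * (l * W'))"
          unfolding dz using a W l D2 by (intro mult_mono) (auto intro: mult_left_mono simp: W'_def)
        finally show ?thesis using mult_left_mono[of _ _ \<tau>] \<tau> by (fastforce simp: power2_eq_square mult_ac)
      qed
      moreover have "L * (norm (D $ k))\<^sup>2 \<le> (a k)\<^sup>2 * (L * (l * W')\<^sup>2)"
      proof -
        have "(norm (D $ k))\<^sup>2 \<le> (a k * (l * W'))\<^sup>2" using D2 by (intro power_mono) auto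
        from mult_left_mono[OF this L(1)] show ?thesis by (simp add: power_mult_distrib mult_ac)
      qed
      moreover have "(a k)\<^sup>2 * (\<tau> * l * W'\<^sup>2 + L * (l * W')\<^sup>2) \<le> (a k)\<^sup>2 * C"
        using C(3) by (intro mult_left_mono) auto
      moreover have "(a k * norm (e k)) * (c * W' + l * W') \<le> (a k * norm (e k)) * C"
        using C(2) a by (intro mult_left_mono) auto
      ultimately show "w $ k \<bullet> D $ k + \<tau> * ((z' $ k - z $ k) \<bullet> D $ k) + L * (norm (D $ k))\<^sup>2
        \<le> - (c / 2) * (a k * (norm (w $ k))\<^sup>2) + C * (a k * norm (e k)) + C * (a k)\<^sup>2"
        by (simp add: algebra_simps)
    qed
    also have "\<dots> = - (c / 2) * (\<Sum>k\<in>UNIV. a k * (norm (w $ k))\<^sup>2)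
       + C * (\<Sum>k\<in>UNIV. a k * norm (e k)) + C * (\<Sum>k\<in>UNIV. (a k)\<^sup>2)"
      unfolding sum.distrib sum_distrib_left ..
    finally show "regularized_cost F \<tau> (gibbs_profile z') \<le> regularized_cost F \<tau> (gibbs_profile z)
       - c / 2 * (\<Sum>k\<in>UNIV. a k * (norm (residual \<tau> z $ k))\<^sup>2)
       + C * (\<Sum>k\<in>UNIV. a k * norm (e k)) + C * (\<Sum>k\<in>UNIV. (a k)\<^sup>2)"
      by (simp add: w_def x_def)
  qed (rule C(1))
qed

end

context smooth_convex_problem
begin

lemma residual_lipschitz:
  "\<exists>C\<ge>0. \<forall>z\<in>traceless_profiles. \<forall>z'\<in>traceless_profiles. norm (residual \<tau> z - residual \<tau> z') \<le> C * norm (z - z')"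
proof -
  obtain L where L: "0 \<le> L" "\<And>X X'. X \<in> feasible I \<Longrightarrow> X' \<in> feasible I \<Longrightarrow> norm (G X - G X') \<le> L * norm (X - X')"
    using gradient_properties by metis
  obtain l where l: "0 \<le> l" "\<And>Y Y'. Y \<in> traceless_profiles \<Longrightarrow> Y' \<in> traceless_profiles \<Longrightarrow>
     norm (gibbs_profile Y - gibbs_profile Y') \<le> l * norm (Y - Y')"
    using gibbs_profile_lipschitz by metis
  have "norm (residual \<tau> z - residual \<tau> z') \<le> (L * l + \<bar>\<tau>\<bar>) * norm (z - z')"
    if z: "z \<in> traceless_profiles" "z' \<in> traceless_profiles" for z z'
  proof -
    have "norm (residual \<tau> z - residual \<tau> z')
      = norm ((G (gibbs_profile z) - G (gibbs_profile z')) + \<tau> *\<^sub>R (z - z'))"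
      by (simp add: residual_def algebra_simps)
    also have "\<dots> \<le> norm (G (gibbs_profile z) - G (gibbs_profile z')) + \<bar>\<tau>\<bar> * norm (z - z')"
      by (rule order_trans[OF norm_triangle_ineq]) simp
    also have "norm (G (gibbs_profile z) - G (gibbs_profile z')) \<le> L * (l * norm (z - z'))"
      using L(2)[OF gibbs_profile_feasible[OF z(1)] gibbs_profile_feasible[OF z(2)]]
        mult_left_mono[OF l(2)[OF z] L(1)] by linarith
    finally show ?thesis by (simp add: algebra_simps)
  qed
  then show ?thesis using L l by (intro exI[of _ "L * l + \<bar>\<tau>\<bar>"]) simp
qed

text \<open>
  The cost gradient is monotone and the Gibbs map strongly monotone, so pairing the residual with the
  distance of the Gibbs profiles bounds the distance to the equilibrium.
\<close>

lemma residual_controls_distance: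
  assumes \<tau>: "0 < \<tau>" and Y: "Y \<in> traceless_profiles" "G (gibbs_profile Y) = - \<tau> *\<^sub>R Y"
  shows "\<exists>C\<ge>0. \<forall>z\<in>traceless_profiles. norm z \<le> R \<longrightarrow> norm (z - Y) \<le> C * norm (residual \<tau> z)"
proof -
  obtain c where c: "0 < c" "\<And>z k. z \<in> traceless_profiles \<Longrightarrow> norm z \<le> max R (norm Y) \<Longrightarrow>
     c * (norm (z $ k - Y $ k))\<^sup>2 \<le> (z $ k - Y $ k) \<bullet> (gibbs_profile z $ k - gibbs_profile Y $ k)"
    using gibbs_profile_strongly_monotone[of "max R (norm Y)"] Y(1) max.cobounded2 by metis
  obtain l where l: "0 \<le> l" "\<And>z. z \<in> traceless_profiles \<Longrightarrow>
     norm (gibbs_profile z - gibbs_profile Y) \<le> l * norm (z - Y)"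
    using gibbs_profile_lipschitz Y(1) by metis
  have "norm (z - Y) \<le> l / (\<tau> * c) * norm (residual \<tau> z)" if z: "z \<in> traceless_profiles" "norm z \<le> R" for z
  proof -
    let ?x = "gibbs_profile z" and ?y = "gibbs_profile Y"
    have f: "?x \<in> feasible I" "?y \<in> feasible I" using z Y by (simp_all add: gibbs_profile_feasible)
    have "F ?x + G ?x \<bullet> (?y - ?x) \<le> F ?y" "F ?y + G ?y \<bullet> (?x - ?y) \<le> F ?x"
      using gradient_properties f by blast+
    then have mono: "0 \<le> (G ?x - G ?y) \<bullet> (?x - ?y)"
      by (simp add: inner_diff_left inner_diff_right)
    have "(\<Sum>k\<in>UNIV. c * (norm (z $ k - Y $ k))\<^sup>2) \<le> (\<Sum>k\<in>UNIV. (z $ k - Y $ k) \<bullet> (?x $ k - ?y $ k))"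
      using c(2) z by (intro sum_mono) auto
    then have "c * (norm (z - Y))\<^sup>2 \<le> (z - Y) \<bullet> (?x - ?y)"
      by (simp add: norm_profile_sq sum_distrib_left inner_vec_def[of "z - Y"])
    then have "\<tau> * (c * (norm (z - Y))\<^sup>2) \<le> \<tau> * ((z - Y) \<bullet> (?x - ?y))" using \<tau> by simp
    also have "\<dots> = residual \<tau> z \<bullet> (?x - ?y) - (G ?x - G ?y) \<bullet> (?x - ?y)"
      by (simp add: residual_def Y(2) inner_add_left inner_diff_left algebra_simps)
    also have "\<dots> \<le> norm (residual \<tau> z) * norm (?x - ?y)"
      using mono norm_cauchy_schwarz[of "residual \<tau> z" "?x - ?y"] by linarith
    also have "\<dots> \<le> norm (residual \<tau> z) * (l * norm (z - Y))" using l(2)[OF z(1)] by (intro mult_left_mono) auto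
    finally have "norm (z - Y) * (\<tau> * c * norm (z - Y)) \<le> norm (z - Y) * (l * norm (residual \<tau> z))"
      by (simp add: power2_eq_square mult_ac)
    then have "norm (z - Y) = 0 \<or> \<tau> * c * norm (z - Y) \<le> l * norm (residual \<tau> z)"
      using mult_le_cancel_left_pos[of "norm (z - Y)" "\<tau> * c * norm (z - Y)" "l * norm (residual \<tau> z)"]
        norm_ge_zero[of "z - Y"] by (metis order_le_imp_less_or_eq)
    then show ?thesis
    proof
      assume "norm (z - Y) = 0"
      moreover have "0 \<le> l / (\<tau> * c) * norm (residual \<tau> z)" using l \<tau> c by simp
      ultimately show ?thesis by linarith
    next
      assume "\<tau> * c * norm (z - Y) \<le> l * norm (residual \<tau> z)"
      then show ?thesis using \<tau> c by (simp add: field_simps)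
    qed
  qed
  then show ?thesis using l \<tau> c by (intro exI[of _ "l / (\<tau> * c)"]) simp
qed

text \<open>
  The noise is removed by passing from \<open>y\<close> to \<open>z = y - s\<close>, where \<open>s\<close> is the tail of the noise series.
  The process \<open>z\<close> follows the noiseless recursion up to an error of the size of \<open>s\<close> and of the delays,
  which is summable against the step sizes. Hence the regularized cost is a Lyapunov function along
  \<open>z\<close>.
\<close>

lemma async_trajectory_converges:
  fixes y s Xd :: "nat \<Rightarrow> ('n, 'k) profile" and K :: "nat \<Rightarrow> 'k set" and N :: "'k \<Rightarrow> nat \<Rightarrow> nat"
  assumes \<tau>: "0 < \<tau>" and \<gamma>: "0 < \<gamma>"
    and N: "\<And>k n. N k n = (\<Sum>j=1..n. of_bool (k \<in> K j))"
    and rate: "\<And>k. \<exists>r>0. (\<lambda>n. real (N k n) / real n) \<longlonglongrightarrow> r"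
    and y: "\<And>n. 1 \<le> n \<Longrightarrow> y n \<in> traceless_profiles" "\<And>n. 1 \<le> n \<Longrightarrow> norm (y n) \<le> B"
    and s: "\<And>n. 1 \<le> n \<Longrightarrow> s n \<in> traceless_profiles" "s \<longlonglongrightarrow> 0" "summable (\<lambda>n. norm (s n) / real n)"
    and Xd: "\<And>n. 1 \<le> n \<Longrightarrow> Xd n \<in> feasible I"
    and close: "\<And>n k. 1 \<le> n \<Longrightarrow> 0 < N k n \<Longrightarrow> norm (Xd n $ k - gibbs_profile (y n) $ k) \<le> Cd / real (N k n)"
    and step: "\<And>n k. 1 \<le> n \<Longrightarrow> y (Suc n) $ k - s (Suc n) $ k = y n $ k - s n $ k
      - (\<gamma> / real (N k n) * of_bool (k \<in> K n)) *\<^sub>R (G (Xd n) $ k + \<tau> *\<^sub>R y n $ k)"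
    and Y: "Y \<in> traceless_profiles" "G (gibbs_profile Y) = - \<tau> *\<^sub>R Y"
  shows "(\<lambda>n. gibbs_profile (y n)) \<longlonglongrightarrow> gibbs_profile Y"
proof -
  define z where "z n = y n - s n" for n
  define a where "a k n = \<gamma> / real (N k n) * of_bool (k \<in> K n)" for k n
  define e where "e n k = G (Xd n) $ k - G (gibbs_profile (z n)) $ k + \<tau> *\<^sub>R s n $ k" for n k
  obtain L where L: "0 \<le> L" "\<And>X X'. X \<in> feasible I \<Longrightarrow> X' \<in> feasible I \<Longrightarrow> norm (G X - G X') \<le> L * norm (X - X')"
    using gradient_properties by metis
  obtain l where l: "0 \<le> l" "\<And>Y Y'. Y \<in> traceless_profiles \<Longrightarrow> Y' \<in> traceless_profiles \<Longrightarrow>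
     norm (gibbs_profile Y - gibbs_profile Y') \<le> l * norm (Y - Y')"
    using gibbs_profile_lipschitz by metis
  have z: "z n \<in> traceless_profiles" if "1 \<le> n" for n
    unfolding z_def using y(1) s(1) that subspace_traceless by (simp add: subspace_diff)
  obtain Bs where Bs: "\<And>n. norm (s n) \<le> Bs"
    using convergent_imp_Bseq[OF convergentI[OF s(2)]] by (auto simp: Bseq_def)
  define R where "R = B + Bs"
  have zR: "norm (z n) \<le> R" if "1 \<le> n" for n
    unfolding z_def R_def using y(2)[OF that] Bs[of n] norm_triangle_ineq4[of "y n" "s n"] by linarith
  have B0: "0 \<le> B" using y(2)[of 1] norm_ge_zero[of "y 1"] by linarith
  have Bs0: "0 \<le> Bs" using Bs[of 1] norm_ge_zero[of "s 1"] by linarith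

  have "\<forall>k. \<exists>r>0. \<forall>\<^sub>F n in sequentially. r * real n \<le> real (N k n)"
  proof
    fix k
    obtain r where r: "0 < r" "(\<lambda>n. real (N k n) / real n) \<longlonglongrightarrow> r" using rate by blast
    then show "\<exists>r>0. \<forall>\<^sub>F n in sequentially. r * real n \<le> real (N k n)"
      using count_ge[OF r(2), of "r / 2"] by (intro exI[of _ "r / 2"]) auto
  qed
  then obtain r where r: "\<And>k. 0 < r k" "\<And>k. \<forall>\<^sub>F n in sequentially. r k * real n \<le> real (N k n)" by metis
  define \<rho> where "\<rho> = Min (range r)"
  have \<rho>: "0 < \<rho>" "\<rho> \<le> r k" for k using r by (auto simp: \<rho>_def)
  have "\<forall>\<^sub>F n in sequentially. \<forall>k. r k * real n \<le> real (N k n)" using r(2) by (intro eventually_all_finite)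
  then obtain n1 where n1: "\<And>n k. n1 \<le> n \<Longrightarrow> r k * real n \<le> real (N k n)" by (auto simp: eventually_sequentially)
  define n0 where "n0 = Suc n1"
  have n0: "1 \<le> n" "0 < real n" if "n0 \<le> n" for n using that by (auto simp: n0_def)
  have Nge: "\<rho> * real n \<le> real (N k n)" if "n0 \<le> n" for n k
  proof -
    have "\<rho> * real n \<le> r k * real n" by (intro mult_right_mono \<rho>(2)) simp
    also have "\<dots> \<le> real (N k n)" using that by (intro n1) (simp add: n0_def)
    finally show ?thesis .
  qed
  have Npos: "0 < real (N k n)" if "n0 \<le> n" for n k
    using Nge[OF that, of k] \<rho>(1) n0[OF that] by (metis less_le_trans mult_pos_pos)
  have inv_N: "1 / real (N k n) \<le> (1 / \<rho>) / real n" if "n0 \<le> n" for n k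
    using divide_left_mono[OF Nge[OF that, of k], of 1] \<rho>(1) n0[OF that] Npos[OF that, of k] by simp
  define A where "A = \<gamma> / \<rho>"
  have A: "0 \<le> A" using \<gamma> \<rho> by (simp add: A_def)
  have a0: "0 \<le> a k n" for k n using \<gamma> by (simp add: a_def)
  have aA: "a k n \<le> A / real n" if "n0 \<le> n" for k n
  proof (cases "k \<in> K n")
    case True
    then show ?thesis using mult_left_mono[OF inv_N[OF that, of k], of \<gamma>] \<gamma> by (simp add: a_def A_def)
  next
    case False
    then show ?thesis using A by (simp add: a_def)
  qed

  obtain Bf where Bf: "\<And>X. X \<in> feasible I \<Longrightarrow> norm X \<le> Bf"
    using compact_imp_bounded[OF compact_feasible] unfolding bounded_iff by blast
  define BG where "BG = norm (G (gibbs_profile 0)) + L * (Bf + Bf)"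
  have BG: "norm (G X) \<le> BG" if X: "X \<in> feasible I" for X
  proof -
    have 0: "gibbs_profile 0 \<in> feasible I" by (rule gibbs_profile_feasible[OF zero_traceless])
    have "norm (X - gibbs_profile 0) \<le> Bf + Bf"
      using norm_triangle_ineq4[of X "gibbs_profile 0"] Bf[OF X] Bf[OF 0] by linarith
    then have "norm (G X - G (gibbs_profile 0)) \<le> L * (Bf + Bf)"
      using L(2)[OF X 0] mult_left_mono[OF _ L(1)] order_trans by blast
    then show ?thesis using norm_triangle_sub[of "G X" "G (gibbs_profile 0)"] by (simp add: BG_def)
  qed
  have BG0: "0 \<le> BG" using BG[OF gibbs_profile_feasible[OF zero_traceless]] norm_ge_zero order_trans by blast
  have drift: "residual \<tau> (z n) $ k + e n k = G (Xd n) $ k + \<tau> *\<^sub>R y n $ k" for n k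
    by (simp add: residual_def e_def z_def algebra_simps)
  define W where "W = max (BG + \<tau> * B) (2 * BG + \<tau> * Bs)"
  have W1: "norm (residual \<tau> (z n) $ k + e n k) \<le> W" if n: "1 \<le> n" for n k
  proof -
    have "norm (G (Xd n) $ k + \<tau> *\<^sub>R y n $ k) \<le> norm (G (Xd n) $ k) + \<tau> * norm (y n $ k)"
      using norm_triangle_ineq[of "G (Xd n) $ k" "\<tau> *\<^sub>R y n $ k"] \<tau> by simp
    also have "norm (G (Xd n) $ k) \<le> BG" using norm_profile_component BG[OF Xd[OF n]] order_trans by blast
    also have "\<tau> * norm (y n $ k) \<le> \<tau> * B"
      using norm_profile_component[of "y n" k] y(2)[OF n] \<tau> by (intro mult_left_mono) auto
    finally show ?thesis by (simp add: drift W_def)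
  qed
  have W2: "norm (e n k) \<le> W" if n: "1 \<le> n" for n k
  proof -
    have "norm (e n k) \<le> norm (G (Xd n) $ k - G (gibbs_profile (z n)) $ k) + \<tau> * norm (s n $ k)"
      unfolding e_def using norm_triangle_ineq[of "G (Xd n) $ k - G (gibbs_profile (z n)) $ k" "\<tau> *\<^sub>R s n $ k"] \<tau> by simp
    also have "norm (G (Xd n) $ k - G (gibbs_profile (z n)) $ k) \<le> BG + BG"
      using norm_triangle_ineq4[of "G (Xd n) $ k" "G (gibbs_profile (z n)) $ k"] BG[OF Xd[OF n]]
        BG[OF gibbs_profile_feasible[OF z[OF n]]] norm_profile_component[of "G (Xd n)" k]
        norm_profile_component[of "G (gibbs_profile (z n))" k] by linarith
    also have "\<tau> * norm (s n $ k) \<le> \<tau> * Bs"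
      using norm_profile_component[of "s n" k] Bs[of n] \<tau> by (intro mult_left_mono) auto
    finally show ?thesis by (simp add: W_def)
  qed
  have W0: "0 \<le> W" using BG0 \<tau> B0 by (simp add: W_def le_max_iff_disj)
  define C1 where "C1 = CARD('k) * (\<bar>Cd\<bar> / \<rho>)"
  define E where "E n = L * (C1 / real n) + (L * l + \<tau>) * norm (s n)" for n
  have eE: "norm (e n k) \<le> E n" if n: "n0 \<le> n" for n k
  proof -
    note n' = n0[OF n]
    have "norm ((Xd n - gibbs_profile (y n)) $ k) \<le> \<bar>Cd\<bar> / \<rho> / real n" for k
    proof -
      have "norm ((Xd n - gibbs_profile (y n)) $ k) \<le> Cd / real (N k n)"
        using close[of n k] n' Npos[OF n, of k] by simp
      also have "\<dots> \<le> \<bar>Cd\<bar> * (1 / real (N k n))" by (simp add: divide_right_mono)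
      also have "\<dots> \<le> \<bar>Cd\<bar> * ((1 / \<rho>) / real n)" using inv_N[OF n] by (intro mult_left_mono) auto
      finally show ?thesis by simp
    qed
    from norm_profile_le[of "Xd n - gibbs_profile (y n)", OF this]
    have 1: "norm (Xd n - gibbs_profile (y n)) \<le> C1 / real n" by (simp add: C1_def)
    have 2: "norm (gibbs_profile (y n) - gibbs_profile (z n)) \<le> l * norm (s n)"
      using l(2)[OF y(1)[OF n'(1)] z[OF n'(1)]] by (simp add: z_def)
    have "norm (Xd n - gibbs_profile (z n)) \<le> C1 / real n + l * norm (s n)"
      using norm_triangle_ineq[of "Xd n - gibbs_profile (y n)" "gibbs_profile (y n) - gibbs_profile (z n)"] 1 2 by simp
    then have "norm (G (Xd n) - G (gibbs_profile (z n))) \<le> L * (C1 / real n + l * norm (s n))"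
      using L(2)[OF Xd[OF n'(1)] gibbs_profile_feasible[OF z[OF n'(1)]]] mult_left_mono[OF _ L(1)] order_trans by blast
    moreover have "norm (e n k) \<le> norm (G (Xd n) - G (gibbs_profile (z n))) + \<tau> * norm (s n)"
    proof -
      have "e n k = (G (Xd n) - G (gibbs_profile (z n)) + \<tau> *\<^sub>R s n) $ k" by (simp add: e_def)
      then have "norm (e n k) \<le> norm (G (Xd n) - G (gibbs_profile (z n)) + \<tau> *\<^sub>R s n)"
        by (simp only: norm_profile_component)
      also have "\<dots> \<le> norm (G (Xd n) - G (gibbs_profile (z n))) + norm (\<tau> *\<^sub>R s n)" by (rule norm_triangle_ineq)
      finally show ?thesis using \<tau> by simp
    qed
    ultimately show ?thesis by (simp add: E_def algebra_simps)
  qed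
  have E0: "0 \<le> E n" for n using L l \<tau> \<rho>(1) by (simp add: E_def C1_def)
  have zstep: "z (Suc n) $ k = z n $ k - a k n *\<^sub>R (residual \<tau> (z n) $ k + e n k)" if "1 \<le> n" for n k
    unfolding drift a_def using step[OF that, of k] by (simp add: z_def)

  obtain c C where c: "0 < c" and C: "0 \<le> C"
    and descent: "\<forall>z z' a e. z \<in> traceless_profiles \<longrightarrow> z' \<in> traceless_profiles \<longrightarrow> norm z \<le> R \<longrightarrow> norm z' \<le> R \<longrightarrow>
     (\<forall>k. 0 \<le> a k \<and> z' $ k = z $ k - a k *\<^sub>R (residual \<tau> z $ k + e k) \<and>
        norm (residual \<tau> z $ k + e k) \<le> W \<and> norm (e k) \<le> W) \<longrightarrow>
     regularized_cost F \<tau> (gibbs_profile z') \<le> regularized_cost F \<tau> (gibbs_profile z)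
       - c * (\<Sum>k\<in>UNIV. a k * (norm (residual \<tau> z $ k))\<^sup>2)
       + C * (\<Sum>k\<in>UNIV. a k * norm (e k)) + C * (\<Sum>k\<in>UNIV. (a k)\<^sup>2)"
    using regularized_descent_step[OF \<tau>, of R W] by (elim exE conjE) (rule that)
  define p where "p n = (\<Sum>k\<in>UNIV. a k n * (norm (residual \<tau> (z n) $ k))\<^sup>2)" for n
  define q where "q n = C * (CARD('k) * (A / real n * E n)) + C * (CARD('k) * (A / real n)\<^sup>2)" for n
  have summable_p: "summable p"
  proof (rule summable_of_descent)
    show "0 \<le> p n" for n unfolding p_def using a0 by (intro sum_nonneg) simp
    show "0 < c" by (rule c)
    have sq: "summable (\<lambda>n. 1 / (real n)\<^sup>2)" using inverse_power_summable[of 2] by (simp add: inverse_eq_divide)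
    have "q = (\<lambda>n. (C * CARD('k) * (A * L * C1 + A\<^sup>2)) * (1 / (real n)\<^sup>2)
      + (C * CARD('k) * A * (L * l + \<tau>)) * (norm (s n) / real n))"
      by (rule ext) (simp add: q_def E_def power2_eq_square algebra_simps add_divide_distrib)
    then show "summable q" by (simp only:) (intro summable_add summable_mult sq s(3))
    fix n assume n: "n0 \<le> n"
    note n' = n0[OF n]
    have Sn: "1 \<le> Suc n" by simp
    have "regularized_cost F \<tau> (gibbs_profile (z (Suc n))) \<le> regularized_cost F \<tau> (gibbs_profile (z n))
       - c * (\<Sum>k\<in>UNIV. a k n * (norm (residual \<tau> (z n) $ k))\<^sup>2)
       + C * (\<Sum>k\<in>UNIV. a k n * norm (e n k)) + C * (\<Sum>k\<in>UNIV. (a k n)\<^sup>2)"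
      using a0 zstep[OF n'(1)] W1[OF n'(1)] W2[OF n'(1)]
      by (intro descent[rule_format] z[OF n'(1)] z[OF Sn] zR[OF n'(1)] zR[OF Sn]) auto
    also have "C * (\<Sum>k\<in>UNIV. a k n * norm (e n k)) \<le> C * (\<Sum>k\<in>(UNIV::'k set). A / real n * E n)"
      using C aA[OF n] eE[OF n] a0 E0 A by (intro mult_left_mono sum_mono mult_mono) auto
    also have "C * (\<Sum>k\<in>UNIV. (a k n)\<^sup>2) \<le> C * (\<Sum>k\<in>(UNIV::'k set). (A / real n)\<^sup>2)"
      using C aA[OF n] a0 by (intro mult_left_mono sum_mono power_mono) auto
    finally show "regularized_cost F \<tau> (gibbs_profile (z (Suc n)))
      \<le> regularized_cost F \<tau> (gibbs_profile (z n)) - c * p n + q n"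
      by (simp add: p_def q_def)
    have "0 \<le> \<tau> * entropy_modulus TYPE('n) * (norm (gibbs_profile (z n) - gibbs_profile Y))\<^sup>2"
      using \<tau> entropy_modulus_pos[where 'n='n] by simp
    then show "regularized_cost F \<tau> (gibbs_profile Y) \<le> regularized_cost F \<tau> (gibbs_profile (z n))"
      using equilibrium_minimizes[OF \<tau> Y gibbs_profile_feasible[OF z[OF n'(1)]]] by linarith
  qed

  obtain Cr where Cr: "0 \<le> Cr" "\<And>z z'. z \<in> traceless_profiles \<Longrightarrow> z' \<in> traceless_profiles \<Longrightarrow>
      norm (residual \<tau> z - residual \<tau> z') \<le> Cr * norm (z - z')"
    using residual_lipschitz by metis
  have "(\<lambda>n. norm (residual \<tau> (z n) $ k)) \<longlonglongrightarrow> 0" for k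
  proof -
    obtain rk where rk: "0 < rk" "(\<lambda>n. real (N k n) / real n) \<longlonglongrightarrow> rk" using rate by blast
    show ?thesis
    proof (rule slowly_varying_tendsto_0[where U = "{j. k \<in> K j}" and N = "N k"])
      show "N k n = (\<Sum>j=1..n. of_bool (j \<in> {j. k \<in> K j}))" for n by (simp add: N)
      show "(\<lambda>n. real (N k n) / real n) \<longlonglongrightarrow> rk" "0 < rk" "0 < \<gamma>" by (rule rk \<gamma>)+
      show "0 \<le> Cr * (CARD('k) * (A * W))" using Cr A W0 by simp
      show "\<bar>norm (residual \<tau> (z (Suc n)) $ k) - norm (residual \<tau> (z n) $ k)\<bar> \<le> Cr * (CARD('k) * (A * W)) / real n"
        if n: "n0 \<le> n" for n
      proof -
        have "norm ((z (Suc n) - z n) $ j) \<le> A / real n * W" for j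
          using mult_mono[OF aA[OF n, of j] W1[OF n0(1)[OF n], of j]] a0[of j n] A
          by (simp add: zstep[OF n0(1)[OF n]])
        from norm_profile_le[OF this] have dz: "norm (z (Suc n) - z n) \<le> CARD('k) * (A / real n * W)" .
        have "\<bar>norm (residual \<tau> (z (Suc n)) $ k) - norm (residual \<tau> (z n) $ k)\<bar>
          \<le> norm ((residual \<tau> (z (Suc n)) - residual \<tau> (z n)) $ k)"
          by (simp add: norm_triangle_ineq3)
        also have "\<dots> \<le> norm (residual \<tau> (z (Suc n)) - residual \<tau> (z n))" by (rule norm_profile_component)
        also have "\<dots> \<le> Cr * norm (z (Suc n) - z n)" using Cr(2) z n0[OF n] by simp
        also have "\<dots> \<le> Cr * (CARD('k) * (A / real n * W))" using dz Cr(1) by (intro mult_left_mono)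
        finally show ?thesis by simp
      qed
      show "summable (\<lambda>n. \<gamma> / real (N k n) * of_bool (n \<in> {j. k \<in> K j}) * (norm (residual \<tau> (z n) $ k))\<^sup>2)"
      proof (rule summable_comparison_test'[OF summable_p])
        fix n
        have "norm (a k n * (norm (residual \<tau> (z n) $ k))\<^sup>2) = a k n * (norm (residual \<tau> (z n) $ k))\<^sup>2"
          using a0[of k n] by simp
        also have "\<dots> \<le> p n"
          unfolding p_def using a0 by (intro member_le_sum) auto
        finally show "norm (\<gamma> / real (N k n) * of_bool (n \<in> {j. k \<in> K j}) * (norm (residual \<tau> (z n) $ k))\<^sup>2) \<le> p n"
          by (simp only: a_def mem_Collect_eq)
      qed
    qed simp
  qed
  then have "(\<lambda>n. residual \<tau> (z n) $ k) \<longlonglongrightarrow> 0 $ k" for k by (simp add: tendsto_norm_zero_iff)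
  then have res: "(\<lambda>n. residual \<tau> (z n)) \<longlonglongrightarrow> 0" by (rule vec_tendstoI)
  obtain Cq where Cq: "0 \<le> Cq" "\<And>z. z \<in> traceless_profiles \<Longrightarrow> norm z \<le> R \<Longrightarrow> norm (z - Y) \<le> Cq * norm (residual \<tau> z)"
    using residual_controls_distance[OF \<tau> Y] by metis
  have "(\<lambda>n. gibbs_profile (y n) - gibbs_profile Y) \<longlonglongrightarrow> 0"
  proof (rule tendsto_norm_zero_cancel, rule tendsto_sandwich[OF _ _ tendsto_const])
    show "\<forall>\<^sub>F n in sequentially. norm (gibbs_profile (y n) - gibbs_profile Y)
      \<le> l * (Cq * norm (residual \<tau> (z n)) + norm (s n))"
      using eventually_ge_at_top[of 1]
    proof eventually_elim
      case (elim n)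
      have "norm (y n - Y) \<le> norm (z n - Y) + norm (s n)"
        using norm_triangle_ineq[of "z n - Y" "s n"] by (simp add: z_def algebra_simps)
      also have "norm (z n - Y) \<le> Cq * norm (residual \<tau> (z n))" using Cq(2) z zR elim by simp
      finally have "l * norm (y n - Y) \<le> l * (Cq * norm (residual \<tau> (z n)) + norm (s n))"
        using l(1) by (intro mult_left_mono) auto
      then show ?case using l(2)[OF y(1)[OF elim] Y(1)] by linarith
    qed
    show "(\<lambda>n. l * (Cq * norm (residual \<tau> (z n)) + norm (s n))) \<longlonglongrightarrow> 0"
      by (rule tendsto_eq_intros res s(2) refl)+ simp
  qed simp
  then show ?thesis by (simp add: LIM_zero_iff)
qed

end

section \<open>Series of orthogonal random variables\<close>

lemma (in prob_space) AE_summable_of_summable_means: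
  fixes g :: "nat \<Rightarrow> 'a \<Rightarrow> real"
  assumes int: "\<And>i. integrable M (g i)" and sm: "summable (\<lambda>i. expectation (\<lambda>x. \<bar>g i x\<bar>))"
  shows "AE x in M. summable (\<lambda>i. \<bar>g i x\<bar>)"
proof -
  have meas: "g i \<in> borel_measurable M" for i using int by auto
  have "(\<integral>\<^sup>+x. (\<Sum>i. ennreal \<bar>g i x\<bar>) \<partial>M) = (\<Sum>i. \<integral>\<^sup>+x. ennreal \<bar>g i x\<bar> \<partial>M)"
    using meas by (intro nn_integral_suminf) measurable
  also have "\<dots> = (\<Sum>i. ennreal (expectation (\<lambda>x. \<bar>g i x\<bar>)))"
    using int by (intro suminf_cong nn_integral_eq_integral) auto
  also have "\<dots> \<noteq> top" using sm by (intro ennreal_suminf_neq_top) (auto intro: integral_nonneg_AE)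
  finally have "(\<integral>\<^sup>+x. (\<Sum>i. ennreal \<bar>g i x\<bar>) \<partial>M) \<noteq> \<infinity>" by simp
  moreover have "(\<lambda>x. \<Sum>i. ennreal \<bar>g i x\<bar>) \<in> borel_measurable M" using meas by measurable
  ultimately have "AE x in M. (\<Sum>i. ennreal \<bar>g i x\<bar>) \<noteq> \<infinity>" by (intro nn_integral_PInf_AE)
  then show ?thesis by eventually_elim (intro summable_suminf_not_top, auto)
qed

lemma cube_gap_le:
  assumes i: "1 \<le> i"
  shows "real ((Suc i)^3 - i^3) \<le> 7 * (real i)\<^sup>2"
proof -
  have "i * 1 \<le> i * i" using i by (intro mult_left_mono) auto
  moreover have "(Suc i)^3 - i^3 = 3 * (i * i) + 3 * i + 1"
    by (simp add: power3_eq_cube algebra_simps)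
  ultimately have "(Suc i)^3 - i^3 \<le> 7 * (i * i)" using i by linarith
  then have "real ((Suc i)^3 - i^3) \<le> real (7 * (i * i))" by (simp only: of_nat_le_iff)
  then show ?thesis by (simp add: power2_eq_square)
qed

lemma sum_inverse_squares_le: "(\<Sum>j=m..<n. 1 / (real (Suc j))\<^sup>2) \<le> 2 / real (Suc m)"
proof (cases "m \<le> n")
  case True
  have "(\<Sum>j=m..<n. 1 / (real (Suc j))\<^sup>2) \<le> 2 / real (Suc m) - 2 / real (Suc n)"
    using True
  proof (induction n rule: dec_induct)
    case (step n)
    have "1 / (real (Suc n))\<^sup>2 \<le> 2 / real (Suc n) - 2 / real (Suc (Suc n))"
    proof -
      have "2 / real (Suc n) - 2 / real (Suc (Suc n)) = 2 / (real (Suc n) * real (Suc (Suc n)))"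
        by (simp add: diff_frac_eq)
      moreover have "1 / a\<^sup>2 = 2 / (a * (2 * a))" for a :: real by (simp add: power2_eq_square)
      then have "1 / (real (Suc n))\<^sup>2 = 2 / (real (Suc n) * (2 * real (Suc n)))" .
      moreover have "2 / (real (Suc n) * (2 * real (Suc n))) \<le> 2 / (real (Suc n) * real (Suc (Suc n)))"
        by (intro divide_left_mono mult_left_mono) auto
      ultimately show ?thesis by linarith
    qed
    then show ?case using step by simp
  qed simp
  then show ?thesis by (smt (verit) divide_nonneg_nonneg of_nat_0_le_iff)
qed simp

context prob_space
begin

context
  fixes \<xi> :: "nat \<Rightarrow> 'a \<Rightarrow> real" and C :: real
  assumes meas [measurable]: "\<And>n. \<xi> n \<in> borel_measurable M"
    and bound: "\<And>n. AE x in M. \<bar>\<xi> n x\<bar> \<le> C / real (Suc n)" and C: "0 \<le> C"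
    and orthogonal: "\<And>m n. m < n \<Longrightarrow> expectation (\<lambda>x. \<xi> m x * \<xi> n x) = 0"
begin

lemma orthogonal_integrable:
  "integrable M (\<lambda>x. \<xi> m x * \<xi> n x)" "integrable M (\<xi> n)"
proof -
  show "integrable M (\<xi> n)"
    using bound[of n] by (intro integrable_const_bound[of _ "C / real (Suc n)"]) auto
  have "AE x in M. norm (\<xi> m x * \<xi> n x) \<le> C / real (Suc m) * (C / real (Suc n))"
    using bound[of m] bound[of n]
  proof eventually_elim
    case (elim x)
    then show ?case using C by (simp only: real_norm_def abs_mult) (intro mult_mono, auto)
  qed
  then show "integrable M (\<lambda>x. \<xi> m x * \<xi> n x)" by (rule integrable_const_bound) simp
qed

lemma orthogonal_sum_square:
  "integrable M (\<lambda>x. (\<Sum>j=m..<n. \<xi> j x)\<^sup>2)"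
  "expectation (\<lambda>x. (\<Sum>j=m..<n. \<xi> j x)\<^sup>2) \<le> C\<^sup>2 * (\<Sum>j=m..<n. 1 / (real (Suc j))\<^sup>2)"
proof -
  have sq: "(\<Sum>j=m..<n. \<xi> j x)\<^sup>2 = (\<Sum>i=m..<n. \<Sum>j=m..<n. \<xi> i x * \<xi> j x)" for x
    by (simp add: power2_eq_square sum_product)
  show "integrable M (\<lambda>x. (\<Sum>j=m..<n. \<xi> j x)\<^sup>2)"
    unfolding sq by (intro Bochner_Integration.integrable_sum orthogonal_integrable)
  have "expectation (\<lambda>x. (\<Sum>j=m..<n. \<xi> j x)\<^sup>2) = (\<Sum>i=m..<n. \<Sum>j=m..<n. expectation (\<lambda>x. \<xi> i x * \<xi> j x))"
    unfolding sq
    by (subst Bochner_Integration.integral_sum, intro Bochner_Integration.integrable_sum orthogonal_integrable)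
       (intro sum.cong refl Bochner_Integration.integral_sum orthogonal_integrable)
  also have "\<dots> = (\<Sum>i=m..<n. \<Sum>j=m..<n. if i = j then expectation (\<lambda>x. (\<xi> i x)\<^sup>2) else 0)"
  proof (intro sum.cong refl)
    fix i j
    show "expectation (\<lambda>x. \<xi> i x * \<xi> j x) = (if i = j then expectation (\<lambda>x. (\<xi> i x)\<^sup>2) else 0)"
      using orthogonal[of i j] orthogonal[of j i]
      by (cases i j rule: linorder_cases) (auto simp: power2_eq_square mult.commute)
  qed
  also have "\<dots> = (\<Sum>i=m..<n. expectation (\<lambda>x. (\<xi> i x)\<^sup>2))" by simp
  also have "\<dots> \<le> (\<Sum>i=m..<n. (C / real (Suc i))\<^sup>2)"
  proof (rule sum_mono)
    fix i
    have "AE x in M. (\<xi> i x)\<^sup>2 \<le> (C / real (Suc i))\<^sup>2"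
      using bound[of i] by eventually_elim (metis abs_ge_zero power2_abs power_mono)
    then have "expectation (\<lambda>x. (\<xi> i x)\<^sup>2) \<le> expectation (\<lambda>x. (C / real (Suc i))\<^sup>2)"
      using orthogonal_integrable(1)[of i i] by (intro integral_mono_AE) (auto simp: power2_eq_square)
    then show "expectation (\<lambda>x. (\<xi> i x)\<^sup>2) \<le> (C / real (Suc i))\<^sup>2" by (simp add: prob_space)
  qed
  also have "\<dots> = C\<^sup>2 * (\<Sum>j=m..<n. 1 / (real (Suc j))\<^sup>2)" by (simp add: power_divide sum_distrib_left)
  finally show "expectation (\<lambda>x. (\<Sum>j=m..<n. \<xi> j x)\<^sup>2) \<le> C\<^sup>2 * (\<Sum>j=m..<n. 1 / (real (Suc j))\<^sup>2)" .
qed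

text \<open>
  By \<open>\<bar>u\<bar> \<le> (t u\<^sup>2 + 1/t) / 2\<close>, to be used with \<open>t\<close> the reciprocal of the expected size of the sum.
\<close>

lemma orthogonal_sum_abs:
  assumes t: "0 < t"
  shows "expectation (\<lambda>x. \<bar>\<Sum>j=m..<n. \<xi> j x\<bar>) \<le> (t * (C\<^sup>2 * (\<Sum>j=m..<n. 1 / (real (Suc j))\<^sup>2)) + 1 / t) / 2"
proof -
  have am: "\<bar>u\<bar> \<le> (t * u\<^sup>2 + 1 / t) / 2" for u :: real
  proof -
    have "0 \<le> (t * \<bar>u\<bar> - 1)\<^sup>2" by simp
    also have "\<dots> = t\<^sup>2 * u\<^sup>2 + 1 - 2 * (t * \<bar>u\<bar>)" by (simp add: power2_diff power_mult_distrib)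
    finally have "2 * (t * \<bar>u\<bar>) \<le> t * (t * u\<^sup>2) + 1" by (simp add: power2_eq_square[of t])
    then show ?thesis using t by (simp add: field_simps)
  qed
  have "expectation (\<lambda>x. \<bar>\<Sum>j=m..<n. \<xi> j x\<bar>) \<le> expectation (\<lambda>x. (t * (\<Sum>j=m..<n. \<xi> j x)\<^sup>2 + 1 / t) / 2)"
    using orthogonal_integrable(2) orthogonal_sum_square(1)
    by (intro integral_mono am integrable_abs Bochner_Integration.integrable_sum) auto
  also have "\<dots> = (t * expectation (\<lambda>x. (\<Sum>j=m..<n. \<xi> j x)\<^sup>2) + 1 / t) / 2"
    using orthogonal_sum_square(1) by (simp add: prob_space)
  also have "\<dots> \<le> (t * (C\<^sup>2 * (\<Sum>j=m..<n. 1 / (real (Suc j))\<^sup>2)) + 1 / t) / 2"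
    using orthogonal_sum_square(2)[of m n] t by (intro divide_right_mono add_right_mono mult_left_mono) auto
  finally show ?thesis .
qed

text \<open>
  The increments of the partial sums between consecutive cubes are summable in mean, as the \<open>i\<close>-th of these
  blocks has \<open>O(i\<^sup>2)\<close> terms of size \<open>O(1/i\<^sup>3)\<close>, which are orthogonal. Within a block the partial sums
  move by \<open>O(1/i)\<close> only. This gives almost sure convergence without a maximal inequality.
\<close>

lemma orthogonal_series_convergent: "AE x in M. convergent (\<lambda>n. \<Sum>j<n. \<xi> j x)"
proof -
  define D where "D i x = (\<Sum>j=i^3..<(Suc i)^3. \<xi> j x)" for i x
  have "summable (\<lambda>i. expectation (\<lambda>x. \<bar>D i x\<bar>))"
  proof (rule summable_comparison_test')
    show "summable (\<lambda>i. (7 * C\<^sup>2 + 1) / 2 * (1 / (real i)\<^sup>2))"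
      using inverse_power_summable[of 2] by (intro summable_mult) (simp add: inverse_eq_divide)
    fix i :: nat assume i: "1 \<le> i"
    note cub = cube_gap_le[OF i]
    have "(\<Sum>j=i^3..<(Suc i)^3. 1 / (real (Suc j))\<^sup>2) \<le> (\<Sum>j=i^3..<(Suc i)^3. 1 / (real i ^ 3)\<^sup>2)"
    proof (intro sum_mono divide_left_mono power_mono)
      fix j assume "j \<in> {i^3..<(Suc i)^3}"
      then have "i ^ 3 \<le> Suc j" by simp
      then show "real i ^ 3 \<le> real (Suc j)" by (metis of_nat_le_iff of_nat_power)
    qed (use i in auto)
    also have "\<dots> = real ((Suc i)^3 - i^3) * (1 / (real i ^ 3)\<^sup>2)" by simp
    also have "\<dots> \<le> 7 * (real i)\<^sup>2 * (1 / (real i ^ 3)\<^sup>2)" using cub by (intro mult_right_mono) auto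
    also have "\<dots> = 7 / (real i)^4"
    proof -
      have "(real i ^ 3)\<^sup>2 = (real i)\<^sup>2 * (real i)^4" by (simp flip: power_mult power_add)
      then have "7 * (real i)\<^sup>2 * (1 / (real i ^ 3)\<^sup>2) = (real i)\<^sup>2 * 7 / ((real i)\<^sup>2 * (real i)^4)" by (simp only: ) simp
      then show ?thesis using i by (subst (asm) mult_divide_mult_cancel_left) auto
    qed
    finally have S: "(\<Sum>j=i^3..<(Suc i)^3. 1 / (real (Suc j))\<^sup>2) \<le> 7 / (real i)^4" .
    have "expectation (\<lambda>x. \<bar>D i x\<bar>) \<le> ((real i)\<^sup>2 * (C\<^sup>2 * (\<Sum>j=i^3..<(Suc i)^3. 1 / (real (Suc j))\<^sup>2)) + 1 / (real i)\<^sup>2) / 2"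
      unfolding D_def using i by (intro orthogonal_sum_abs) simp
    also have "\<dots> \<le> ((real i)\<^sup>2 * (C\<^sup>2 * (7 / (real i)^4)) + 1 / (real i)\<^sup>2) / 2"
      using S by (intro divide_right_mono add_right_mono mult_left_mono) auto
    also have "\<dots> = (7 * C\<^sup>2 + 1) / 2 * (1 / (real i)\<^sup>2)"
    proof -
      have "(real i)^4 = (real i)\<^sup>2 * (real i)\<^sup>2" by (simp flip: power_add)
      then show ?thesis using i by (simp add: field_simps)
    qed
    finally show "norm (expectation (\<lambda>x. \<bar>D i x\<bar>)) \<le> (7 * C\<^sup>2 + 1) / 2 * (1 / (real i)\<^sup>2)"
      by (simp add: integral_nonneg_AE)
  qed
  then have "AE x in M. summable (\<lambda>i. \<bar>D i x\<bar>)"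
    using orthogonal_integrable(2) by (intro AE_summable_of_summable_means) (auto simp: D_def)
  moreover have "AE x in M. \<forall>n. \<bar>\<xi> n x\<bar> \<le> C / real (Suc n)" using bound by (simp add: AE_all_countable)
  ultimately show ?thesis
  proof eventually_elim
    case (elim x)
    define S where "S n = (\<Sum>j<n. \<xi> j x)" for n
    have "S (i^3) = (\<Sum>l<i. D l x)" for i
    proof (induction i)
      case (Suc i)
      have "S ((Suc i)^3) = S (i^3) + D i x"
        unfolding S_def D_def by (simp add: lessThan_atLeast0 sum.atLeastLessThan_concat power_mono)
      then show ?case using Suc by simp
    qed (simp add: S_def)
    moreover have "summable (\<lambda>i. D i x)" using elim(1) by (rule summable_rabs_cancel)
    ultimately obtain T where T: "(\<lambda>i. S (i^3)) \<longlonglongrightarrow> T" by (auto simp: summable_iff_convergent convergent_def)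
    define r where "r n = nat \<lfloor>root 3 (real n)\<rfloor>" for n
    have r: "r n ^ 3 \<le> n" "n < (Suc (r n))^3" for n
    proof -
      have 1: "real (r n) \<le> root 3 (real n)" "root 3 (real n) < real (Suc (r n))"
        unfolding r_def by (auto simp: of_nat_nat) linarith+
      have "real (r n) ^ 3 \<le> root 3 (real n) ^ 3" using 1 by (intro power_mono) auto
      then show "r n ^ 3 \<le> n" by (simp add: odd_real_root_pow flip: of_nat_power)
      have "root 3 (real n) ^ 3 < real (Suc (r n)) ^ 3" using 1(2) by (intro power_strict_mono) auto
      then show "n < (Suc (r n))^3" by (simp add: odd_real_root_pow del: of_nat_Suc flip: of_nat_power)
    qed
    have rlim: "filterlim r at_top sequentially"
    proof (rule filterlim_at_top[THEN iffD2], rule allI)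
      fix Z :: nat
      show "\<forall>\<^sub>F n in sequentially. Z \<le> r n"
        using eventually_ge_at_top[of "Z^3"]
      proof eventually_elim
        case (elim n)
        then have "Z ^ 3 < (Suc (r n))^3" using r(2)[of n] by linarith
        then have "Z < Suc (r n)" by (rule power_less_imp_less_base) simp
        then show ?case by simp
      qed
    qed
    have osc: "\<bar>S n - S (r n ^ 3)\<bar> \<le> 7 * C * (1 / real (r n))" if pos: "1 \<le> r n" for n
    proof -
      let ?i = "r n"
      have "S n - S (?i ^ 3) = (\<Sum>j=?i^3..<n. \<xi> j x)"
        unfolding S_def lessThan_atLeast0 using r(1)[of n] by (simp add: sum_diff_nat_ivl)
      also have "\<bar>\<dots>\<bar> \<le> (\<Sum>j=?i^3..<n. C / real ?i ^ 3)"
        unfolding real_norm_def[symmetric]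
      proof (rule sum_norm_le)
        fix j assume "j \<in> {?i^3..<n}"
        then have "?i ^ 3 \<le> Suc j" by simp
        then have "real ?i ^ 3 \<le> real (Suc j)" by (metis of_nat_le_iff of_nat_power)
        then have "C / real (Suc j) \<le> C / real ?i ^ 3" using C pos by (intro divide_left_mono) auto
        then show "norm (\<xi> j x) \<le> C / real ?i ^ 3" using elim(2) order_trans by (auto simp del: of_nat_Suc)
      qed
      also have "\<dots> = real (n - ?i^3) * (C / real ?i ^ 3)" by simp
      also have "\<dots> \<le> 7 * (real ?i)\<^sup>2 * (C / real ?i ^ 3)"
      proof (rule mult_right_mono)
        have "real (n - ?i^3) \<le> real ((Suc ?i)^3 - ?i^3)" using r(2)[of n] by (intro of_nat_mono diff_le_mono) simp
        then show "real (n - ?i^3) \<le> 7 * (real ?i)\<^sup>2" using cube_gap_le[OF pos] by (rule order_trans)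
      qed (use C in simp)
      also have "\<dots> = 7 * C * (1 / real ?i)" using pos by (simp add: power3_eq_cube power2_eq_square)
      finally show ?thesis .
    qed
    have "(\<lambda>n. S n - S (r n ^ 3)) \<longlonglongrightarrow> 0"
    proof (rule tendsto_rabs_zero_cancel, rule tendsto_sandwich[OF _ _ tendsto_const])
      show "\<forall>\<^sub>F n in sequentially. \<bar>S n - S (r n ^ 3)\<bar> \<le> 7 * C * (1 / real (r n))"
        using filterlim_at_top[THEN iffD1, OF rlim, rule_format, of 1] by eventually_elim (rule osc)
      have "(\<lambda>i. 7 * C * (1 / real i)) \<longlonglongrightarrow> 7 * C * 0" by (intro tendsto_mult tendsto_const lim_1_over_n)
      from filterlim_compose[OF this rlim] show "(\<lambda>n. 7 * C * (1 / real (r n))) \<longlonglongrightarrow> 0" by simp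
    qed simp
    moreover have "(\<lambda>n. S (r n ^ 3)) \<longlonglongrightarrow> T" by (rule filterlim_compose[OF T rlim])
    ultimately have "(\<lambda>n. (S n - S (r n ^ 3)) + S (r n ^ 3)) \<longlonglongrightarrow> 0 + T" by (rule tendsto_add)
    then show ?case by (auto simp: convergent_def S_def)
  qed
qed

text \<open>By Fatou's lemma the tails are of order \<open>1/\<surd>n\<close> in mean, hence summable against \<open>1/n\<close>.\<close>

lemma orthogonal_series_tails:
  "AE x in M. \<exists>T. (\<lambda>n. \<Sum>j<n. \<xi> j x) \<longlonglongrightarrow> T \<and> summable (\<lambda>n. \<bar>T - (\<Sum>j<n. \<xi> j x)\<bar> / real (Suc n))"
proof -
  define S where "S n x = (\<Sum>j<n. \<xi> j x)" for n x
  define T where "T x = lim (\<lambda>n. S n x)" for x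
  have Smeas [measurable]: "S n \<in> borel_measurable M" for n unfolding S_def by measurable
  have Tmeas [measurable]: "T \<in> borel_measurable M" unfolding T_def by measurable
  have conv: "AE x in M. (\<lambda>n. S n x) \<longlonglongrightarrow> T x"
    using orthogonal_series_convergent unfolding S_def[symmetric] T_def
    by eventually_elim (simp add: convergent_LIMSEQ_iff)
  define K where "K = C\<^sup>2 + 1 / 2"
  have fin: "expectation (\<lambda>x. \<bar>S m x - S n x\<bar>) \<le> K * (real (Suc n) powr (- 1 / 2))" if "n \<le> m" for m n
  proof -
    let ?t = "real (Suc n) powr (1 / 2)"
    have t: "0 < ?t" by simp
    have tt: "?t / real (Suc n) = 1 / ?t"
      by (simp add: field_simps flip: powr_add)
    have "S m x - S n x = (\<Sum>j=n..<m. \<xi> j x)" for x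
      unfolding S_def lessThan_atLeast0 using that by (simp add: sum_diff_nat_ivl)
    then have "expectation (\<lambda>x. \<bar>S m x - S n x\<bar>) \<le> (?t * (C\<^sup>2 * (\<Sum>j=n..<m. 1 / (real (Suc j))\<^sup>2)) + 1 / ?t) / 2"
      using orthogonal_sum_abs[OF t, of n m] by simp
    also have "\<dots> \<le> (?t * (C\<^sup>2 * (2 / real (Suc n))) + 1 / ?t) / 2"
      using sum_inverse_squares_le[of n m] by (intro divide_right_mono add_right_mono mult_left_mono) auto
    also have "\<dots> = (2 * C\<^sup>2 * (?t / real (Suc n)) + 1 / ?t) / 2" by simp
    also have "\<dots> = K * (1 / ?t)" unfolding tt by (simp add: K_def field_simps)
    also have "1 / ?t = real (Suc n) powr (- 1 / 2)" by (simp add: powr_minus_divide)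
    finally show ?thesis .
  qed
  have K: "0 \<le> K" by (simp add: K_def)
  have intS: "integrable M (\<lambda>x. \<bar>S m x - S n x\<bar>)" for m n
    unfolding S_def using orthogonal_integrable(2)
    by (intro integrable_abs Bochner_Integration.integrable_diff Bochner_Integration.integrable_sum)
  have nn: "(\<integral>\<^sup>+x. ennreal \<bar>T x - S n x\<bar> \<partial>M) \<le> ennreal (K * (real (Suc n) powr (- 1 / 2)))" for n
  proof -
    have "(\<integral>\<^sup>+x. ennreal \<bar>T x - S n x\<bar> \<partial>M) = (\<integral>\<^sup>+x. liminf (\<lambda>m. ennreal \<bar>S m x - S n x\<bar>) \<partial>M)"
    proof (rule nn_integral_cong_AE)
      show "AE x in M. ennreal \<bar>T x - S n x\<bar> = liminf (\<lambda>m. ennreal \<bar>S m x - S n x\<bar>)"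
        using conv
      proof eventually_elim
        case (elim x)
        have "(\<lambda>m. ennreal \<bar>S m x - S n x\<bar>) \<longlonglongrightarrow> ennreal \<bar>T x - S n x\<bar>"
          by (intro tendsto_ennrealI tendsto_rabs tendsto_diff elim tendsto_const)
        then show ?case using lim_imp_Liminf[OF sequentially_bot] by metis
      qed
    qed
    also have "\<dots> \<le> liminf (\<lambda>m. \<integral>\<^sup>+x. ennreal \<bar>S m x - S n x\<bar> \<partial>M)"
      by (rule nn_integral_liminf) measurable
    also have "\<dots> \<le> ennreal (K * (real (Suc n) powr (- 1 / 2)))"
    proof (rule Liminf_le)
      show "\<forall>\<^sub>F m in sequentially. (\<integral>\<^sup>+x. ennreal \<bar>S m x - S n x\<bar> \<partial>M) \<le> ennreal (K * (real (Suc n) powr (- 1 / 2)))"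
        using eventually_ge_at_top[of n]
      proof eventually_elim
        case (elim m)
        have "(\<integral>\<^sup>+x. ennreal \<bar>S m x - S n x\<bar> \<partial>M) = ennreal (expectation (\<lambda>x. \<bar>S m x - S n x\<bar>))"
          by (intro nn_integral_eq_integral intS) simp
        then show ?case using fin[OF elim] by (simp add: ennreal_leI del: of_nat_Suc)
      qed
    qed simp
    finally show ?thesis .
  qed
  have intT: "integrable M (\<lambda>x. T x - S n x)" for n
  proof (rule integrableI_bounded)
    have "(\<integral>\<^sup>+x. ennreal \<bar>T x - S n x\<bar> \<partial>M) < \<infinity>" using nn[of n] by (simp add: le_less_trans del: of_nat_Suc)
    then show "(\<integral>\<^sup>+x. ennreal (norm (T x - S n x)) \<partial>M) < \<infinity>" by simp
  qed measurable
  have ET: "expectation (\<lambda>x. \<bar>T x - S n x\<bar>) \<le> K * (real (Suc n) powr (- 1 / 2))" for n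
  proof -
    have "ennreal (expectation (\<lambda>x. \<bar>T x - S n x\<bar>)) = (\<integral>\<^sup>+x. ennreal \<bar>T x - S n x\<bar> \<partial>M)"
      using intT[of n] by (intro nn_integral_eq_integral[symmetric]) auto
    also note nn[of n]
    finally show ?thesis using K by (subst (asm) ennreal_le_iff) simp_all
  qed
  have "summable (\<lambda>n. expectation (\<lambda>x. \<bar>(T x - S n x) / real (Suc n)\<bar>))"
  proof (rule summable_comparison_test')
    have "summable (\<lambda>n. real (Suc n) powr (- 3 / 2))"
      using summable_real_powr_iff[of "- 3 / 2"] by (subst summable_Suc_iff) simp
    then show "summable (\<lambda>n. K * real (Suc n) powr (- 3 / 2))" by (rule summable_mult)
    fix n :: nat
    have "expectation (\<lambda>x. \<bar>(T x - S n x) / real (Suc n)\<bar>) = expectation (\<lambda>x. \<bar>T x - S n x\<bar>) / real (Suc n)"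
      by (simp add: abs_divide del: of_nat_Suc)
    also have "\<dots> \<le> K * (real (Suc n) powr (- 1 / 2)) / real (Suc n)" using ET by (intro divide_right_mono) auto
    also have "\<dots> = K * real (Suc n) powr (- 3 / 2)"
      using powr_diff[of "real (Suc n)" "- 1 / 2" 1] by (simp del: of_nat_Suc)
    finally show "norm (expectation (\<lambda>x. \<bar>(T x - S n x) / real (Suc n)\<bar>)) \<le> K * real (Suc n) powr (- 3 / 2)"
      by (simp add: integral_nonneg_AE del: of_nat_Suc)
  qed
  then have "AE x in M. summable (\<lambda>n. \<bar>(T x - S n x) / real (Suc n)\<bar>)"
    using intT by (intro AE_summable_of_summable_means) auto
  then show ?thesis using conv
    by eventually_elim (auto simp: S_def abs_divide simp del: of_nat_Suc)
qed

end

end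

section \<open>The learning process and its noise\<close>

text \<open>
  An update with step size \<open>a\<close> may be expanding while \<open>a \<tau> > 1\<close>, but this happens for boundedly many
  updates only; from then on each update is a convex combination. The bound is uniform in the set \<open>U\<close> of
  update epochs, so that it holds for all paths at once.
\<close>

lemma recursion_bounded:
  fixes \<tau> \<gamma> C :: real
  assumes \<tau>: "0 < \<tau>" and \<gamma>: "0 < \<gamma>" and C: "0 \<le> C"
  shows "\<exists>B. \<forall>(u :: nat \<Rightarrow> real) (U :: nat set). u 1 = 0 \<longrightarrow> (\<forall>n\<ge>1. n \<notin> U \<longrightarrow> u (Suc n) = u n) \<longrightarrow>
    (\<forall>n\<ge>1. n \<in> U \<longrightarrow> u (Suc n) \<le> \<bar>1 - \<gamma> / real (\<Sum>j=1..n. of_bool (j \<in> U)) * \<tau>\<bar> * u n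
       + \<gamma> / real (\<Sum>j=1..n. of_bool (j \<in> U)) * C) \<longrightarrow>
    (\<forall>n\<ge>1. 0 \<le> u n) \<longrightarrow> (\<forall>n\<ge>1. u n \<le> B)"
proof -
  \<comment> \<open>An update multiplies any bound that is at least \<open>C / \<tau>\<close> by at most \<open>\<beta>\<close>, and at most \<open>J\<close> updates are expanding.\<close>
  define \<beta> where "\<beta> = 1 + 2 * (\<gamma> * \<tau>)"
  define b where "b j = C / \<tau> * \<beta> ^ j" for j :: nat
  define J where "J = nat \<lceil>\<gamma> * \<tau>\<rceil>"
  have gt: "0 < \<gamma> * \<tau>" using \<tau> \<gamma> by simp
  then have \<beta>: "1 \<le> \<beta>" by (simp add: \<beta>_def)
  have b0: "0 \<le> C / \<tau>" using C \<tau> by simp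
  have bge: "C / \<tau> \<le> b j" for j
    using mult_left_mono[OF one_le_power[OF \<beta>, of j] b0] by (simp add: b_def)
  show ?thesis
  proof (rule exI[of _ "b J"], intro allI impI)
    fix u :: "nat \<Rightarrow> real" and U :: "nat set" and m :: nat
    assume u1: "u 1 = 0" and stay: "\<forall>n\<ge>1. n \<notin> U \<longrightarrow> u (Suc n) = u n"
      and move: "\<forall>n\<ge>1. n \<in> U \<longrightarrow> u (Suc n) \<le> \<bar>1 - \<gamma> / real (\<Sum>j=1..n. of_bool (j \<in> U)) * \<tau>\<bar> * u n
        + \<gamma> / real (\<Sum>j=1..n. of_bool (j \<in> U)) * C"
      and u0: "\<forall>n\<ge>1. 0 \<le> u n" and m: "1 \<le> m"
    define N where "N n = (\<Sum>j=1..n. of_bool (j \<in> U) :: nat)" for n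
    have "u (Suc n) \<le> b (min (N n) J)" for n
    proof (induction n)
      case 0
      then show ?case using u1 bge[of 0] b0 by (simp add: N_def)
    next
      case (Suc n)
      show ?case
      proof (cases "Suc n \<in> U")
        case False
        then show ?thesis using stay Suc by (simp add: N_def)
      next
        case True
        then have NS: "N (Suc n) = Suc (N n)" by (simp add: N_def)
        define a where "a = \<gamma> / real (N (Suc n))"
        have a: "0 < a" "a \<le> \<gamma>" using \<gamma> by (auto simp: a_def NS divide_le_eq mult_le_cancel_left1)
        have un: "0 \<le> u (Suc n)" using u0 by simp
        have mv: "u (Suc (Suc n)) \<le> \<bar>1 - a * \<tau>\<bar> * u (Suc n) + a * C"
          using move[rule_format, OF _ True] by (simp add: a_def N_def)
        show ?thesis
        proof (cases "Suc (N n) \<le> J")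
          case True
          have "a * \<tau> \<le> \<gamma> * \<tau>" "0 < a * \<tau>" using a \<tau> by simp_all
          then have "\<bar>1 - a * \<tau>\<bar> \<le> 1 + \<gamma> * \<tau>" by linarith
          then have "\<bar>1 - a * \<tau>\<bar> * u (Suc n) \<le> (1 + \<gamma> * \<tau>) * b (N n)"
            using Suc True un gt by (intro mult_mono) auto
          moreover have "a * C \<le> \<gamma> * \<tau> * b (N n)"
          proof -
            have "a * C \<le> \<gamma> * C" using a C by (intro mult_right_mono) auto
            also have "\<dots> = \<gamma> * \<tau> * (C / \<tau>)" using \<tau> by simp
            also have "\<dots> \<le> \<gamma> * \<tau> * b (N n)" using gt bge by (intro mult_left_mono) auto
            finally show ?thesis .
          qed
          ultimately have "u (Suc (Suc n)) \<le> (1 + \<gamma> * \<tau>) * b (N n) + \<gamma> * \<tau> * b (N n)" using mv by linarith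
          also have "\<dots> = \<beta> * b (N n)" by (simp add: \<beta>_def algebra_simps)
          also have "\<dots> = b (Suc (N n))" by (simp add: b_def)
          finally show ?thesis using True by (simp add: NS)
        next
          case False
          then have J: "J < Suc (N n)" by simp
          have "\<gamma> * \<tau> \<le> real J" unfolding J_def by (rule real_nat_ceiling_ge)
          also have "\<dots> \<le> real (N (Suc n))" using J by (simp add: NS)
          finally have at: "a * \<tau> \<le> 1" by (simp add: a_def NS field_simps)
          have "\<bar>1 - a * \<tau>\<bar> * u (Suc n) \<le> (1 - a * \<tau>) * b J"
            using Suc J at un by (intro mult_mono) auto
          moreover have "a * C = a * \<tau> * (C / \<tau>)" using \<tau> by simp
          moreover have "a * \<tau> * (C / \<tau>) \<le> a * \<tau> * b J" using a \<tau> bge by (intro mult_left_mono) auto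
          ultimately have "u (Suc (Suc n)) \<le> b J" using mv by (simp add: algebra_simps)
          then show ?thesis using J by (simp add: NS min_def)
        qed
      qed
    qed
    from this[of "m - 1"] have "u m \<le> b (min (N (m - 1)) J)" using m by simp
    also have "\<dots> \<le> b J"
      unfolding b_def using \<beta> b0 by (intro mult_left_mono power_increasing) auto
    finally show "u m \<le> b J" .
  qed
qed

lemma real_cond_exp_inner:
  fixes Z W :: "'a \<Rightarrow> complex^'n::finite^'n"
  assumes sub: "sigma_finite_subalgebra M H" and ce: "has_cond_exp M H Z W"
    and int: "\<And>i j. integrable M (\<lambda>\<omega>. Re (Z \<omega> $ i $ j))" "\<And>i j. integrable M (\<lambda>\<omega>. Im (Z \<omega> $ i $ j))"
  shows "AE \<omega> in M. real_cond_exp M H (\<lambda>\<omega>. Z \<omega> \<bullet> c) \<omega> = W \<omega> \<bullet> c"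
proof -
  interpret sigma_finite_subalgebra M H by fact
  define f where "f p \<omega> = Re (c $ fst p $ snd p) * Re (Z \<omega> $ fst p $ snd p)
    + Im (c $ fst p $ snd p) * Im (Z \<omega> $ fst p $ snd p)" for p :: "'n \<times> 'n" and \<omega>
  have inner: "A \<bullet> c = (\<Sum>p\<in>UNIV. Re (c $ fst p $ snd p) * Re (A $ fst p $ snd p)
    + Im (c $ fst p $ snd p) * Im (A $ fst p $ snd p))" for A :: "complex^'n^'n"
  proof -
    have "A \<bullet> c = (\<Sum>i\<in>UNIV. \<Sum>j\<in>UNIV. Re (c $ i $ j) * Re (A $ i $ j) + Im (c $ i $ j) * Im (A $ i $ j))"
      by (simp add: inner_vec_def inner_complex_def mult.commute)
    then show ?thesis by (simp add: sum.cartesian_product case_prod_unfold)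
  qed
  have fint: "integrable M (f p)" for p
    unfolding f_def by (intro Bochner_Integration.integrable_add integrable_mult_right int)
  have "AE \<omega> in M. real_cond_exp M H (f p) \<omega> = Re (c $ fst p $ snd p) * Re (W \<omega> $ fst p $ snd p)
    + Im (c $ fst p $ snd p) * Im (W \<omega> $ fst p $ snd p)" for p
  proof -
    have "AE \<omega> in M. real_cond_exp M H (\<lambda>\<omega>. Re (Z \<omega> $ fst p $ snd p)) \<omega> = Re (W \<omega> $ fst p $ snd p)"
      "AE \<omega> in M. real_cond_exp M H (\<lambda>\<omega>. Im (Z \<omega> $ fst p $ snd p)) \<omega> = Im (W \<omega> $ fst p $ snd p)"
      using ce by (auto simp: has_cond_exp_def)
    moreover have "AE \<omega> in M. real_cond_exp M H (f p) \<omega>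
      = real_cond_exp M H (\<lambda>\<omega>. Re (c $ fst p $ snd p) * Re (Z \<omega> $ fst p $ snd p)) \<omega>
      + real_cond_exp M H (\<lambda>\<omega>. Im (c $ fst p $ snd p) * Im (Z \<omega> $ fst p $ snd p)) \<omega>"
      unfolding f_def by (intro real_cond_exp_add integrable_mult_right int)
    moreover note real_cond_exp_cmult[OF int(1)[of "fst p" "snd p"], of "Re (c $ fst p $ snd p)"]
      real_cond_exp_cmult[OF int(2)[of "fst p" "snd p"], of "Im (c $ fst p $ snd p)"]
    ultimately show ?thesis by eventually_elim simp
  qed
  then have "AE \<omega> in M. \<forall>p. real_cond_exp M H (f p) \<omega> = Re (c $ fst p $ snd p) * Re (W \<omega> $ fst p $ snd p)
    + Im (c $ fst p $ snd p) * Im (W \<omega> $ fst p $ snd p)"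
    by (subst AE_all_countable) auto
  moreover have "AE \<omega> in M. real_cond_exp M H (\<lambda>\<omega>. \<Sum>p\<in>UNIV. f p \<omega>) \<omega> = (\<Sum>p\<in>UNIV. real_cond_exp M H (f p) \<omega>)"
    by (rule real_cond_exp_sum[OF fint])
  ultimately have "AE \<omega> in M. real_cond_exp M H (\<lambda>\<omega>. \<Sum>p\<in>UNIV. f p \<omega>) \<omega> = W \<omega> \<bullet> c"
    by eventually_elim (simp add: inner del: split_paired_All)
  then show ?thesis by (simp only: f_def inner)
qed

locale async_learning = smooth_convex_problem I F V + prob_space M
  for I :: "'k::finite \<Rightarrow> 'n::finite set"
    and F :: "('n, 'k) profile \<Rightarrow> real" and V :: "('n, 'k) profile \<Rightarrow> ('n, 'k) profile"
    and M :: "'a measure" +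
  fixes \<tau> \<gamma> :: real and Ks :: "nat \<Rightarrow> 'a \<Rightarrow> 'k set" and Vhat Y X :: "nat \<Rightarrow> 'a \<Rightarrow> ('n, 'k) profile"
  assumes \<tau>: "0 < \<tau>" and \<gamma>: "0 < \<gamma>"
    and recursion: "async_recursion I \<tau> \<gamma> M Ks Vhat Y X"
    and Ks_measurable: "\<And>n. 1 \<le> n \<Longrightarrow> Ks n \<in> measurable M (count_space UNIV)"
    and rates: "positive_update_rates M Ks"
    and estimates: "bounded_hermitian_estimates I M Vhat"
    and unbiased: "\<And>n k. 1 \<le> n \<Longrightarrow> has_cond_exp M (history M Ks X n) (\<lambda>\<omega>. Vhat n \<omega> $ k)
                     (\<lambda>\<omega>. V (delayed_profile Ks X n \<omega>) $ k)"
begin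

abbreviation N :: "'k \<Rightarrow> nat \<Rightarrow> 'a \<Rightarrow> nat" where
  "N k n \<omega> \<equiv> update_count Ks k n \<omega>"

definition step_size :: "'k \<Rightarrow> nat \<Rightarrow> 'a \<Rightarrow> real" where
  "step_size k n \<omega> = \<gamma> / real (N k n \<omega>) * of_bool (k \<in> Ks n \<omega>)"

text \<open>
  The traceless parts of the dual variables follow the same recursion and determine the iterates.
\<close>

definition y :: "nat \<Rightarrow> 'a \<Rightarrow> ('n, 'k) profile" where
  "y n \<omega> = (\<chi> k. center (I k) (Y n \<omega> $ k))"

lemma step_size_nonneg: "0 \<le> step_size k n \<omega>"
  using \<gamma> by (simp add: step_size_def)

lemma recursionD:
  assumes "\<omega> \<in> space M"
  shows "Y 1 \<omega> $ k = 0"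
    and "1 \<le> n \<Longrightarrow> Y (Suc n) \<omega> $ k = Y n \<omega> $ k - step_size k n \<omega> *\<^sub>R (Vhat n \<omega> $ k + \<tau> *\<^sub>R Y n \<omega> $ k)"
    and "1 \<le> n \<Longrightarrow> X n \<omega> $ k = gibbs (I k) (Y n \<omega> $ k)"
  using recursion assms unfolding async_recursion_def step_size_def by auto

lemma Vhat_corner:
  assumes "1 \<le> n" "\<omega> \<in> space M"
  shows "Vhat n \<omega> $ k \<in> corner (I k)" "hermitian (Vhat n \<omega> $ k)"
  using estimates assms by (auto simp: bounded_hermitian_estimates_def)

lemma Y_corner:
  assumes \<omega>: "\<omega> \<in> space M" and n: "1 \<le> n"
  shows "Y n \<omega> $ k \<in> corner (I k) \<and> hermitian (Y n \<omega> $ k)"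
  using n
proof (induction n rule: dec_induct)
  case base
  then show ?case
    unfolding recursionD(1)[OF \<omega>] by (intro conjI subspace_0[OF subspace_corner] hermitian_0)
next
  case (step n)
  then show ?case
    using Vhat_corner[OF step(1) \<omega>]
    by (auto simp: recursionD(2)[OF \<omega> step(1)] intro!: hermitian_diff hermitian_scaleR hermitian_add
        subspace_diff[OF subspace_corner] subspace_scale[OF subspace_corner] subspace_add[OF subspace_corner])
qed

lemma y_traceless: "\<omega> \<in> space M \<Longrightarrow> 1 \<le> n \<Longrightarrow> y n \<omega> \<in> traceless_profiles"
  using Y_corner by (simp add: y_def traceless_profiles_def center_corner center_hermitian inner_center_corner_one nonempty)

lemma y_step:
  assumes "\<omega> \<in> space M" "1 \<le> n"
  shows "y (Suc n) \<omega> $ k = y n \<omega> $ k - step_size k n \<omega> *\<^sub>R (center (I k) (Vhat n \<omega> $ k) + \<tau> *\<^sub>R y n \<omega> $ k)"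
  by (simp add: y_def recursionD(2)[OF assms] linear_diff[OF linear_center] linear_scale[OF linear_center]
      linear_add[OF linear_center])

lemma X_eq: "\<omega> \<in> space M \<Longrightarrow> 1 \<le> n \<Longrightarrow> X n \<omega> = gibbs_profile (y n \<omega>)"
  using Y_corner by (simp add: vec_eq_iff y_def gibbs_profile_def recursionD(3) gibbs_center nonempty)

lemma y_1: "\<omega> \<in> space M \<Longrightarrow> y 1 \<omega> = 0"
  unfolding y_def recursionD(1) by (simp add: vec_eq_iff linear_0[OF linear_center])

lemma X_feasible: "\<omega> \<in> space M \<Longrightarrow> 1 \<le> n \<Longrightarrow> X n \<omega> \<in> feasible I"
  by (simp add: X_eq gibbs_profile_feasible y_traceless)

lemma delayed_profile_feasible:
  assumes "\<omega> \<in> space M" "1 \<le> n"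
  shows "delayed_profile Ks X n \<omega> \<in> feasible I"
proof -
  have "1 \<le> n - delay Ks l n \<omega>" for l
  proof -
    let ?S = "insert 1 {j \<in> {1..n}. l \<in> Ks j \<omega>}"
    have "Max ?S \<in> ?S" by (rule Max_in) auto
    then have "1 \<le> Max ?S" "Max ?S \<le> n" using assms(2) by auto
    then show ?thesis by (simp add: delay_def)
  qed
  then show ?thesis using X_feasible[OF assms(1)] by (simp add: feasible_def delayed_profile_def)
qed

lemma update_indicator_measurable:
  "1 \<le> n \<Longrightarrow> Ks n \<in> measurable H (count_space UNIV) \<Longrightarrow> (\<lambda>\<omega>. of_bool (k \<in> Ks n \<omega>) :: real) \<in> borel_measurable H"
  by (rule measurable_compose[where g = "\<lambda>A. of_bool (k \<in> A)"]) auto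

lemma update_count_measurable:
  assumes "\<And>j. 1 \<le> j \<Longrightarrow> j \<le> n \<Longrightarrow> Ks j \<in> measurable H (count_space UNIV)"
  shows "(\<lambda>\<omega>. real (N k n \<omega>)) \<in> borel_measurable H"
  unfolding update_count_def of_nat_sum of_nat_of_bool
  using assms by (intro borel_measurable_sum update_indicator_measurable) auto

lemma step_size_measurable:
  assumes "1 \<le> n" "\<And>j. 1 \<le> j \<Longrightarrow> j \<le> n \<Longrightarrow> Ks j \<in> measurable H (count_space UNIV)"
  shows "step_size k n \<in> borel_measurable H"
  unfolding step_size_def
  using assms by (intro borel_measurable_times borel_measurable_divide update_count_measurable
      update_indicator_measurable) auto

lemma component_measurable: "Z \<in> borel_measurable H \<Longrightarrow> (\<lambda>\<omega>. Z \<omega> $ k) \<in> borel_measurable H"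
  for Z :: "'a \<Rightarrow> ('n, 'k) profile"
  by (rule measurable_compose[where g = "\<lambda>X. X $ k"])
     (auto intro!: borel_measurable_continuous_onI continuous_on_component continuous_on_id)

lemma Vhat_measurable: "1 \<le> n \<Longrightarrow> (\<lambda>\<omega>. Vhat n \<omega> $ k) \<in> borel_measurable M"
  using estimates unfolding bounded_hermitian_estimates_def by (intro component_measurable) blast

lemma center_measurable: "center S \<in> borel_measurable borel"
  by (intro borel_measurable_continuous_onI linear_continuous_on)
     (simp add: linear_center flip: linear_conv_bounded_linear)

lemma profile_measurable:
  fixes Z :: "'a \<Rightarrow> ('n, 'k) profile"
  assumes "\<And>k. (\<lambda>\<omega>. Z \<omega> $ k) \<in> borel_measurable H"
  shows "Z \<in> borel_measurable H"
proof (rule borel_measurable_euclidean_space[THEN iffD2], rule ballI)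
  fix b :: "('n, 'k) profile" assume "b \<in> Basis"
  then obtain k c where b: "b = axis k c" by (auto simp: Basis_vec_def)
  show "(\<lambda>\<omega>. Z \<omega> \<bullet> b) \<in> borel_measurable H"
    unfolding b inner_axis using assms by (intro borel_measurable_inner) auto
qed

lemma y_measurable: "1 \<le> n \<Longrightarrow> y n \<in> borel_measurable M"
proof (induction n rule: dec_induct)
  case base
  then show ?case by (subst measurable_cong[OF y_1]) auto
next
  case (step n)
  have "(\<lambda>\<omega>. y (Suc n) \<omega> $ k) \<in> borel_measurable M" for k
  proof (subst measurable_cong[OF y_step[OF _ step(1)]])
    have "(\<lambda>\<omega>. y n \<omega> $ k) \<in> borel_measurable M"
      by (rule component_measurable[OF step(3)])
    moreover have "(\<lambda>\<omega>. center (I k) (Vhat n \<omega> $ k)) \<in> borel_measurable M"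
      by (rule measurable_compose[OF Vhat_measurable[OF step(1)] center_measurable])
    moreover have "step_size k n \<in> borel_measurable M" using step(1) Ks_measurable by (intro step_size_measurable) auto
    ultimately show "(\<lambda>\<omega>. y n \<omega> $ k - step_size k n \<omega> *\<^sub>R (center (I k) (Vhat n \<omega> $ k) + \<tau> *\<^sub>R y n \<omega> $ k)) \<in> borel_measurable M"
      by measurable
  qed
  then show ?case by (rule profile_measurable)
qed

lemma continuous_on_gibbs_profile: "continuous_on traceless_profiles gibbs_profile"
proof -
  obtain l where l: "0 \<le> l" "\<And>Y Y'. Y \<in> traceless_profiles \<Longrightarrow> Y' \<in> traceless_profiles \<Longrightarrow>
     norm (gibbs_profile Y - gibbs_profile Y') \<le> l * norm (Y - Y')"
    using gibbs_profile_lipschitz by metis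
  have "l-lipschitz_on traceless_profiles gibbs_profile" by (rule lipschitz_onI) (auto simp: dist_norm l)
  then show ?thesis by (rule lipschitz_on_continuous_on)
qed

lemma X_measurable:
  assumes n: "1 \<le> n"
  shows "X n \<in> borel_measurable M"
proof (subst measurable_cong[OF X_eq[OF _ n]])
  have "y n \<in> measurable M (restrict_space borel traceless_profiles)"
    using y_traceless[OF _ n] y_measurable[OF n] by (intro measurable_restrict_space2) auto
  then show "(\<lambda>\<omega>. gibbs_profile (y n \<omega>)) \<in> borel_measurable M"
    by (rule measurable_compose[OF _ borel_measurable_continuous_on_restrict[OF continuous_on_gibbs_profile]])
qed

lemma space_history [simp]: "space (history M Ks X n) = space M"
  unfolding history_def by (rule space_measure_of) auto

lemma history_sets:
  "sets (history M Ks X n) = sigma_sets (space M)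
     (\<Union>m\<in>{1..n}. {X m -` B \<inter> space M | B. B \<in> sets borel} \<union> {Ks m -` S \<inter> space M | S. S \<in> UNIV})"
  unfolding history_def by (rule sets_measure_of) auto

lemma history_X:
  assumes "1 \<le> m" "m \<le> n"
  shows "X m \<in> borel_measurable (history M Ks X n)"
proof (rule measurableI)
  fix B :: "('n, 'k) profile set" assume "B \<in> sets borel"
  then show "X m -` B \<inter> space (history M Ks X n) \<in> sets (history M Ks X n)"
    unfolding history_sets space_history using assms by (intro sigma_sets.Basic UN_I[of m]) auto
qed simp

lemma history_Ks:
  assumes "1 \<le> m" "m \<le> n"
  shows "Ks m \<in> measurable (history M Ks X n) (count_space UNIV)"
proof (rule measurableI)
  fix S :: "'k set set"
  show "Ks m -` S \<inter> space (history M Ks X n) \<in> sets (history M Ks X n)"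
    unfolding history_sets space_history using assms by (intro sigma_sets.Basic UN_I[of m]) auto
qed simp

lemma history_subalgebra: "subalgebra M (history M Ks X n)"
proof -
  have "sets (history M Ks X n) \<subseteq> sets M"
    unfolding history_sets
  proof (rule sets.sigma_sets_subset, safe)
    fix m and B :: "('n, 'k) profile set" assume "m \<in> {1..n}" "B \<in> sets borel"
    then show "X m -` B \<inter> space M \<in> sets M" using measurable_sets[OF X_measurable] by auto
  next
    fix m and S :: "'k set set" assume "m \<in> {1..n}"
    then show "Ks m -` S \<inter> space M \<in> sets M" using measurable_sets[OF Ks_measurable, of m S] by auto
  qed
  then show ?thesis by (simp add: subalgebra_def)
qed

lemma history_sigma_finite: "sigma_finite_subalgebra M (history M Ks X n)"
  by (intro finite_measure_subalgebra_is_sigma_finite finite_measure_subalgebra.intro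
      finite_measure_subalgebra_axioms.intro finite_measure_axioms history_subalgebra)

lemma history_mono: "m \<le> n \<Longrightarrow> subalgebra (history M Ks X n) (history M Ks X m)"
  unfolding subalgebra_def history_sets by (intro conjI sigma_sets_mono' UN_mono) auto

lemma estimates_bounded:
  obtains C where "0 \<le> C" "AE \<omega> in M. \<forall>n\<ge>1. \<forall>k. norm (Vhat n \<omega> $ k) \<le> C"
proof -
  obtain C where C: "\<And>n k. 1 \<le> n \<Longrightarrow> AE \<omega> in M. norm (Vhat n \<omega> $ k) \<le> C"
    using estimates unfolding bounded_hermitian_estimates_def by blast
  have "AE \<omega> in M. norm (Vhat n \<omega> $ k) \<le> \<bar>C\<bar>" if "1 \<le> n" for n k
    using C[OF that, of k] by eventually_elim (rule order_trans[OF _ abs_ge_self])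
  then have "AE \<omega> in M. \<forall>n k. 1 \<le> n \<longrightarrow> norm (Vhat n \<omega> $ k) \<le> \<bar>C\<bar>"
    by (simp add: AE_all_countable)
  then have "AE \<omega> in M. \<forall>n\<ge>1. \<forall>k. norm (Vhat n \<omega> $ k) \<le> \<bar>C\<bar>" by eventually_elim auto
  then show thesis by (intro that[of "\<bar>C\<bar>"]) auto
qed

lemma y_bounded:
  assumes C: "0 \<le> C"
  obtains B where "0 \<le> B" "\<And>\<omega> n. \<omega> \<in> space M \<Longrightarrow> (\<forall>n\<ge>1. \<forall>k. norm (Vhat n \<omega> $ k) \<le> C) \<Longrightarrow> 1 \<le> n \<Longrightarrow> norm (y n \<omega>) \<le> B"
proof -
  obtain b where b: "\<forall>(u :: nat \<Rightarrow> real) (U :: nat set). u 1 = 0 \<longrightarrow> (\<forall>n\<ge>1. n \<notin> U \<longrightarrow> u (Suc n) = u n) \<longrightarrow>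
    (\<forall>n\<ge>1. n \<in> U \<longrightarrow> u (Suc n) \<le> \<bar>1 - \<gamma> / real (\<Sum>j=1..n. of_bool (j \<in> U)) * \<tau>\<bar> * u n
       + \<gamma> / real (\<Sum>j=1..n. of_bool (j \<in> U)) * C) \<longrightarrow>
    (\<forall>n\<ge>1. 0 \<le> u n) \<longrightarrow> (\<forall>n\<ge>1. u n \<le> b)"
    using recursion_bounded[OF \<tau> \<gamma> C] by (elim exE) (rule that)
  have comp: "norm (y n \<omega> $ k) \<le> b"
    if \<omega>: "\<omega> \<in> space M" and V: "\<forall>n\<ge>1. \<forall>k. norm (Vhat n \<omega> $ k) \<le> C" and n: "1 \<le> n" for \<omega> n k
  proof (rule b[rule_format, where u = "\<lambda>n. norm (y n \<omega> $ k)" and U = "{j. k \<in> Ks j \<omega>}", OF _ _ _ _ n])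
    show "norm (y 1 \<omega> $ k) = 0" using y_1[OF \<omega>] by simp
    show "norm (y (Suc n) \<omega> $ k) = norm (y n \<omega> $ k)" if "1 \<le> n" "n \<notin> {j. k \<in> Ks j \<omega>}" for n
      using y_step[OF \<omega> that(1), of k] that(2) by (simp add: step_size_def)
    fix n assume n: "1 \<le> n" "n \<in> {j. k \<in> Ks j \<omega>}"
    define a where "a = \<gamma> / real (\<Sum>j=1..n. of_bool (j \<in> {j. k \<in> Ks j \<omega>}))"
    have a: "step_size k n \<omega> = a" using n(2) by (simp add: step_size_def a_def update_count_def)
    then have a0: "0 \<le> a" using step_size_nonneg by metis
    have "y (Suc n) \<omega> $ k = (1 - a * \<tau>) *\<^sub>R y n \<omega> $ k - a *\<^sub>R center (I k) (Vhat n \<omega> $ k)"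
      using y_step[OF \<omega> n(1), of k] by (simp add: a algebra_simps)
    also have "norm \<dots> \<le> \<bar>1 - a * \<tau>\<bar> * norm (y n \<omega> $ k) + a * norm (center (I k) (Vhat n \<omega> $ k))"
      by (rule order_trans[OF norm_triangle_ineq4]) (simp add: a0)
    also have "norm (center (I k) (Vhat n \<omega> $ k)) \<le> C" using norm_center_le V n(1) order_trans by blast
    finally show "norm (y (Suc n) \<omega> $ k) \<le> \<bar>1 - a * \<tau>\<bar> * norm (y n \<omega> $ k) + a * C"
      using a0 by (simp add: mult_left_mono)
  qed simp
  have "norm (y n \<omega>) \<le> CARD('k) * \<bar>b\<bar>"
    if "\<omega> \<in> space M" "\<forall>n\<ge>1. \<forall>k. norm (Vhat n \<omega> $ k) \<le> C" "1 \<le> n" for \<omega> n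
    using comp[OF that] by (intro norm_profile_le) (rule order_trans[OF _ abs_ge_self])
  then show thesis by (intro that[of "CARD('k) * \<bar>b\<bar>"]) auto
qed

text \<open>
  The history contains the iterates but not the dual variables. It still determines their traceless
  parts: these stay in a compact set, on which the Gibbs map is injective, so that its inverse is
  continuous on the image.
\<close>

lemma centered_dual_from_iterate:
  obtains \<Lambda> :: "('n, 'k) profile \<Rightarrow> ('n, 'k) profile"
  where "\<Lambda> \<in> borel_measurable borel" "\<And>Z. Z \<in> traceless_profiles \<Longrightarrow> norm Z \<le> B \<Longrightarrow> \<Lambda> (gibbs_profile Z) = Z"
proof -
  define K where "K = cball 0 B \<inter> traceless_profiles"
  have K: "compact K" unfolding K_def by (intro compact_Int_closed closed_subspace subspace_traceless) simp
  have cont: "continuous_on K gibbs_profile"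
    by (rule continuous_on_subset[OF continuous_on_gibbs_profile]) (auto simp: K_def)
  have inj: "inj_on gibbs_profile K"
  proof (rule inj_onI)
    fix Z Z' assume Z: "Z \<in> K" "Z' \<in> K" and eq: "gibbs_profile Z = gibbs_profile Z'"
    obtain c where c: "0 < c" "\<And>Y Y' k. Y \<in> traceless_profiles \<Longrightarrow> Y' \<in> traceless_profiles \<Longrightarrow> norm Y \<le> B \<Longrightarrow> norm Y' \<le> B \<Longrightarrow>
       c * (norm (Y $ k - Y' $ k))\<^sup>2 \<le> (Y $ k - Y' $ k) \<bullet> (gibbs_profile Y $ k - gibbs_profile Y' $ k)"
      using gibbs_profile_strongly_monotone[of B] by metis
    have "c * (norm (Z $ k - Z' $ k))\<^sup>2 \<le> 0" for k
      using c(2)[of Z Z' k] Z eq by (simp add: K_def)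
    then have "Z $ k = Z' $ k" for k using c(1) by (simp add: mult_le_0_iff)
    then show "Z = Z'" by (simp add: vec_eq_iff)
  qed
  define \<Lambda> where "\<Lambda> W = (if W \<in> gibbs_profile ` K then the_inv_into K gibbs_profile W else 0)" for W
  show thesis
  proof (rule that)
    have "closed (gibbs_profile ` K)" by (intro compact_imp_closed compact_continuous_image cont K)
    then show "\<Lambda> \<in> borel_measurable borel"
      unfolding \<Lambda>_def
      by (intro borel_measurable_continuous_on_if continuous_on_inv_into cont K inj continuous_on_const) auto
    show "\<Lambda> (gibbs_profile Z) = Z" if "Z \<in> traceless_profiles" "norm Z \<le> B" for Z
    proof -
      have "Z \<in> K" using that by (simp add: K_def)
      then show ?thesis by (simp add: \<Lambda>_def the_inv_into_f_f[OF inj])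
    qed
  qed
qed

end

context async_learning
begin

text \<open>
  The noise of one agent in one direction, up to the epochs at which the agent has updated at least at
  rate \<open>\<rho>\<close>. This truncation is decided by the history and makes the \<open>n\<close>-th term of size \<open>O(1/n)\<close> uniformly
  over almost all paths; as the actual rates are positive, it removes finitely many terms once \<open>\<rho>\<close> is small.
\<close>

definition truncated_noise :: "real \<Rightarrow> 'k \<Rightarrow> complex^'n^'n \<Rightarrow> nat \<Rightarrow> 'a \<Rightarrow> real" where
  "truncated_noise \<rho> k c j \<omega> = of_bool (\<rho> * real (Suc j) \<le> real (N k (Suc j) \<omega>)) * step_size k (Suc j) \<omega> *
     (Vhat (Suc j) \<omega> $ k \<bullet> center (I k) c - V (delayed_profile Ks X (Suc j) \<omega>) $ k \<bullet> center (I k) c)"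

text \<open>
  Given the history the noise has mean zero, and earlier noise is almost surely a function of the
  history; hence the terms are orthogonal.
\<close>

lemma truncated_noise_series:
  assumes \<rho>: "0 < \<rho>"
  shows "AE \<omega> in M. \<exists>T. (\<lambda>n. \<Sum>j<n. truncated_noise \<rho> k c j \<omega>) \<longlonglongrightarrow> T \<and>
    summable (\<lambda>n. \<bar>T - (\<Sum>j<n. truncated_noise \<rho> k c j \<omega>)\<bar> / real (Suc n))"
proof -
  let ?H = "\<lambda>n. history M Ks X n"
  have Suc1: "1 \<le> Suc j" for j by simp
  define w where "w n \<omega> = of_bool (\<rho> * real n \<le> real (N k n \<omega>)) * step_size k n \<omega>" for n \<omega>
  define v where "v n \<omega> = Vhat n \<omega> $ k \<bullet> center (I k) c" for n \<omega>
  define g where "g n = real_cond_exp M (?H n) (v n)" for n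
  define \<xi> where "\<xi> j \<omega> = w (Suc j) \<omega> * (v (Suc j) \<omega> - g (Suc j) \<omega>)" for j \<omega>
  obtain C where C: "0 \<le> C" "AE \<omega> in M. \<forall>n\<ge>1. \<forall>k. norm (Vhat n \<omega> $ k) \<le> C"
    by (rule estimates_bounded)
  define D where "D = C * norm (center (I k) c)"
  have D: "0 \<le> D" using C by (simp add: D_def)

  have w_bound: "0 \<le> w n \<omega>" "w n \<omega> \<le> \<gamma> / \<rho> / real n" if n: "1 \<le> n" for n \<omega>
  proof -
    show "0 \<le> w n \<omega>" using step_size_nonneg by (simp add: w_def)
    show "w n \<omega> \<le> \<gamma> / \<rho> / real n"
    proof (cases "\<rho> * real n \<le> real (N k n \<omega>) \<and> k \<in> Ks n \<omega>")
      case True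
      moreover have "0 < \<rho> * real n" using n \<rho> by simp
      ultimately have "\<gamma> / real (N k n \<omega>) \<le> \<gamma> / (\<rho> * real n)"
        using \<gamma> by (intro divide_left_mono mult_pos_pos[of "real (N k n \<omega>)" "\<rho> * real n"]) linarith+
      then show ?thesis using True by (simp add: w_def step_size_def)
    next
      case False
      then have "w n \<omega> = 0" by (auto simp: w_def step_size_def)
      then show ?thesis using \<rho> \<gamma> by simp
    qed
  qed
  have w_history: "w n \<in> borel_measurable (?H n)" if n: "1 \<le> n" for n
  proof -
    have "(\<lambda>\<omega>. real (N k n \<omega>)) \<in> borel_measurable (?H n)" "step_size k n \<in> borel_measurable (?H n)"
      using n history_Ks by (auto intro!: update_count_measurable step_size_measurable)
    then show ?thesis unfolding w_def by measurable
  qed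
  have to_M: "f \<in> borel_measurable M" if "f \<in> borel_measurable (?H n)" for f :: "'a \<Rightarrow> real" and n
    using measurable_from_subalg[OF history_subalgebra that] .
  have v_meas: "v n \<in> borel_measurable M" if "1 \<le> n" for n
    unfolding v_def using Vhat_measurable[OF that] by measurable
  have v_bound: "AE \<omega> in M. \<bar>v n \<omega>\<bar> \<le> D" if n: "1 \<le> n" for n
    using C(2)
  proof eventually_elim
    case (elim \<omega>)
    have "\<bar>v n \<omega>\<bar> \<le> norm (Vhat n \<omega> $ k) * norm (center (I k) c)" unfolding v_def by (rule Cauchy_Schwarz_ineq2)
    also have "\<dots> \<le> D" unfolding D_def using elim n by (intro mult_right_mono) auto
    finally show ?case .
  qed
  have v_int: "integrable M (v n)" if "1 \<le> n" for n
    using v_bound[OF that] v_meas[OF that] by (intro integrable_const_bound[of _ D]) auto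
  have g_history: "g n \<in> borel_measurable (?H n)" for n unfolding g_def by (rule borel_measurable_cond_exp)
  have g_bound: "AE \<omega> in M. \<bar>g n \<omega>\<bar> \<le> D" if n: "1 \<le> n" for n
  proof -
    have "AE \<omega> in M. g n \<omega> \<le> D" "AE \<omega> in M. - D \<le> g n \<omega>"
      unfolding g_def using v_bound[OF n]
      by (auto intro!: sigma_finite_subalgebra.real_cond_exp_le_c[OF history_sigma_finite v_int[OF n]]
          sigma_finite_subalgebra.real_cond_exp_ge_c[OF history_sigma_finite v_int[OF n]])
    then show ?thesis by eventually_elim auto
  qed
  have g_eq: "AE \<omega> in M. g n \<omega> = V (delayed_profile Ks X n \<omega>) $ k \<bullet> center (I k) c" if n: "1 \<le> n" for n
    unfolding g_def v_def
  proof (rule real_cond_exp_inner[OF history_sigma_finite unbiased[OF n]])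
    note m = Vhat_measurable[OF n, of k]
    have entry: "(\<lambda>\<omega>. Vhat n \<omega> $ k $ i $ j) \<in> borel_measurable M" for i j
      by (rule measurable_compose[OF m, of "\<lambda>A. A $ i $ j"])
         (auto intro!: borel_measurable_continuous_onI continuous_on_component continuous_on_id)
    have le: "AE \<omega> in M. cmod (Vhat n \<omega> $ k $ i $ j) \<le> C" for i j
      using C(2)
    proof eventually_elim
      case (elim \<omega>)
      have "cmod (Vhat n \<omega> $ k $ i $ j) \<le> norm (Vhat n \<omega> $ k $ i)"
        by (rule Finite_Cartesian_Product.norm_nth_le)
      also have "\<dots> \<le> norm (Vhat n \<omega> $ k)" by (rule Finite_Cartesian_Product.norm_nth_le)
      also have "\<dots> \<le> C" using elim n by blast
      finally show ?case .
    qed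
    show "integrable M (\<lambda>\<omega>. Re (Vhat n \<omega> $ k $ i $ j))" for i j
      using le[of i j] entry[of i j]
      by (intro integrable_const_bound[of _ C]) (auto elim!: eventually_mono intro: order_trans[OF abs_Re_le_cmod])
    show "integrable M (\<lambda>\<omega>. Im (Vhat n \<omega> $ k $ i $ j))" for i j
      using le[of i j] entry[of i j]
      by (intro integrable_const_bound[of _ C]) (auto elim!: eventually_mono intro: order_trans[OF abs_Im_le_cmod])
  qed

  have \<xi>_meas: "\<xi> j \<in> borel_measurable M" for j
    unfolding \<xi>_def using to_M[OF w_history, of "Suc j"] to_M[OF g_history] v_meas[of "Suc j"] by measurable
  define E where "E = \<gamma> / \<rho> * (D + D)"
  have E: "0 \<le> E" using \<gamma> \<rho> D by (simp add: E_def)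
  have \<xi>_bound: "AE \<omega> in M. \<bar>\<xi> j \<omega>\<bar> \<le> E / real (Suc j)" for j
    using v_bound[OF Suc1[of j]] g_bound[OF Suc1[of j]]
  proof eventually_elim
    case (elim \<omega>)
    have "\<bar>v (Suc j) \<omega> - g (Suc j) \<omega>\<bar> \<le> D + D" using elim by auto
    moreover have "0 \<le> w (Suc j) \<omega>" "w (Suc j) \<omega> \<le> \<gamma> / \<rho> / real (Suc j)" by (rule w_bound, simp)+
    ultimately have "\<bar>\<xi> j \<omega>\<bar> \<le> \<gamma> / \<rho> / real (Suc j) * (D + D)"
      unfolding \<xi>_def abs_mult by (intro mult_mono) auto
    then show ?case by (simp add: E_def)
  qed

  obtain B where B: "0 \<le> B" "\<And>\<omega> n. \<omega> \<in> space M \<Longrightarrow> (\<forall>n\<ge>1. \<forall>k. norm (Vhat n \<omega> $ k) \<le> C) \<Longrightarrow> 1 \<le> n \<Longrightarrow> norm (y n \<omega>) \<le> B"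
    by (rule y_bounded[OF C(1)]) (rule that)
  obtain \<Lambda> where \<Lambda>: "\<Lambda> \<in> borel_measurable borel" "\<And>Z. Z \<in> traceless_profiles \<Longrightarrow> norm Z \<le> B \<Longrightarrow> \<Lambda> (gibbs_profile Z) = Z"
    by (rule centered_dual_from_iterate[of B]) (rule that)
  \<comment> \<open>Solving the recursion for the estimate shows that past noise is a function of the history.\<close>
  define \<eta> where "\<eta> j \<omega> = of_bool (\<rho> * real (Suc j) \<le> real (N k (Suc j) \<omega>)) *
    ((1 - step_size k (Suc j) \<omega> * \<tau>) * (\<Lambda> (X (Suc j) \<omega>) $ k \<bullet> c) - \<Lambda> (X (Suc (Suc j)) \<omega>) $ k \<bullet> c)
    - w (Suc j) \<omega> * g (Suc j) \<omega>" for j \<omega>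
  have \<eta>_eq: "AE \<omega> in M. \<xi> j \<omega> = \<eta> j \<omega>" for j
    using C(2) AE_space
  proof eventually_elim
    case (elim \<omega>)
    have \<Lambda>X: "\<Lambda> (X n \<omega>) = y n \<omega>" if "1 \<le> n" for n
      using \<Lambda>(2)[OF y_traceless B(2)] elim that X_eq by simp
    have "step_size k (Suc j) \<omega> * v (Suc j) \<omega>
      = (1 - step_size k (Suc j) \<omega> * \<tau>) * (y (Suc j) \<omega> $ k \<bullet> c) - y (Suc (Suc j)) \<omega> $ k \<bullet> c"
      unfolding y_step[OF elim(2) Suc1[of j]] v_def inner_center[symmetric]
      by (simp add: inner_diff_left inner_add_left algebra_simps)
    then show ?case by (simp add: \<xi>_def \<eta>_def w_def \<Lambda>X right_diff_distrib)
  qed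
  have \<eta>_history: "\<eta> j \<in> borel_measurable (?H n)" if "Suc (Suc j) \<le> n" for j n
  proof -
    have \<Lambda>X: "(\<lambda>\<omega>. \<Lambda> (X m \<omega>) $ k) \<in> borel_measurable (?H n)" if "1 \<le> m" "m \<le> n" for m
      by (rule component_measurable[OF measurable_compose[OF history_X[OF that] \<Lambda>(1)]])
    have sub: "f \<in> borel_measurable (?H n)" if "f \<in> borel_measurable (?H (Suc j))" for f :: "'a \<Rightarrow> real"
      using measurable_from_subalg[OF history_mono that] \<open>Suc (Suc j) \<le> n\<close> by simp
    have "(\<lambda>\<omega>. real (N k (Suc j) \<omega>)) \<in> borel_measurable (?H n)" "step_size k (Suc j) \<in> borel_measurable (?H n)"
      using that history_Ks by (auto intro!: update_count_measurable step_size_measurable)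
    moreover have "w (Suc j) \<in> borel_measurable (?H n)" "g (Suc j) \<in> borel_measurable (?H n)"
      by (rule sub[OF w_history[OF Suc1[of j]]], rule sub[OF g_history])
    moreover have "(\<lambda>\<omega>. \<Lambda> (X (Suc j) \<omega>) $ k) \<in> borel_measurable (?H n)"
      "(\<lambda>\<omega>. \<Lambda> (X (Suc (Suc j)) \<omega>) $ k) \<in> borel_measurable (?H n)"
      using that by (intro \<Lambda>X, simp, simp)+
    ultimately show ?thesis unfolding \<eta>_def by measurable
  qed
  have orth: "expectation (\<lambda>\<omega>. \<xi> i \<omega> * \<xi> j \<omega>) = 0" if ij: "i < j" for i j
  proof -
    let ?n = "Suc j"
    define f where "f \<omega> = \<eta> i \<omega> * w ?n \<omega>" for \<omega>
    have f_history: "f \<in> borel_measurable (?H ?n)"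
      unfolding f_def using \<eta>_history[of i ?n] w_history[OF Suc1[of j]] ij by (intro borel_measurable_times) auto
    have f_bound: "AE \<omega> in M. \<bar>f \<omega>\<bar> \<le> E * (\<gamma> / \<rho>)"
      using \<xi>_bound[of i] \<eta>_eq[of i]
    proof eventually_elim
      case (elim \<omega>)
      have le: "x / real (Suc m) \<le> x" if "0 \<le> x" for x m
        using divide_left_mono[of 1 "real (Suc m)" x] that by simp
      have "E / real (Suc i) \<le> E" "\<gamma> / \<rho> / real ?n \<le> \<gamma> / \<rho>" using E \<gamma> \<rho> by (intro le; simp)+
      moreover have "0 \<le> w ?n \<omega>" "w ?n \<omega> \<le> \<gamma> / \<rho> / real ?n" by (rule w_bound, simp)+
      ultimately show ?case unfolding f_def abs_mult using elim E by (intro mult_mono) auto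
    qed
    have prod_int: "integrable M (\<lambda>\<omega>. f \<omega> * h \<omega>)"
      if h: "h \<in> borel_measurable M" and "AE \<omega> in M. \<bar>h \<omega>\<bar> \<le> D" for h
    proof (rule integrable_const_bound[of _ "E * (\<gamma> / \<rho>) * D"])
      show "AE \<omega> in M. norm (f \<omega> * h \<omega>) \<le> E * (\<gamma> / \<rho>) * D"
        using f_bound that(2)
      proof eventually_elim
        case (elim \<omega>)
        have "\<bar>f \<omega>\<bar> * \<bar>h \<omega>\<bar> \<le> E * (\<gamma> / \<rho>) * D" using elim E \<gamma> \<rho> by (intro mult_mono) auto
        then show ?case by (simp only: real_norm_def abs_mult)
      qed
      show "(\<lambda>\<omega>. f \<omega> * h \<omega>) \<in> borel_measurable M" using to_M[OF f_history] h by measurable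
    qed
    note fv = prod_int[OF v_meas[OF Suc1[of j]] v_bound[OF Suc1[of j]]] and fg = prod_int[OF to_M[OF g_history] g_bound[OF Suc1[of j]]]
    have "expectation (\<lambda>\<omega>. \<xi> i \<omega> * \<xi> j \<omega>) = expectation (\<lambda>\<omega>. f \<omega> * v ?n \<omega> - f \<omega> * g ?n \<omega>)"
    proof (rule integral_cong_AE)
      show "(\<lambda>\<omega>. \<xi> i \<omega> * \<xi> j \<omega>) \<in> borel_measurable M" using \<xi>_meas by (intro borel_measurable_times)
      show "(\<lambda>\<omega>. f \<omega> * v ?n \<omega> - f \<omega> * g ?n \<omega>) \<in> borel_measurable M"
        using to_M[OF f_history] v_meas[OF Suc1[of j]] to_M[OF g_history] by measurable
      show "AE \<omega> in M. \<xi> i \<omega> * \<xi> j \<omega> = f \<omega> * v ?n \<omega> - f \<omega> * g ?n \<omega>"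
        using \<eta>_eq[of i] by eventually_elim (simp add: f_def \<xi>_def[of j] algebra_simps)
    qed
    also have "\<dots> = expectation (\<lambda>\<omega>. f \<omega> * v ?n \<omega>) - expectation (\<lambda>\<omega>. f \<omega> * g ?n \<omega>)"
      using fv fg by simp
    also have "expectation (\<lambda>\<omega>. f \<omega> * g ?n \<omega>) = expectation (\<lambda>\<omega>. f \<omega> * v ?n \<omega>)"
      unfolding g_def
      using sigma_finite_subalgebra.real_cond_exp_intg(2)[OF history_sigma_finite _ f_history] fv v_meas[OF Suc1[of j]] by simp
    finally show ?thesis by simp
  qed
  from orthogonal_series_tails[of \<xi>, OF \<xi>_meas \<xi>_bound E orth]
  have "AE \<omega> in M. \<exists>T. (\<lambda>n. \<Sum>j<n. \<xi> j \<omega>) \<longlonglongrightarrow> T \<and> summable (\<lambda>n. \<bar>T - (\<Sum>j<n. \<xi> j \<omega>)\<bar> / real (Suc n))" .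
  moreover have "AE \<omega> in M. \<forall>j. \<xi> j \<omega> = truncated_noise \<rho> k c j \<omega>"
  proof (subst AE_all_countable, rule allI)
    fix j
    show "AE \<omega> in M. \<xi> j \<omega> = truncated_noise \<rho> k c j \<omega>"
      using g_eq[OF Suc1[of j]] by eventually_elim (simp add: \<xi>_def truncated_noise_def w_def v_def)
  qed
  ultimately show ?thesis by eventually_elim simp
qed

definition noise :: "'a \<Rightarrow> nat \<Rightarrow> ('n, 'k) profile" where
  "noise \<omega> j = (\<chi> k. step_size k (Suc j) \<omega> *\<^sub>R
     (center (I k) (Vhat (Suc j) \<omega> $ k) - G (delayed_profile Ks X (Suc j) \<omega>) $ k))"

lemma noise_traceless:
  assumes "\<omega> \<in> space M"
  shows "noise \<omega> j \<in> traceless_profiles"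
proof -
  have "(\<chi> k. center (I k) (Vhat (Suc j) \<omega> $ k)) \<in> traceless_profiles"
    using Vhat_corner[OF _ assms, of "Suc j"]
    by (simp add: traceless_profiles_def center_corner center_hermitian inner_center_corner_one nonempty)
  moreover have "G (delayed_profile Ks X (Suc j) \<omega>) \<in> traceless_profiles"
    using delayed_profile_feasible[OF assms] by (intro G_traceless) simp
  ultimately have "(\<chi> k. center (I k) (Vhat (Suc j) \<omega> $ k)) - G (delayed_profile Ks X (Suc j) \<omega>) \<in> traceless_profiles"
    by (rule subspace_diff[OF subspace_traceless])
  then show ?thesis
    unfolding traceless_profiles_def noise_def
    by (auto intro: subspace_scale[OF subspace_corner] hermitian_scaleR)
qed

text \<open>
  On almost every path the truncated series behave well for all \<open>\<rho> = 1 / (q + 1)\<close> at once, and for one of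
  these the truncation changes finitely many terms only.
\<close>

lemma noise_series:
  "AE \<omega> in M. \<exists>T. (\<lambda>n. \<Sum>j<n. noise \<omega> j) \<longlonglongrightarrow> T \<and> summable (\<lambda>n. norm (T - (\<Sum>j<n. noise \<omega> j)) / real (Suc n))"
proof -
  have "AE \<omega> in M. \<forall>k. \<exists>r>0. (\<lambda>n. real (N k n \<omega>) / real n) \<longlonglongrightarrow> r"
    using rates by (subst AE_all_countable) (simp add: positive_update_rates_def)
  moreover have "AE \<omega> in M. \<forall>q. \<forall>k. \<forall>c\<in>Basis. \<exists>T. (\<lambda>n. \<Sum>j<n. truncated_noise (1 / real (Suc q)) k c j \<omega>) \<longlonglongrightarrow> T \<and>
    summable (\<lambda>n. \<bar>T - (\<Sum>j<n. truncated_noise (1 / real (Suc q)) k c j \<omega>)\<bar> / real (Suc n))"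
    unfolding AE_all_countable
    by (intro allI AE_ball_countable[THEN iffD2] ballI truncated_noise_series) (auto simp: countable_finite)
  ultimately show ?thesis
  proof eventually_elim
    case (elim \<omega>)
    define S where "S n = (\<Sum>j<n. noise \<omega> j)" for n
    have "\<exists>T. (\<lambda>n. S n \<bullet> b) \<longlonglongrightarrow> T \<and> summable (\<lambda>n. \<bar>T - S n \<bullet> b\<bar> / real (Suc n))" if "b \<in> Basis" for b
    proof -
      obtain k c where b: "b = axis k c" "c \<in> Basis" using \<open>b \<in> Basis\<close> by (subst (asm) Basis_vec_def) auto
      obtain r where r: "0 < r" "(\<lambda>n. real (N k n \<omega>) / real n) \<longlonglongrightarrow> r" using elim(1) by blast
      obtain q where q: "1 / real (Suc q) < r" using nat_approx_posE[OF r(1)] by blast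
      let ?t = "\<lambda>j. truncated_noise (1 / real (Suc q)) k c j \<omega>"
      obtain T where T: "(\<lambda>n. \<Sum>j<n. ?t j) \<longlonglongrightarrow> T" "summable (\<lambda>n. \<bar>T - (\<Sum>j<n. ?t j)\<bar> / real (Suc n))"
        using elim(2) b(2) by blast
      obtain n0 where n0: "\<And>n. n0 \<le> n \<Longrightarrow> 1 / real (Suc q) * real n \<le> real (N k n \<omega>)"
        using count_ge[OF r(2) q] unfolding eventually_sequentially by blast
      have eq: "noise \<omega> j \<bullet> b = ?t j" if "n0 \<le> j" for j
      proof -
        have "1 / real (Suc q) * real (Suc j) \<le> real (N k (Suc j) \<omega>)" using n0[of "Suc j"] that by simp
        then show ?thesis
          by (simp add: b inner_axis noise_def truncated_noise_def G_def inner_diff_left inner_center)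
      qed
      define d where "d = S n0 \<bullet> b - (\<Sum>j<n0. ?t j)"
      have Sd: "S n \<bullet> b = d + (\<Sum>j<n. ?t j)" if "n0 \<le> n" for n
        using that
      proof (induction n rule: dec_induct)
        case (step n)
        then show ?case by (simp add: S_def inner_add_left eq)
      qed (simp add: d_def)
      have ev: "\<forall>\<^sub>F n in sequentially. d + (\<Sum>j<n. ?t j) = S n \<bullet> b"
        using eventually_ge_at_top[of n0] by eventually_elim (simp add: Sd)
      have "(\<lambda>n. S n \<bullet> b) \<longlonglongrightarrow> d + T"
        by (rule Lim_transform_eventually[OF tendsto_add[OF tendsto_const T(1)] ev])
      moreover have "summable (\<lambda>n. \<bar>(d + T) - S n \<bullet> b\<bar> / real (Suc n))"
        using T(2)
      proof (rule summable_cong[THEN iffD1, rotated])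
        show "\<forall>\<^sub>F n in sequentially. \<bar>T - (\<Sum>j<n. ?t j)\<bar> / real (Suc n) = \<bar>(d + T) - S n \<bullet> b\<bar> / real (Suc n)"
          using eventually_ge_at_top[of n0] by eventually_elim (simp add: Sd)
      qed
      ultimately show ?thesis by blast
    qed
    then have "\<forall>b\<in>Basis. \<exists>T. (\<lambda>n. S n \<bullet> b) \<longlonglongrightarrow> T \<and> summable (\<lambda>n. \<bar>T - S n \<bullet> b\<bar> / real (Suc n))" ..
    from bchoice[OF this] obtain t where
      "\<forall>b\<in>Basis. (\<lambda>n. S n \<bullet> b) \<longlonglongrightarrow> t b \<and> summable (\<lambda>n. \<bar>t b - S n \<bullet> b\<bar> / real (Suc n))" ..
    then have t: "(\<lambda>n. S n \<bullet> b) \<longlonglongrightarrow> t b" "summable (\<lambda>n. \<bar>t b - S n \<bullet> b\<bar> / real (Suc n))"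
      if "b \<in> Basis" for b using that by simp_all
    define T where "T = (\<Sum>b\<in>Basis. t b *\<^sub>R b)"
    have Tb: "T \<bullet> b = t b" if "b \<in> Basis" for b using that by (simp add: T_def)
    have "S \<longlonglongrightarrow> T" unfolding tendsto_componentwise_iff[of S] using t(1) Tb by simp
    moreover have "summable (\<lambda>n. norm (T - S n) / real (Suc n))"
    proof (rule summable_comparison_test')
      show "summable (\<lambda>n. \<Sum>b\<in>Basis. \<bar>t b - S n \<bullet> b\<bar> / real (Suc n))" by (intro summable_sum t(2))
      fix n
      have "norm (T - S n) \<le> (\<Sum>b\<in>Basis. \<bar>(T - S n) \<bullet> b\<bar>)" by (rule norm_le_l1)
      also have "\<dots> = (\<Sum>b\<in>Basis. \<bar>t b - S n \<bullet> b\<bar>)" by (intro sum.cong) (auto simp: inner_diff_left Tb)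
      finally show "norm (norm (T - S n) / real (Suc n)) \<le> (\<Sum>b\<in>Basis. \<bar>t b - S n \<bullet> b\<bar> / real (Suc n))"
        by (simp add: divide_right_mono flip: sum_divide_distrib)
    qed
    ultimately show ?case unfolding S_def by blast
  qed
qed

lemma delayed_profile_close:
  assumes \<omega>: "\<omega> \<in> space M" and C: "\<forall>n\<ge>1. \<forall>k. norm (Vhat n \<omega> $ k) \<le> C" and B: "\<And>n. 1 \<le> n \<Longrightarrow> norm (y n \<omega>) \<le> B"
  shows "\<exists>c. \<forall>n\<ge>1. \<forall>k. 0 < N k n \<omega> \<longrightarrow>
    norm (delayed_profile Ks X n \<omega> $ k - gibbs_profile (y n \<omega>) $ k) \<le> c / real (N k n \<omega>)"
proof -
  obtain l where l: "0 \<le> l" "\<And>Y Y' k. Y \<in> traceless_profiles \<Longrightarrow> Y' \<in> traceless_profiles \<Longrightarrow>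
     norm (gibbs_profile Y $ k - gibbs_profile Y' $ k) \<le> l * norm (Y $ k - Y' $ k)"
    using gibbs_profile_lipschitz by metis
  have C0: "0 \<le> C" using C norm_ge_zero order_trans by (metis order_refl)
  have B0: "0 \<le> B" using B[of 1] norm_ge_zero[of "y 1 \<omega>"] by linarith
  define c where "c = l * (\<gamma> * (C + \<tau> * B))"
  have c: "0 \<le> c" using l \<gamma> \<tau> C0 B0 by (simp add: c_def)
  have "norm (delayed_profile Ks X n \<omega> $ k - gibbs_profile (y n \<omega>) $ k) \<le> c / real (N k n \<omega>)"
    if n: "1 \<le> n" and N0: "0 < N k n \<omega>" for n k
  proof -
    have dX: "norm (X (Suc j) \<omega> $ k - X j \<omega> $ k) \<le> l * norm (y (Suc j) \<omega> $ k - y j \<omega> $ k)" if "1 \<le> j" for j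
      using l(2)[OF y_traceless[OF \<omega>] y_traceless[OF \<omega> that], of "Suc j"] X_eq[OF \<omega>] that by simp
    have "norm (X (n - (n - Max (insert 1 {j \<in> {1..n}. j \<in> {j. k \<in> Ks j \<omega>}}))) \<omega> $ k - X n \<omega> $ k) \<le> c / real (N k n \<omega>)"
    proof (rule last_update_close[where v = "\<lambda>j. X j \<omega> $ k" and N = "\<lambda>n. N k n \<omega>"])
      show "N k n \<omega> = (\<Sum>j=1..n. of_bool (j \<in> {j. k \<in> Ks j \<omega>}))" by (simp add: update_count_def)
      show "0 < N k n \<omega>" "1 \<le> n" "0 \<le> c" by (rule N0 n c)+
      fix j :: nat assume j: "1 \<le> j"
      show "X (Suc j) \<omega> $ k = X j \<omega> $ k" if "j \<notin> {j. k \<in> Ks j \<omega>}"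
        using recursionD(3)[OF \<omega>, of j k] recursionD(3)[OF \<omega>, of "Suc j" k] recursionD(2)[OF \<omega> j, of k] that j
        by (simp add: step_size_def)
      assume "j \<in> {j. k \<in> Ks j \<omega>}"
      then have s: "step_size k j \<omega> = \<gamma> / real (N k j \<omega>)" by (simp add: step_size_def)
      have "norm (center (I k) (Vhat j \<omega> $ k) + \<tau> *\<^sub>R y j \<omega> $ k) \<le> norm (center (I k) (Vhat j \<omega> $ k)) + \<tau> * norm (y j \<omega> $ k)"
        by (rule order_trans[OF norm_triangle_ineq]) (use \<tau> in simp)
      also have "norm (center (I k) (Vhat j \<omega> $ k)) \<le> C" using norm_center_le C j order_trans by blast
      also have "\<tau> * norm (y j \<omega> $ k) \<le> \<tau> * B"
        using B[OF j] norm_profile_component[of "y j \<omega>" k] \<tau> by (intro mult_left_mono) auto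
      finally have "norm (y (Suc j) \<omega> $ k - y j \<omega> $ k) \<le> step_size k j \<omega> * (C + \<tau> * B)"
        using step_size_nonneg[of k j \<omega>] by (simp add: y_step[OF \<omega> j] mult_left_mono)
      from mult_left_mono[OF this l(1)] dX[OF j]
      show "norm (X (Suc j) \<omega> $ k - X j \<omega> $ k) \<le> c / real (\<Sum>i=1..j. of_bool (i \<in> {j. k \<in> Ks j \<omega>}))"
        by (simp add: s c_def update_count_def)
    qed
    then show ?thesis using X_eq[OF \<omega> n] by (simp add: delayed_profile_def delay_def)
  qed
  then show ?thesis by blast
qed

lemma iterates_converge:
  assumes Z: "Z \<in> traceless_profiles" "G (gibbs_profile Z) = - \<tau> *\<^sub>R Z"
  shows "AE \<omega> in M. (\<lambda>n. X n \<omega>) \<longlonglongrightarrow> gibbs_profile Z"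
proof -
  obtain C where C: "0 \<le> C" "AE \<omega> in M. \<forall>n\<ge>1. \<forall>k. norm (Vhat n \<omega> $ k) \<le> C"
    by (rule estimates_bounded)
  obtain B where B: "0 \<le> B" "\<And>\<omega> n. \<omega> \<in> space M \<Longrightarrow> (\<forall>n\<ge>1. \<forall>k. norm (Vhat n \<omega> $ k) \<le> C) \<Longrightarrow> 1 \<le> n \<Longrightarrow> norm (y n \<omega>) \<le> B"
    by (rule y_bounded[OF C(1)]) (rule that)
  have "AE \<omega> in M. \<forall>k. \<exists>r>0. (\<lambda>n. real (N k n \<omega>) / real n) \<longlonglongrightarrow> r"
    using rates by (subst AE_all_countable) (simp add: positive_update_rates_def)
  then show ?thesis using C(2) noise_series AE_space
  proof eventually_elim
    case (elim \<omega>)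
    note \<omega> = elim(4)
    define S where "S n = (\<Sum>j<n. noise \<omega> j)" for n
    obtain T where T: "S \<longlonglongrightarrow> T" "summable (\<lambda>n. norm (T - S n) / real (Suc n))"
      using elim(3) unfolding S_def by blast
    have S: "S n \<in> traceless_profiles" for n
      unfolding S_def by (intro subspace_sum subspace_traceless noise_traceless \<omega>)
    have Tt: "T \<in> traceless_profiles"
      using closed_sequentially[OF closed_subspace[OF subspace_traceless]] S T(1) by blast
    define s where "s n = T - S (n - 1)" for n
    obtain c where c: "\<forall>n\<ge>1. \<forall>k. 0 < N k n \<omega> \<longrightarrow>
      norm (delayed_profile Ks X n \<omega> $ k - gibbs_profile (y n \<omega>) $ k) \<le> c / real (N k n \<omega>)"
      using delayed_profile_close[OF \<omega> elim(2) B(2)[OF \<omega> elim(2)]] by blast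
    have "(\<lambda>n. gibbs_profile (y n \<omega>)) \<longlonglongrightarrow> gibbs_profile Z"
    proof (rule async_trajectory_converges[OF \<tau> \<gamma>, where K = "\<lambda>n. Ks n \<omega>" and N = "\<lambda>k n. N k n \<omega>" and s = s
          and Xd = "\<lambda>n. delayed_profile Ks X n \<omega>" and B = B and Cd = c])
      show "N k n \<omega> = (\<Sum>j=1..n. of_bool (k \<in> Ks j \<omega>))" for k n by (simp add: update_count_def)
      show "\<exists>r>0. (\<lambda>n. real (N k n \<omega>) / real n) \<longlonglongrightarrow> r" for k using elim(1) by blast
      show "y n \<omega> \<in> traceless_profiles" "norm (y n \<omega>) \<le> B" "delayed_profile Ks X n \<omega> \<in> feasible I" if "1 \<le> n" for n
        using that y_traceless[OF \<omega>] B(2)[OF \<omega> elim(2)] delayed_profile_feasible[OF \<omega>] by blast+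
      show "s n \<in> traceless_profiles" for n unfolding s_def using Tt S by (rule subspace_diff[OF subspace_traceless])
      have lim: "(\<lambda>n. s (Suc n)) \<longlonglongrightarrow> 0" using tendsto_diff[OF tendsto_const[of T] T(1)] by (simp add: s_def)
      then show "s \<longlonglongrightarrow> 0" by (simp only: filterlim_sequentially_Suc)
      show "summable (\<lambda>n. norm (s n) / real n)"
        using T(2) by (subst summable_Suc_iff[symmetric]) (simp add: s_def)
      show "norm (delayed_profile Ks X n \<omega> $ k - gibbs_profile (y n \<omega>) $ k) \<le> c / real (N k n \<omega>)"
        if "1 \<le> n" "0 < N k n \<omega>" for n k using c that by blast
      show "y (Suc n) \<omega> $ k - s (Suc n) $ k = y n \<omega> $ k - s n $ k
        - (\<gamma> / real (N k n \<omega>) * of_bool (k \<in> Ks n \<omega>)) *\<^sub>R (G (delayed_profile Ks X n \<omega>) $ k + \<tau> *\<^sub>R y n \<omega> $ k)"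
        if n: "1 \<le> n" for n k
      proof -
        have "S n = S (n - 1) + noise \<omega> (n - 1)" using n by (cases n) (simp_all add: S_def)
        then have "s (Suc n) = s n - noise \<omega> (n - 1)" by (simp add: s_def)
        then have "s (Suc n) $ k = s n $ k - step_size k n \<omega> *\<^sub>R
          (center (I k) (Vhat n \<omega> $ k) - G (delayed_profile Ks X n \<omega>) $ k)"
          using n by (simp add: noise_def)
        then show ?thesis
          unfolding y_step[OF \<omega> n] step_size_def[symmetric] by (simp add: algebra_simps)
      qed
      show "Z \<in> traceless_profiles" "G (gibbs_profile Z) = - \<tau> *\<^sub>R Z" by (rule Z)+
    qed
    then show ?case
    proof (rule Lim_transform_eventually)
      show "\<forall>\<^sub>F n in sequentially. gibbs_profile (y n \<omega>) = X n \<omega>"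
        using eventually_ge_at_top[of 1] by eventually_elim (simp add: X_eq[OF \<omega>])
    qed
  qed
qed

end

lemma convex_on_expected_cost:
  assumes P: "prob_space P" and conv: "\<And>w. w \<in> space P \<Longrightarrow> convex_on S (\<lambda>X. f X w)"
    and S: "convex S" and int: "\<And>X. X \<in> S \<Longrightarrow> integrable P (f X)"
  shows "convex_on S (expected_cost P f)"
proof (rule convex_onI[OF _ S])
  fix t :: real and X Y assume t: "0 < t" "t < 1" and XY: "X \<in> S" "Y \<in> S"
  let ?Z = "(1 - t) *\<^sub>R X + t *\<^sub>R Y"
  have Z: "?Z \<in> S" using convexD_alt[OF S XY, of t] t by simp
  have "(\<integral>w. f ?Z w \<partial>P) \<le> (\<integral>w. (1 - t) * f X w + t * f Y w \<partial>P)"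
    using t XY conv int Z by (intro integral_mono) (auto intro!: convex_onD)
  also have "\<dots> = (1 - t) * (\<integral>w. f X w \<partial>P) + t * (\<integral>w. f Y w \<partial>P)" using int XY by simp
  finally show "expected_cost P f ?Z \<le> (1 - t) * expected_cost P f X + t * expected_cost P f Y"
    by (simp add: expected_cost_def)
qed

theorem theorem3p8:
  fixes I :: "'k::finite \<Rightarrow> 'n::finite set"
    and P :: "'w measure"
    and f :: "('n, 'k) profile \<Rightarrow> 'w \<Rightarrow> real"
    and F :: "('n, 'k) profile \<Rightarrow> real"
    and V :: "('n, 'k) profile \<Rightarrow> ('n, 'k) profile"
  assumes dims: "\<And>k. I k \<noteq> {}"
    and P: "prob_space P"
    and f_smooth: "\<And>w. w \<in> space P \<Longrightarrow> smooth_on (feasible I) (\<lambda>X. f X w)"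
    and f_convex: "\<And>w. w \<in> space P \<Longrightarrow> convex_on (feasible I) (\<lambda>X. f X w)"
    and F_def: "F = expected_cost P f"
    and F_finite: "\<And>X. X \<in> feasible I \<Longrightarrow> integrable P (f X)"
    and F_smooth: "smooth_on (feasible I) F"
    and V: "\<And>k X. X \<in> feasible I \<Longrightarrow> indiv_gradient I F k X (V X $ k)"
  shows "\<exists>\<epsilon> :: real \<Rightarrow> real. (\<epsilon> \<longlongrightarrow> 0) (at_right 0) \<and>
    (\<forall>\<tau> \<gamma> (M :: 'a measure) Ks Vhat Y X.
       \<tau> > 0 \<longrightarrow> \<gamma> > 0 \<longrightarrow> prob_space M \<longrightarrow>
       async_recursion I \<tau> \<gamma> M Ks Vhat Y X \<longrightarrow>
       (\<forall>k. AE \<omega> in M. \<exists>D. \<forall>n\<ge>1. delay Ks k n \<omega> \<le> D) \<longrightarrow>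
       homogeneous_markov_chain M Ks \<longrightarrow> recurrent_chain M Ks \<longrightarrow> positive_update_rates M Ks \<longrightarrow>
       bounded_hermitian_estimates I M Vhat \<longrightarrow>
       (\<forall>n\<ge>1. \<forall>k. has_cond_exp M (history M Ks X n) (\<lambda>\<omega>. Vhat n \<omega> $ k)
                     (\<lambda>\<omega>. V (delayed_profile Ks X n \<omega>) $ k)) \<longrightarrow>
       (\<exists>Xmin.
          (\<forall>Z. is_arg_min (regularized_cost F \<tau>) (\<lambda>Z. Z \<in> feasible I) Z \<longleftrightarrow> Z = Xmin) \<and>
          (AE \<omega> in M. (\<lambda>n. X n \<omega>) \<longlonglongrightarrow> Xmin) \<and>
          (\<exists>S. is_arg_min (expected_cost P f) (\<lambda>Z. Z \<in> feasible I) S \<and> dist Xmin S \<le> \<epsilon> \<tau>)))"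
proof -
  have convex: "convex_on (feasible I) F"
    unfolding F_def by (rule convex_on_expected_cost[OF P f_convex convex_feasible F_finite])
  interpret smooth_convex_problem I F V
    by unfold_locales (rule dims F_smooth convex V, assumption?)+
  obtain \<epsilon> where \<epsilon>: "(\<epsilon> \<longlongrightarrow> 0) (at_right 0)"
    "\<And>\<tau> X. 0 < \<tau> \<Longrightarrow> is_arg_min (regularized_cost F \<tau>) (\<lambda>Z. Z \<in> feasible I) X \<Longrightarrow>
       \<exists>S. is_arg_min F (\<lambda>Z. Z \<in> feasible I) S \<and> dist X S \<le> \<epsilon> \<tau>"
    using regularized_minimizer_approximates by blast
  show ?thesis
  proof (intro exI[of _ \<epsilon>] conjI allI impI)
    show "(\<epsilon> \<longlongrightarrow> 0) (at_right 0)" by (rule \<epsilon>(1))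
    fix \<tau> \<gamma> :: real and M :: "'a measure" and Ks Vhat Y X
    assume \<tau>: "\<tau> > 0" and \<gamma>: "\<gamma> > 0" and M: "prob_space M"
      and rec: "async_recursion I \<tau> \<gamma> M Ks Vhat Y X"
      and markov: "homogeneous_markov_chain M Ks" and rates: "positive_update_rates M Ks"
      and est: "bounded_hermitian_estimates I M Vhat"
      and unbiased: "\<forall>n\<ge>1. \<forall>k. has_cond_exp M (history M Ks X n) (\<lambda>\<omega>. Vhat n \<omega> $ k)
                     (\<lambda>\<omega>. V (delayed_profile Ks X n \<omega>) $ k)"
    interpret prob_space M by (rule M)
    interpret async_learning I F V M \<tau> \<gamma> Ks Vhat Y X
    proof
      show "Ks n \<in> measurable M (count_space UNIV)" if "1 \<le> n" for n
        using markov that by (simp add: homogeneous_markov_chain_def)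
      show "has_cond_exp M (history M Ks X n) (\<lambda>\<omega>. Vhat n \<omega> $ k) (\<lambda>\<omega>. V (delayed_profile Ks X n \<omega>) $ k)"
        if "1 \<le> n" for n k using unbiased that by blast
    qed (fact \<tau> \<gamma> rec rates est)+
    obtain Z where Z: "Z \<in> traceless_profiles" "G (gibbs_profile Z) = - \<tau> *\<^sub>R Z"
      using equilibrium_exists[OF \<tau>] by blast
    note min = equilibrium_unique_minimizer[OF \<tau> Z]
    show "\<exists>Xmin.
          (\<forall>Z. is_arg_min (regularized_cost F \<tau>) (\<lambda>Z. Z \<in> feasible I) Z \<longleftrightarrow> Z = Xmin) \<and>
          (AE \<omega> in M. (\<lambda>n. X n \<omega>) \<longlonglongrightarrow> Xmin) \<and>
          (\<exists>S. is_arg_min (expected_cost P f) (\<lambda>Z. Z \<in> feasible I) S \<and> dist Xmin S \<le> \<epsilon> \<tau>)"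
    proof (rule exI[of _ "gibbs_profile Z"], intro conjI allI)
      show "AE \<omega> in M. (\<lambda>n. X n \<omega>) \<longlonglongrightarrow> gibbs_profile Z" by (rule iterates_converge[OF Z])
      show "\<exists>S. is_arg_min (expected_cost P f) (\<lambda>Z. Z \<in> feasible I) S \<and> dist (gibbs_profile Z) S \<le> \<epsilon> \<tau>"
        using \<epsilon>(2)[OF \<tau>] min unfolding F_def by blast
    qed (rule min)
  qed
qed

end
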